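(* Let $X$ be a locally uniformly rotund (LUR) reflexive Banach space and let $\Omega\subsetneq X$ be a convex domain with quasihyperbolic metric $k$. Let $x_0,y,y_n\in\Omega$, $n\in\mathbb{N}$, be such that $$k(x_0,y)=k(x_0,y_n)\ \text{ for all } n\in\mathbb{N},\qquad k\Big(x_0,\frac{y+y_n}{2}\Big)\to k(x_0,y)\ \text{ as } n\to\infty .$$ Then $y_n\to y$ in norm as $n\to\infty$. Moreover, if $\Omega$ is symmetric (i.e. $\Omega=-\Omega$), then for every $r>0$ the Minkowski functional of the quasihyperbolic ball $\mathbf{B}_k(0,r)$ is an equivalent LUR norm on $X$.
   Context: $X$ is a real Banach space with $\dim X\ge2$, and a domain is a nonempty open connected set. $X$ (or a norm on it) is locally uniformly rotund (LUR) if for all $x,x_n$ of norm $1$ ($n\in\mathbb{N}$) with $\lim_{n\to\infty}\|\frac{x+x_n}{2}\|=1$ one has $\lim_{n\to\infty}\|x_n-x\|=0$. For a domain $\Omega\subsetneq X$ write $d(x)=\mathrm{dist}(x,\partial\Omega)$. The quasihyperbolic length of a rectifiable path $\gamma$ in $\Omega$ is $\ell_k(\gamma)=\int_\gamma \frac{\|d\gamma\|}{d(\gamma)}$ (integral with respect to norm arc length), and the quasihyperbolic metric is $k(x,y)=\inf_\gamma\ell_k(\gamma)$, the infimum being over all rectifiable paths $\gamma$ in $\Omega$ joining $x$ and $y$. $\mathbf{B}_k(0,r)=\{x\in\Omega: k(0,x)\le r\}$. The Minkowski functional of a set $B$ is $z\mapsto\inf\{\lambda>0: z\in\lambda B\}$.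 *)

theory Defs
  imports "HOL-Analysis.Analysis"
begin

text \<open>The canonical embedding into the bidual is onto; a dual space is the type of bounded linear
  maps into \<^typ>\<open>real\<close>.\<close>

definition reflexive_space :: "'a::real_normed_vector itself \<Rightarrow> bool" where
  "reflexive_space _ \<longleftrightarrow>
     (\<forall>\<phi> :: ('a \<Rightarrow>\<^sub>L real) \<Rightarrow>\<^sub>L real. \<exists>x :: 'a. \<forall>f :: 'a \<Rightarrow>\<^sub>L real.
        blinfun_apply \<phi> f = blinfun_apply f x)"

definition is_norm :: "('a::real_vector \<Rightarrow> real) \<Rightarrow> bool" where
  "is_norm N \<longleftrightarrow>
     (\<forall>x. 0 \<le> N x) \<and> (\<forall>x. N x = 0 \<longleftrightarrow> x = 0) \<and>
     (\<forall>a x. N (a *\<^sub>R x) = \<bar>a\<bar> * N x) \<and> (\<forall>x y. N (x + y) \<le> N x + N y)"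

definition equivalent_norm :: "('a::real_normed_vector \<Rightarrow> real) \<Rightarrow> bool" where
  "equivalent_norm N \<longleftrightarrow>
     is_norm N \<and> (\<exists>c>0. \<exists>C>0. \<forall>x. c * norm x \<le> N x \<and> N x \<le> C * norm x)"

definition locally_uniformly_rotund :: "('a::real_vector \<Rightarrow> real) \<Rightarrow> bool" where
  "locally_uniformly_rotund N \<longleftrightarrow>
     (\<forall>(x :: 'a) (u :: nat \<Rightarrow> 'a).
        N x = 1 \<longrightarrow> (\<forall>n. N (u n) = 1) \<longrightarrow>
        (\<lambda>n. N ((1 / 2) *\<^sub>R (x + u n))) \<longlonglongrightarrow> 1 \<longrightarrow>
        (\<lambda>n. N (u n - x)) \<longlonglongrightarrow> 0)"

definition minkowski_functional :: "'a::real_vector set \<Rightarrow> 'a \<Rightarrow> real" where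
  "minkowski_functional B z = Inf {c. 0 < c \<and> z \<in> (\<lambda>b. c *\<^sub>R b) ` B}"

text \<open>Only finitely many terms of the monotone sequence \<open>t\<close> enter a sum, so these are the
  polygonal lengths over all finite partitions of subintervals of \<open>{a..b}\<close>.\<close>

definition polygonal_lengths ::
    "(real \<Rightarrow> 'a::real_normed_vector) \<Rightarrow> real \<Rightarrow> real \<Rightarrow> real set" where
  "polygonal_lengths g a b =
     {\<Sum>i<n. norm (g (t (Suc i)) - g (t i)) | (n :: nat) (t :: nat \<Rightarrow> real).
        mono t \<and> range t \<subseteq> {a..b}}"

definition rectifiable :: "(real \<Rightarrow> 'a::real_normed_vector) \<Rightarrow> bool" where
  "rectifiable g \<longleftrightarrow> path g \<and> bdd_above (polygonal_lengths g 0 1)"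

definition arc_length :: "(real \<Rightarrow> 'a::real_normed_vector) \<Rightarrow> real \<Rightarrow> real" where
  "arc_length g t = Sup (polygonal_lengths g 0 t)"

text \<open>The arc-length parametrization, for \<open>s\<close> in \<open>{0..arc_length g 1}\<close>. The parameter chosen by
  \<^const>\<open>inv_into\<close> need not be unique, but a rectifiable path is constant on each level set of its
  arc-length function, so the point is.\<close>

definition arc_length_param ::
    "(real \<Rightarrow> 'a::real_normed_vector) \<Rightarrow> real \<Rightarrow> 'a" where
  "arc_length_param g s = g (inv_into {0..1} (arc_length g) s)"

definition qh_length ::
    "'a::real_normed_vector set \<Rightarrow> (real \<Rightarrow> 'a) \<Rightarrow> real" where
  "qh_length \<Omega> g =
     integral {0..arc_length g 1} (\<lambda>s. 1 / infdist (arc_length_param g s) (frontier \<Omega>))"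

definition qh_dist :: "'a::real_normed_vector set \<Rightarrow> 'a \<Rightarrow> 'a \<Rightarrow> real" where
  "qh_dist \<Omega> x y =
     Inf {qh_length \<Omega> g | g.
       rectifiable g \<and> path_image g \<subseteq> \<Omega> \<and> pathstart g = x \<and> pathfinish g = y}"

definition qh_cball :: "'a::real_normed_vector set \<Rightarrow> 'a \<Rightarrow> real \<Rightarrow> 'a set" where
  "qh_cball \<Omega> x r = {y \<in> \<Omega>. qh_dist \<Omega> x y \<le> r}"

end

theory Submission
  imports Defs "HOL-Library.Diagonal_Subsequence"
begin

text \<open>On a convex domain the distance \<open>d\<close> to the boundary is concave. Hence the average
  \<open>\<eta> = (\<gamma> + \<sigma>) / 2\<close> of two curves run at quasihyperbolic speed at most \<open>R\<close> again has speed at most \<open>R\<close>,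
  and \<open>k\<close> is convex. Together with reflexivity, convexity yields geodesics as weak limits of almost
  geodesics.

  Let \<open>\<gamma>\<close> and \<open>\<gamma>\<^sub>n\<close> be geodesics of length \<open>R\<close> from \<open>x\<^sub>0\<close> to \<open>y\<close> and to \<open>y\<^sub>n\<close>, parametrized by \<open>[0, 1]\<close>
  at constant speed. Then \<open>k(x\<^sub>0, \<eta>\<^sub>n(t))\<close> has derivative at most \<open>R\<close>, and the integral of the derivative
  tends to \<open>R\<close>, so along a subsequence the derivatives tend to \<open>R\<close> almost everywhere. This forces
  \<open>\<parallel>\<gamma>' + \<gamma>\<^sub>n'\<parallel> / (d(\<gamma>) + d(\<gamma>\<^sub>n))\<close> to tend to \<open>R\<close>, and local uniform rotundity at \<open>\<gamma>'(t)\<close> gives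
  \<open>\<gamma>\<^sub>n' / d(\<gamma>\<^sub>n) - \<gamma>' / d(\<gamma>) \<rightarrow> 0\<close>. So \<open>\<gamma>\<^sub>n\<close> nearly solves the differential equation
  \<open>\<sigma>' = d(\<sigma>) \<gamma>' / d(\<gamma>)\<close>, which is Lipschitz in \<open>\<sigma>\<close> and solved by \<open>\<gamma>\<close>; by Gronwall \<open>\<gamma>\<^sub>n \<rightarrow> \<gamma>\<close>.

  Derivatives are replaced throughout by slopes over dyadic intervals. For real Lipschitz functions
  these form a bounded martingale and converge almost everywhere along a subsequence; for the
  geodesic \<open>\<gamma>\<close> itself, reflexivity provides a weak limit of the slopes, and local uniform rotundity at
  that limit makes the convergence strong.\<close>

section \<open>Arc length\<close>

text \<open>The slopes of the varying geodesics are never shown to converge. Of each of them only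
  two real functions are differentiated: the distance from the start to the averaged curve, and the
  weighted gap to \<open>\<gamma>\<close>. Only the fixed \<open>\<gamma>\<close> gets a
  vector-valued derivative. Hence countably many real Lipschitz functions matter, and one sequence
  of dyadic levels serves all of them.

  A limit of almost geodesics has to be defined consistently at uncountably many parameters. A fixed
  generalized limit does this at every parameter, and by its linearity the limits at two parameters
  form a weak limit of pairs, so bounds on their distance survive.

  The given length is an integral over the arc-length parametrization. Since the estimates and the
  averaging produce curves with other parametrizations, the infimum is rewritten over 1-Lipschitz
  curves, with \<open>1 / d\<close> integrated over their own parameter interval.\<close>

definition polysum :: "(real \<Rightarrow> 'a::real_normed_vector) \<Rightarrow> nat \<Rightarrow> (nat \<Rightarrow> real) \<Rightarrow> real" where
  "polysum g n t = (\<Sum>i<n. norm (g (t (Suc i)) - g (t i)))"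

lemma polygonal_lengths_eq:
  "polygonal_lengths g a b = {polysum g n t | n t. mono t \<and> range t \<subseteq> {a..b}}"
  by (simp add: polygonal_lengths_def polysum_def)

lemma polysum_in:
  "mono t \<Longrightarrow> range t \<subseteq> {a..b} \<Longrightarrow> polysum g n t \<in> polygonal_lengths g a b"
  unfolding polygonal_lengths_eq by blast

lemma polygonal_lengths_mono:
  "a' \<le> a \<Longrightarrow> b \<le> b' \<Longrightarrow> polygonal_lengths g a b \<subseteq> polygonal_lengths g a' b'"
proof
  fix x assume ab: "a' \<le> a" "b \<le> b'" and "x \<in> polygonal_lengths g a b"
  then obtain n t where t: "x = polysum g n t" "mono t" "range t \<subseteq> {a..b}"
    unfolding polygonal_lengths_eq by blast
  with ab have "range t \<subseteq> {a'..b'}" by (auto simp: image_subset_iff) (meson order_trans)+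
  with t show "x \<in> polygonal_lengths g a' b'" by (simp add: polysum_in)
qed

lemma polygonal_lengths_nonempty:
  assumes "a \<le> b" shows "0 \<in> polygonal_lengths g a b"
proof -
  have "polysum g 0 (\<lambda>_. a) \<in> polygonal_lengths g a b"
    by (rule polysum_in) (use assms in \<open>auto simp: mono_def\<close>)
  then show ?thesis by (simp add: polysum_def)
qed

text \<open>Cutting by \<open>min\<close> and \<open>max\<close> keeps the number of points and the
  monotonicity, so the index of the cut need not be located; the triangle inequality enters only at
  the step that straddles \<open>s\<close>.\<close>

lemma polysum_split:
  assumes "mono t"
  shows "polysum g n t \<le> polysum g n (\<lambda>i. min (t i) s) + polysum g n (\<lambda>i. max (t i) s)"
proof -
  have "norm (g (t (Suc i)) - g (t i)) \<le> norm (g (min (t (Suc i)) s) - g (min (t i) s))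
          + norm (g (max (t (Suc i)) s) - g (max (t i) s))" for i
  proof -
    have "t i \<le> t (Suc i)" using assms by (simp add: mono_def)
    then show ?thesis
      using norm_triangle_ineq[of "g s - g (t i)" "g (t (Suc i)) - g s"]
      by (cases "t (Suc i) \<le> s"; cases "s \<le> t i") (auto simp: min_def max_def)
  qed
  then show ?thesis
    unfolding polysum_def sum.distrib[symmetric] by (intro sum_mono)
qed

lemma sum_lessThan_add: "(\<Sum>i<n + m. f i) = (\<Sum>i<n. f i) + (\<Sum>i<m. f (n + i))"
  for f :: "nat \<Rightarrow> real"
  by (induction m) (simp_all add: add.assoc)

lemma mono_min: "mono t \<Longrightarrow> mono (\<lambda>i. min (t i) s)" for t :: "nat \<Rightarrow> real"
  by (rule monoI) (meson min.mono monoD order_refl)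

lemma mono_max: "mono t \<Longrightarrow> mono (\<lambda>i. max (t i) s)" for t :: "nat \<Rightarrow> real"
  by (rule monoI) (meson max.mono monoD order_refl)

text \<open>The two partitions are listed one after the other. They need not meet in
  \<open>b\<close>, and the step that joins them can only increase the sum; hence an
  inequality.\<close>

lemma polygonal_lengths_concat:
  assumes "p \<in> polygonal_lengths g a b" "q \<in> polygonal_lengths g b c" "a \<le> b" "b \<le> c"
  shows "\<exists>r \<in> polygonal_lengths g a c. p + q \<le> r"
proof -
  obtain n t where t: "p = polysum g n t" "mono t" "range t \<subseteq> {a..b}"
    using assms(1) unfolding polygonal_lengths_eq by blast
  obtain m u where u: "q = polysum g m u" "mono u" "range u \<subseteq> {b..c}"
    using assms(2) unfolding polygonal_lengths_eq by blast
  \<comment> \<open>\<open>t\<close> contributes the \<open>n + 1\<close> points of index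
    \<open>0\<close> to \<open>n\<close>, so step \<open>n\<close> is the joining one and
    \<open>u\<close> starts at index \<open>Suc n\<close>.\<close>
  define v where "v i = (if i \<le> n then t i else u (i - Suc n))" for i
  have tb: "a \<le> t i" "t i \<le> b" for i using t(3) by (auto simp: image_subset_iff)
  have ub: "b \<le> u i" "u i \<le> c" for i using u(3) by (auto simp: image_subset_iff)
  have "mono v"
  proof (rule monoI)
    fix i j :: nat assume "i \<le> j"
    then show "v i \<le> v j"
      using tb(2)[of i] ub(1)[of "j - Suc n"] t(2) u(2)
      by (auto simp: v_def mono_def)
  qed
  moreover have "a \<le> v i" "v i \<le> c" for i
    using tb[of i] ub[of "i - Suc n"] assms(3,4) by (auto simp: v_def)
  then have "range v \<subseteq> {a..c}" by auto
  ultimately have mem: "polysum g (Suc n + m) v \<in> polygonal_lengths g a c"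
    by (rule polysum_in)
  have "polysum g (Suc n + m) v
      = (\<Sum>i<Suc n. norm (g (v (Suc i)) - g (v i))) + (\<Sum>i<m. norm (g (v (Suc (Suc n + i))) - g (v (Suc n + i))))"
    unfolding polysum_def by (rule sum_lessThan_add)
  moreover have "(\<Sum>i<m. norm (g (v (Suc (Suc n + i))) - g (v (Suc n + i)))) = q"
    by (simp add: u(1) polysum_def v_def)
  moreover have "(\<Sum>i<Suc n. norm (g (v (Suc i)) - g (v i))) \<ge> p"
    by (simp add: t(1) polysum_def v_def)
  ultimately show ?thesis using mem by (intro bexI[of _ "polysum g (Suc n + m) v"]) auto
qed

lemma polysum_continuous:
  fixes g :: "real \<Rightarrow> 'a::real_normed_vector"
  assumes "continuous_on {a..b} g" and "\<And>i. continuous_on S (\<lambda>s. T s i)"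
    and "\<And>s i. s \<in> S \<Longrightarrow> T s i \<in> {a..b}"
  shows "continuous_on S (\<lambda>s. polysum g n (T s))"
proof -
  have "continuous_on S (\<lambda>s. g (T s i))" for i
    by (rule continuous_on_compose2[OF assms(1) assms(2)]) (use assms(3) in auto)
  then show ?thesis unfolding polysum_def by (intro continuous_intros)
qed

context
  fixes g :: "real \<Rightarrow> 'a::real_normed_vector"
  assumes rect: "rectifiable g"
begin

lemma rect_cont: "continuous_on {0..1} g"
  using rect by (simp add: rectifiable_def path_def)

lemma rect_bdd: "0 \<le> a \<Longrightarrow> b \<le> 1 \<Longrightarrow> bdd_above (polygonal_lengths g a b)"
  using rect polygonal_lengths_mono[of 0 a b 1 g] bdd_above_mono
  by (auto simp: rectifiable_def)

definition "tvar a b = Sup (polygonal_lengths g a b)"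

lemma polysum_le_tvar:
  assumes "0 \<le> a" "b \<le> 1" "mono t" "range t \<subseteq> {a..b}" shows "polysum g n t \<le> tvar a b"
  unfolding tvar_def by (rule cSup_upper[OF polysum_in rect_bdd]) (use assms in auto)

lemma tvar_add:
  assumes "0 \<le> a" "a \<le> b" "b \<le> c" "c \<le> 1"
  shows "tvar a c = tvar a b + tvar b c"
proof (rule antisym)
  show "tvar a c \<le> tvar a b + tvar b c"
    unfolding tvar_def[of a c]
  proof (rule cSup_least)
    show "polygonal_lengths g a c \<noteq> {}" using polygonal_lengths_nonempty[of a c g] assms by auto
    fix x assume "x \<in> polygonal_lengths g a c"
    then obtain n t where t: "x = polysum g n t" "mono t" "range t \<subseteq> {a..c}"
      unfolding polygonal_lengths_eq by blast
    have tb: "a \<le> t i" "t i \<le> c" for i using t(3) by (auto simp: image_subset_iff)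
    have "polysum g n (\<lambda>i. min (t i) b) \<le> tvar a b"
      by (rule polysum_le_tvar) (use mono_min[OF t(2)] tb assms in \<open>auto simp: min_le_iff_disj\<close>)
    moreover have "polysum g n (\<lambda>i. max (t i) b) \<le> tvar b c"
      by (rule polysum_le_tvar) (use mono_max[OF t(2)] tb assms in \<open>auto simp: le_max_iff_disj\<close>)
    ultimately show "x \<le> tvar a b + tvar b c"
      using polysum_split[OF t(2), of g n b] t(1) by linarith
  qed
next
  have "tvar a b \<le> tvar a c - q" if q: "q \<in> polygonal_lengths g b c" for q
    unfolding tvar_def[of a b]
  proof (rule cSup_least)
    show "polygonal_lengths g a b \<noteq> {}" using polygonal_lengths_nonempty[of a b g] assms by auto
    fix p assume p: "p \<in> polygonal_lengths g a b"
    obtain r where "r \<in> polygonal_lengths g a c" "p + q \<le> r"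
      using polygonal_lengths_concat[OF p q assms(2,3)] by blast
    moreover have "r \<le> tvar a c"
      unfolding tvar_def by (rule cSup_upper[OF \<open>r \<in> _\<close> rect_bdd]) (use assms in auto)
    ultimately show "p \<le> tvar a c - q" by linarith
  qed
  then have "tvar b c \<le> tvar a c - tvar a b"
    unfolding tvar_def[of b c]
    by (intro cSup_least) (use polygonal_lengths_nonempty[of b c g] assms in fastforce)+
  then show "tvar a b + tvar b c \<le> tvar a c" by simp
qed

lemma arc_length_eq_tvar: "arc_length g t = tvar 0 t"
  by (simp add: arc_length_def tvar_def)

lemma norm_le_tvar:
  assumes "0 \<le> a" "a \<le> b" "b \<le> 1" shows "norm (g b - g a) \<le> tvar a b"
proof -
  have "polysum g 1 (\<lambda>i. if i = 0 then a else b) \<le> tvar a b"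
    by (rule polysum_le_tvar) (use assms in \<open>auto simp: mono_def\<close>)
  then show ?thesis by (simp add: polysum_def)
qed

lemma arc_length_0 [simp]: "arc_length g 0 = 0"
  using tvar_add[of 0 0 0] by (simp add: arc_length_eq_tvar)

lemma arc_length_diff:
  assumes "0 \<le> a" "a \<le> b" "b \<le> 1"
  shows "norm (g b - g a) \<le> arc_length g b - arc_length g a"
  using tvar_add[of 0 a b] norm_le_tvar[OF assms] assms by (simp add: arc_length_eq_tvar)

lemma arc_length_mono:
  assumes "0 \<le> a" "a \<le> b" "b \<le> 1" shows "arc_length g a \<le> arc_length g b"
  using arc_length_diff[OF assms] norm_ge_zero[of "g b - g a"] by linarith

text \<open>Both \<open>arc_length g\<close> and \<open>tvar 0 1 - arc_length g\<close> are suprema of continuous functions.\<close>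

lemma arc_length_lower:
  assumes x: "x \<in> {0..1}" and e: "0 < e"
  shows "\<forall>\<^sub>F s in at x within {0..1}. arc_length g x - e < arc_length g s"
proof -
  have "arc_length g x - e < Sup (polygonal_lengths g 0 x)"
    using e by (simp add: arc_length_def)
  then obtain p where p: "p \<in> polygonal_lengths g 0 x" "arc_length g x - e < p"
    by (rule less_cSupE) (use polygonal_lengths_nonempty[of 0 x g] x in auto)
  obtain n t where t: "p = polysum g n t" "mono t" "range t \<subseteq> {0..x}"
    using p(1) unfolding polygonal_lengths_eq by blast
  have tb: "0 \<le> t i" "t i \<le> x" for i using t(3) by (auto simp: image_subset_iff)
  have "continuous_on {0..1} (\<lambda>s. polysum g n (\<lambda>i. min (t i) s))"
    by (rule polysum_continuous[OF rect_cont])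
       (use tb x in \<open>auto intro!: continuous_intros simp: min_le_iff_disj\<close>)
  then have "((\<lambda>s. polysum g n (\<lambda>i. min (t i) s)) \<longlongrightarrow> polysum g n (\<lambda>i. min (t i) x)) (at x within {0..1})"
    using x by (simp add: continuous_on_def)
  moreover have "polysum g n (\<lambda>i. min (t i) x) = p"
    using tb by (simp add: t(1) min_absorb1)
  ultimately have "\<forall>\<^sub>F s in at x within {0..1}. arc_length g x - e < polysum g n (\<lambda>i. min (t i) s)"
    using p(2) by (auto dest: order_tendstoD(1))
  moreover have "\<forall>\<^sub>F s in at x within {0..1}. s \<in> {0..1}"
    by (simp add: eventually_at_filter)
  ultimately show ?thesis
  proof eventually_elim
    case (elim s)
    have "polysum g n (\<lambda>i. min (t i) s) \<le> arc_length g s"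
      unfolding arc_length_eq_tvar
      by (rule polysum_le_tvar) (use elim tb mono_min[OF t(2)] in \<open>auto simp: min_le_iff_disj\<close>)
    with elim show ?case by linarith
  qed
qed

lemma arc_length_upper:
  assumes x: "x \<in> {0..1}" and e: "0 < e"
  shows "\<forall>\<^sub>F s in at x within {0..1}. arc_length g s < arc_length g x + e"
proof -
  have "tvar x 1 - e < Sup (polygonal_lengths g x 1)"
    using e by (simp add: tvar_def)
  then obtain p where p: "p \<in> polygonal_lengths g x 1" "tvar x 1 - e < p"
    by (rule less_cSupE) (use polygonal_lengths_nonempty[of x 1 g] x in auto)
  obtain n t where t: "p = polysum g n t" "mono t" "range t \<subseteq> {x..1}"
    using p(1) unfolding polygonal_lengths_eq by blast
  have tb: "x \<le> t i" "t i \<le> 1" for i using t(3) by (auto simp: image_subset_iff)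
  have "continuous_on {0..1} (\<lambda>s. polysum g n (\<lambda>i. max (t i) s))"
    by (rule polysum_continuous[OF rect_cont])
       (use tb x in \<open>auto intro!: continuous_intros simp: le_max_iff_disj\<close>)
  then have "((\<lambda>s. polysum g n (\<lambda>i. max (t i) s)) \<longlongrightarrow> polysum g n (\<lambda>i. max (t i) x)) (at x within {0..1})"
    using x by (simp add: continuous_on_def)
  moreover have "polysum g n (\<lambda>i. max (t i) x) = p"
    using tb by (simp add: t(1) max_absorb1)
  ultimately have "\<forall>\<^sub>F s in at x within {0..1}. tvar x 1 - e < polysum g n (\<lambda>i. max (t i) s)"
    using p(2) by (auto dest: order_tendstoD(1))
  moreover have "\<forall>\<^sub>F s in at x within {0..1}. s \<in> {0..1}"
    by (simp add: eventually_at_filter)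
  ultimately show ?thesis
  proof eventually_elim
    case (elim s)
    have "polysum g n (\<lambda>i. max (t i) s) \<le> tvar s 1"
      by (rule polysum_le_tvar) (use elim tb mono_max[OF t(2)] in \<open>auto simp: le_max_iff_disj\<close>)
    moreover have "tvar 0 1 = tvar 0 s + tvar s 1" "tvar 0 1 = tvar 0 x + tvar x 1"
      using elim x by (auto intro: tvar_add)
    ultimately show ?case using elim by (simp add: arc_length_eq_tvar)
  qed
qed

lemma arc_length_continuous: "continuous_on {0..1} (arc_length g)"
  unfolding continuous_on_def
proof
  fix x :: real assume x: "x \<in> {0..1}"
  show "(arc_length g \<longlongrightarrow> arc_length g x) (at x within {0..1})"
  proof (rule order_tendstoI)
    fix a assume "a < arc_length g x"
    then show "\<forall>\<^sub>F s in at x within {0..1}. a < arc_length g s"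
      using arc_length_lower[OF x, of "arc_length g x - a"] by simp
  next
    fix a assume "arc_length g x < a"
    then show "\<forall>\<^sub>F s in at x within {0..1}. arc_length g s < a"
      using arc_length_upper[OF x, of "a - arc_length g x"] by simp
  qed
qed

lemma arc_length_image: "arc_length g ` {0..1} = {0..arc_length g 1}"
proof
  show "arc_length g ` {0..1} \<subseteq> {0..arc_length g 1}"
    using arc_length_mono[of 0] arc_length_mono[of _ 1] by auto
  show "{0..arc_length g 1} \<subseteq> arc_length g ` {0..1}"
  proof
    fix s assume "s \<in> {0..arc_length g 1}"
    then show "s \<in> arc_length g ` {0..1}"
      using IVT'[of "arc_length g" 0 s 1] arc_length_continuous by auto
  qed
qed

lemma arc_length_param_arc_length:
  assumes "t \<in> {0..1}" shows "arc_length_param g (arc_length g t) = g t"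
proof -
  define u where "u = inv_into {0..1} (arc_length g) (arc_length g t)"
  have u: "u \<in> {0..1}" "arc_length g u = arc_length g t"
    using assms inv_into_into[of "arc_length g t" "arc_length g" "{0..1}"] f_inv_into_f[of "arc_length g t" "arc_length g" "{0..1}"]
    unfolding u_def by auto
  have "norm (g t - g u) \<le> 0"
  proof (cases "u \<le> t")
    case True
    then show ?thesis using arc_length_diff[of u t] u assms by auto
  next
    case False
    then show ?thesis using arc_length_diff[of t u] u assms by (auto simp: norm_minus_commute)
  qed
  then show ?thesis by (simp add: arc_length_param_def u_def)
qed

lemma arc_length_param_lipschitz: "1-lipschitz_on {0..arc_length g 1} (arc_length_param g)"
proof (rule lipschitz_onI)
  have *: "norm (arc_length_param g r - arc_length_param g s) \<le> \<bar>r - s\<bar>"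
    if r: "r \<le> s" "r \<in> {0..arc_length g 1}" "s \<in> {0..arc_length g 1}" for r s
  proof -
    obtain a where a: "a \<in> {0..1}" "r = arc_length g a" using r(2) unfolding arc_length_image[symmetric] by auto
    obtain b where b: "b \<in> {0..1}" "s = arc_length g b" using r(3) unfolding arc_length_image[symmetric] by auto
    have "norm (g b - g a) \<le> \<bar>r - s\<bar>"
    proof (cases "a \<le> b")
      case True
      then show ?thesis using arc_length_diff[of a b] a b by auto
    next
      case False
      then show ?thesis using arc_length_diff[of b a] a b by (auto simp: norm_minus_commute)
    qed
    then show ?thesis using a b by (simp add: arc_length_param_arc_length norm_minus_commute)
  qed
  fix r s assume "r \<in> {0..arc_length g 1}" "s \<in> {0..arc_length g 1}"
  then show "dist (arc_length_param g r) (arc_length_param g s) \<le> 1 * dist r s"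
    using *[of r s] *[of s r] by (cases "r \<le> s") (auto simp: dist_norm norm_minus_commute)
qed auto

lemma arc_length_param_endpoints:
  "arc_length_param g 0 = pathstart g" "arc_length_param g (arc_length g 1) = pathfinish g"
  using arc_length_param_arc_length[of 0] arc_length_param_arc_length[of 1]
  by (simp_all add: pathstart_def pathfinish_def)

lemma arc_length_param_in_path_image:
  assumes "s \<in> {0..arc_length g 1}" shows "arc_length_param g s \<in> path_image g"
  using assms inv_into_into[of s "arc_length g" "{0..1}"]
  by (auto simp: arc_length_param_def path_image_def arc_length_image)

end

section \<open>Arc length of Lipschitz curves and change of parameter\<close>

lemma polysum_lipschitz:
  assumes "L-lipschitz_on {0..1} g" "mono t" "range t \<subseteq> {0..1}"
  shows "polysum g n t \<le> L * (t n - t 0)"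
proof -
  have tb: "t i \<in> {0..1}" for i using assms(3) by (auto simp: image_subset_iff)
  have "norm (g (t (Suc i)) - g (t i)) \<le> L * (t (Suc i) - t i)" for i
    using lipschitz_onD[OF assms(1) tb[of "Suc i"] tb[of i]] monoD[OF assms(2), of i "Suc i"]
    by (simp add: dist_norm)
  then have "polysum g n t \<le> (\<Sum>i<n. L * (t (Suc i) - t i))"
    unfolding polysum_def by (intro sum_mono)
  then show ?thesis by (simp add: sum_distrib_left[symmetric] sum_lessThan_telescope)
qed

lemma rectifiable_lipschitz:
  assumes L: "L-lipschitz_on {0..1} g"
  shows "rectifiable g"
  unfolding rectifiable_def
proof
  show "path g" using lipschitz_on_continuous_on[OF L] by (simp add: path_def)
  show "bdd_above (polygonal_lengths g 0 1)"
  proof (rule bdd_aboveI)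
    fix x assume "x \<in> polygonal_lengths g 0 1"
    then obtain n t where t: "x = polysum g n t" "mono t" "range t \<subseteq> {0..1}"
      unfolding polygonal_lengths_eq by blast
    have "t n \<in> {0..1}" "t 0 \<in> {0..1}" using t(3) by (auto simp: image_subset_iff)
    then have "t n - t 0 \<le> 1" by simp
    then have "L * (t n - t 0) \<le> L * 1"
      using lipschitz_on_nonneg[OF L] by (rule mult_left_mono)
    then show "x \<le> L" using polysum_lipschitz[OF L t(2,3), of n] t(1) by simp
  qed
qed

lemma arc_length_lipschitz:
  assumes L: "L-lipschitz_on {0..1} g" and ab: "0 \<le> a" "a \<le> b" "b \<le> 1"
  shows "arc_length g b - arc_length g a \<le> L * (b - a)"
proof -
  note rect = rectifiable_lipschitz[OF L]
  have "tvar g a b \<le> L * (b - a)"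
    unfolding tvar_def[OF rect]
  proof (rule cSup_least)
    show "polygonal_lengths g a b \<noteq> {}" using polygonal_lengths_nonempty[of a b g] ab by auto
    fix x assume "x \<in> polygonal_lengths g a b"
    then obtain n t where t: "x = polysum g n t" "mono t" "range t \<subseteq> {a..b}"
      unfolding polygonal_lengths_eq by blast
    have tb: "t i \<in> {a..b}" for i using t(3) by (auto simp: image_subset_iff)
    have "polysum g n t \<le> L * (t n - t 0)"
      by (rule polysum_lipschitz[OF L t(2)]) (use t(3) ab in auto)
    also have "\<dots> \<le> L * (b - a)"
      using tb[of n] tb[of 0] lipschitz_on_nonneg[OF L] by (intro mult_left_mono) auto
    finally show "x \<le> L * (b - a)" using t(1) by simp
  qed
  then show ?thesis using tvar_add[OF rect, of 0 a b] ab by (simp add: arc_length_eq_tvar[OF rect])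
qed

text \<open>Arc length grows no faster than the parameter of a 1-Lipschitz curve, so passing to it
  shortens every stretch of the parameter and, \<open>p\<close> being nonnegative, lowers the
  integral. The arc-length function \<open>B\<close> is only known to be monotone and Lipschitz;
  therefore the substitution is proved by comparing the two integrals on short intervals.\<close>

lemma curve_to_path:
  fixes c :: "real \<Rightarrow> 'a::real_normed_vector" and p :: "'a \<Rightarrow> real"
  assumes T: "0 \<le> T" and c: "1-lipschitz_on {0..T} c"
    and p: "continuous_on (c ` {0..T}) p" "\<And>x. 0 \<le> p x"
  shows "\<exists>g. rectifiable g \<and> path_image g \<subseteq> c ` {0..T} \<and> pathstart g = c 0 \<and> pathfinish g = c T \<and>
           integral {0..arc_length g 1} (\<lambda>s. p (arc_length_param g s)) \<le> integral {0..T} (\<lambda>t. p (c t))"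
proof -
  define g where "g = (\<lambda>t. c (T * t))"
  have "c ` {0..T} \<noteq> {}" using T by auto
  have gL: "T-lipschitz_on {0..1} g"
  proof (rule lipschitz_onI)
    fix x y :: real assume xy: "x \<in> {0..1}" "y \<in> {0..1}"
    have "T * x \<in> {0..T}" "T * y \<in> {0..T}"
      using xy T mult_left_mono[of x 1 T] mult_left_mono[of y 1 T] by auto
    then have "dist (g x) (g y) \<le> 1 * dist (T * x) (T * y)"
      unfolding g_def by (rule lipschitz_onD[OF c])
    also have "\<dots> = T * dist x y"
      using T by (simp add: dist_real_def right_diff_distrib[symmetric] abs_mult)
    finally show "dist (g x) (g y) \<le> T * dist x y" .
  qed (use T in auto)
  note rect = rectifiable_lipschitz[OF gL]
  have "path_image g \<subseteq> c ` {0..T}"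
    using T mult_left_mono[of _ 1 T] by (auto simp: path_image_def g_def)
  moreover have "pathstart g = c 0" "pathfinish g = c T"
    by (simp_all add: g_def pathstart_def pathfinish_def)
  moreover have "integral {0..arc_length g 1} (\<lambda>s. p (arc_length_param g s)) \<le> integral {0..T} (\<lambda>t. p (c t))"
  proof (cases "T = 0")
    case True
    have "arc_length g 1 = 0"
      using arc_length_lipschitz[OF gL, of 0 1] arc_length_mono[OF rect, of 0 1] True
      by (simp add: arc_length_0[OF rect])
    then show ?thesis using True by simp
  next
    case False
    then have T0: "0 < T" using T by simp
    define B where "B t = arc_length g (t / T)" for t
    define h where "h s = p (arc_length_param g s)" for s
    have B0: "B 0 = 0" and BT: "B T = arc_length g 1"
      using T0 by (simp_all add: B_def arc_length_0[OF rect])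
    have Bmono: "B a \<le> B b" if "0 \<le> a" "a \<le> b" "b \<le> T" for a b
      unfolding B_def using that T0 by (intro arc_length_mono[OF rect]) (auto simp: field_simps)
    have Blip: "B b - B a \<le> b - a" if "0 \<le> a" "a \<le> b" "b \<le> T" for a b
    proof -
      have "B b - B a \<le> T * (b / T - a / T)"
        unfolding B_def using that T0 by (intro arc_length_lipschitz[OF gL]) (auto simp: field_simps)
      then show ?thesis using T0 by (simp add: right_diff_distrib)
    qed
    have hB: "h (B t) = p (c t)" if "0 \<le> t" "t \<le> T" for t
      using arc_length_param_arc_length[OF rect, of "t / T"] that T0 by (simp add: h_def B_def g_def)
    have Bcont: "continuous_on {0..T} B"
      unfolding B_def using T0
      by (intro continuous_on_compose2[OF arc_length_continuous[OF rect]] continuous_intros) auto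
    have hcont: "continuous_on {0..B T} h"
      unfolding h_def BT
    proof (rule continuous_on_compose2[OF p(1)])
      show "continuous_on {0..arc_length g 1} (arc_length_param g)"
        by (rule lipschitz_on_continuous_on[OF arc_length_param_lipschitz[OF rect]])
      show "arc_length_param g ` {0..arc_length g 1} \<subseteq> c ` {0..T}"
        using arc_length_param_in_path_image[OF rect] \<open>path_image g \<subseteq> c ` {0..T}\<close> by blast
    qed
    have qcont: "continuous_on {0..T} (\<lambda>t. p (c t))"
      by (rule continuous_on_compose2[OF p(1) lipschitz_on_continuous_on[OF c]]) auto
    have hint: "h integrable_on {B a..B b}" if "0 \<le> a" "a \<le> b" "b \<le> T" for a b
    proof -
      have "{B a..B b} \<subseteq> {0..B T}"
        using Bmono[of 0 a] Bmono[of b T] B0 that by auto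
      then show ?thesis by (intro integrable_continuous_interval continuous_on_subset[OF hcont])
    qed
    have qint: "(\<lambda>t. p (c t)) integrable_on {a..b}" if "0 \<le> a" "b \<le> T" for a b
      by (intro integrable_continuous_interval continuous_on_subset[OF qcont]) (use that in auto)
    have "integral {B 0..B T} h \<le> integral {0..T} (\<lambda>t. p (c t)) + e" if e: "0 < e" for e
    proof -
      \<comment> \<open>On a short interval \<open>p (c t)\<close> stays within \<open>e'\<close> of
        one value, so the left integral exceeds the right one by at most \<open>2 * e'\<close> per
        unit of the parameter, which is \<open>e\<close> over \<open>[0, T]\<close>.\<close>
      define e' where "e' = e / (2 * T)"
      have e': "0 < e'" using e T0 by (simp add: e'_def)
      define P where "P a b \<longleftrightarrow> (0 \<le> a \<and> a \<le> b \<and> b \<le> T \<longrightarrow>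
        integral {B a..B b} h \<le> integral {a..b} (\<lambda>t. p (c t)) + 2 * e' * (b - a))" for a b
      have "P 0 T"
      \<comment> \<open>The bound is additive over adjacent intervals and holds on all short
        intervals around each point, hence on the whole interval.\<close>
      proof (rule Bolzano[OF T])
        fix a b d assume H: "P a b" "P b d" "a \<le> b" "b \<le> d"
        show "P a d"
          unfolding P_def
        proof
          assume ad: "0 \<le> a \<and> a \<le> d \<and> d \<le> T"
          have "integral {B a..B b} h + integral {B b..B d} h = integral {B a..B d} h"
            by (rule Henstock_Kurzweil_Integration.integral_combine) (use ad H in \<open>auto intro!: Bmono hint\<close>)
          moreover have "integral {a..b} (\<lambda>t. p (c t)) + integral {b..d} (\<lambda>t. p (c t))
              = integral {a..d} (\<lambda>t. p (c t))"
            by (rule Henstock_Kurzweil_Integration.integral_combine) (use ad H in \<open>auto intro!: qint\<close>)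
          moreover have "integral {B a..B b} h \<le> integral {a..b} (\<lambda>t. p (c t)) + 2 * e' * (b - a)"
            "integral {B b..B d} h \<le> integral {b..d} (\<lambda>t. p (c t)) + 2 * e' * (d - b)"
            using H ad by (auto simp: P_def)
          ultimately show "integral {B a..B d} h \<le> integral {a..d} (\<lambda>t. p (c t)) + 2 * e' * (d - a)"
            by (simp add: algebra_simps)
        qed
      next
        fix x assume x: "0 \<le> x" "x \<le> T"
        from qcont[unfolded continuous_on_iff, rule_format, of x, OF _ e'] x
        obtain d where d: "0 < d" "\<And>t. t \<in> {0..T} \<Longrightarrow> dist t x < d \<Longrightarrow> dist (p (c t)) (p (c x)) < e'"
          by auto
        have "P a b" if ab: "a \<le> x" "x \<le> b" "b - a < d" for a b
          unfolding P_def
        proof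
          assume r: "0 \<le> a \<and> a \<le> b \<and> b \<le> T"
          have near: "\<bar>p (c t) - p (c x)\<bar> \<le> e'" if "t \<in> {a..b}" for t
          proof -
            have "dist t x < d" using that ab by (auto simp: dist_real_def)
            then show ?thesis using d(2)[of t] that r by (auto simp: dist_real_def)
          qed
          have "h s \<le> p (c x) + e'" if s: "s \<in> {B a..B b}" for s
          proof -
            have "\<exists>t\<ge>a. t \<le> b \<and> B t = s"
              by (rule IVT') (use s r in \<open>auto intro: continuous_on_subset[OF Bcont]\<close>)
            then obtain t where t: "a \<le> t" "t \<le> b" "B t = s" by blast
            then show ?thesis using near[of t] hB[of t] r by auto
          qed
          then have "integral {B a..B b} h \<le> integral {B a..B b} (\<lambda>_. p (c x) + e')"
            by (intro integral_le hint) (use r in auto)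
          also have "\<dots> = (p (c x) + e') * (B b - B a)"
            using Bmono[of a b] r by simp
          \<comment> \<open>The factor is nonnegative, so the shorter range of \<open>B\<close> can
            only lower the integral.\<close>
          also have "\<dots> \<le> (p (c x) + e') * (b - a)"
            using Blip[of a b] r p(2)[of "c x"] e' by (intro mult_left_mono) auto
          also have "\<dots> = (p (c x) - e') * (b - a) + 2 * e' * (b - a)"
            by (simp add: algebra_simps)
          also have "(p (c x) - e') * (b - a) = integral {a..b} (\<lambda>_. p (c x) - e')"
            using r by simp
          also have "\<dots> \<le> integral {a..b} (\<lambda>t. p (c t))"
            by (intro integral_le qint) (use r near in \<open>force simp: abs_le_iff\<close>)+
          finally show "integral {B a..B b} h \<le> integral {a..b} (\<lambda>t. p (c t)) + 2 * e' * (b - a)"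
            by simp
        qed
        with d(1) show "\<exists>d>0. \<forall>a b. a \<le> x \<and> x \<le> b \<and> b - a < d \<longrightarrow> P a b" by blast
      qed
      then show ?thesis using T0 by (simp add: P_def e'_def)
    qed
    then have "integral {B 0..B T} h \<le> integral {0..T} (\<lambda>t. p (c t))" by (rule field_le_epsilon)
    then show ?thesis by (simp add: B0 BT h_def[abs_def])
  qed
  ultimately show ?thesis using rect by blast
qed

section \<open>The quasihyperbolic distance of a convex domain\<close>

locale convex_domain =
  fixes \<Omega> :: "'a::real_normed_vector set"
  assumes open_dom: "open \<Omega>" and convex_dom: "convex \<Omega>"
    and nonempty_dom: "\<Omega> \<noteq> {}" and proper_dom: "\<Omega> \<noteq> UNIV"
begin

abbreviation bdist :: "'a \<Rightarrow> real" where "bdist x \<equiv> infdist x (frontier \<Omega>)"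
abbreviation qh :: "'a \<Rightarrow> 'a \<Rightarrow> real" where "qh \<equiv> qh_dist \<Omega>"

section \<open>The distance to the boundary\<close>

lemma frontier_ne: "frontier \<Omega> \<noteq> {}"
  by (simp add: frontier_eq_empty nonempty_dom proper_dom)

lemma frontier_notin: "f \<in> frontier \<Omega> \<Longrightarrow> f \<notin> \<Omega>"
  using frontier_disjoint_eq open_dom by blast

lemma bdist_pos: "x \<in> \<Omega> \<Longrightarrow> 0 < bdist x"
  using frontier_notin in_closed_iff_infdist_zero[OF frontier_closed frontier_ne, of x]
    infdist_nonneg[of x "frontier \<Omega>"] by fastforce

lemma bdist_lipschitz: "\<bar>bdist x - bdist y\<bar> \<le> norm (x - y)"
  using infdist_triangle_abs[of x "frontier \<Omega>" y] by (simp add: dist_norm)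

text \<open>A ball is connected: if it met both \<open>\<Omega>\<close> and the complement, it would
  contain a frontier point closer to \<open>x\<close> than the distance allows.\<close>

lemma ball_bdist_subset:
  assumes "x \<in> \<Omega>" shows "ball x (bdist x) \<subseteq> \<Omega>"
proof
  fix z assume z: "z \<in> ball x (bdist x)"
  show "z \<in> \<Omega>"
  proof (rule ccontr)
    assume "z \<notin> \<Omega>"
    moreover have "x \<in> ball x (bdist x)" using bdist_pos[OF assms] by simp
    ultimately have "ball x (bdist x) \<inter> frontier \<Omega> \<noteq> {}"
      using z assms by (intro connected_Int_frontier connected_ball) blast+
    then obtain f where "f \<in> frontier \<Omega>" "dist x f < bdist x" by auto
    then show False using infdist_le[of f "frontier \<Omega>" x] by simp
  qed
qed

text \<open>A frontier point \<open>f\<close> with \<open>norm (f - m) < D\<close> would lie inside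
  \<open>\<Omega>\<close>: moving \<open>x\<close> and \<open>y\<close> in the direction
  \<open>f - m\<close> by amounts proportional to their own boundary distances keeps both in their
  balls, and the convex combination of the moved points is \<open>f\<close>.\<close>

lemma bdist_concave:
  assumes x: "x \<in> \<Omega>" and y: "y \<in> \<Omega>" and uv: "0 \<le> u" "0 \<le> v" "u + v = 1"
  shows "u * bdist x + v * bdist y \<le> bdist (u *\<^sub>R x + v *\<^sub>R y)"
proof -
  define D where "D = u * bdist x + v * bdist y"
  define m where "m = u *\<^sub>R x + v *\<^sub>R y"
  have D: "0 < D"
    using uv bdist_pos[OF x] bdist_pos[OF y] unfolding D_def
    by (cases "u = 0") (auto intro: add_pos_nonneg)
  have "D \<le> dist m f" if f: "f \<in> frontier \<Omega>" for f
  proof (rule ccontr)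
    assume "\<not> D \<le> dist m f"
    then have w: "norm (f - m) < D" by (simp add: dist_norm norm_minus_commute)
    have *: "z + (bdist z / D) *\<^sub>R (f - m) \<in> \<Omega>" if z: "z \<in> \<Omega>" for z
    proof -
      have "norm ((bdist z / D) *\<^sub>R (f - m)) = bdist z * (norm (f - m) / D)"
        using D bdist_pos[OF z] by simp
      also have "\<dots> < bdist z * 1"
        using D w bdist_pos[OF z] by (intro mult_strict_left_mono) simp_all
      finally show ?thesis using ball_bdist_subset[OF z] by (auto simp: dist_norm)
    qed
    have "u *\<^sub>R (x + (bdist x / D) *\<^sub>R (f - m)) + v *\<^sub>R (y + (bdist y / D) *\<^sub>R (f - m)) \<in> \<Omega>"
      using convexD[OF convex_dom *[OF x] *[OF y] uv] .
    also have "u *\<^sub>R (x + (bdist x / D) *\<^sub>R (f - m)) + v *\<^sub>R (y + (bdist y / D) *\<^sub>R (f - m))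
        = m + ((u * bdist x + v * bdist y) / D) *\<^sub>R (f - m)"
      by (simp add: m_def scaleR_add_right scaleR_add_left add_divide_distrib)
    also have "\<dots> = f" using D by (simp add: D_def[symmetric])
    finally show False using frontier_notin[OF f] by simp
  qed
  then have "D \<le> bdist m"
    unfolding infdist_notempty[OF frontier_ne] by (intro cINF_greatest frontier_ne)
  then show ?thesis by (simp add: D_def m_def)
qed

section \<open>Quasihyperbolic length and distance through 1-Lipschitz curves\<close>

lemma inverse_bdist_continuous: "S \<subseteq> \<Omega> \<Longrightarrow> continuous_on S (\<lambda>x. 1 / bdist x)"
  using bdist_pos by (intro continuous_intros) fastforce

lemma inverse_bdist_curve_continuous:
  fixes c :: "real \<Rightarrow> 'a"
  assumes "L-lipschitz_on {a..b} c" "c ` {a..b} \<subseteq> \<Omega>"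
  shows "continuous_on {a..b} (\<lambda>t. 1 / bdist (c t))"
  by (rule continuous_on_compose2[OF inverse_bdist_continuous[OF assms(2)] lipschitz_on_continuous_on[OF assms(1)]]) simp

lemma inverse_bdist_integrable:
  fixes c :: "real \<Rightarrow> 'a"
  assumes "L-lipschitz_on {a..b} c" "c ` {a..b} \<subseteq> \<Omega>"
  shows "(\<lambda>t. 1 / bdist (c t)) integrable_on {a..b}"
  by (intro integrable_continuous_interval inverse_bdist_curve_continuous[OF assms])

text \<open>A non-integrable integrand has integral \<open>0\<close> by default. So \<open>0\<close>
  bounds the lengths of all paths from below, and the infimum in \<open>qh_dist\<close> is below
  each of them.\<close>

lemma integral_inverse_bdist_nonneg: "0 \<le> integral S (\<lambda>s. 1 / bdist (c s))" for c :: "real \<Rightarrow> 'a"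
proof (cases "(\<lambda>s. 1 / bdist (c s)) integrable_on S")
  case True
  then show ?thesis by (rule integral_nonneg) (simp add: infdist_nonneg)
qed (simp add: not_integrable_integral)

lemma qh_length_nonneg: "0 \<le> qh_length \<Omega> g"
  unfolding qh_length_def by (rule integral_inverse_bdist_nonneg)

lemma path_of_curve:
  fixes c :: "real \<Rightarrow> 'a"
  assumes "0 \<le> T" "1-lipschitz_on {0..T} c" "c ` {0..T} \<subseteq> \<Omega>"
  shows "\<exists>g. rectifiable g \<and> path_image g \<subseteq> \<Omega> \<and> pathstart g = c 0 \<and> pathfinish g = c T \<and>
           qh_length \<Omega> g \<le> integral {0..T} (\<lambda>t. 1 / bdist (c t))"
  using curve_to_path[OF assms(1,2) inverse_bdist_continuous[OF assms(3)]] assms(3)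
  unfolding qh_length_def by (force simp: infdist_nonneg)

lemma qh_le_curve0:
  fixes c :: "real \<Rightarrow> 'a"
  assumes "0 \<le> T" "1-lipschitz_on {0..T} c" "c ` {0..T} \<subseteq> \<Omega>"
  shows "qh (c 0) (c T) \<le> integral {0..T} (\<lambda>t. 1 / bdist (c t))"
proof -
  obtain g where g: "rectifiable g" "path_image g \<subseteq> \<Omega>" "pathstart g = c 0" "pathfinish g = c T"
    "qh_length \<Omega> g \<le> integral {0..T} (\<lambda>t. 1 / bdist (c t))"
    using path_of_curve[OF assms] by blast
  have "qh (c 0) (c T) \<le> qh_length \<Omega> g"
    unfolding qh_dist_def
    by (rule cInf_lower) (use g qh_length_nonneg in \<open>auto intro!: bdd_belowI[of _ 0]\<close>)
  with g show ?thesis by linarith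
qed

lemma lipschitz_shift:
  fixes c :: "real \<Rightarrow> 'a"
  assumes "1-lipschitz_on {a..b} c" shows "1-lipschitz_on {0..b - a} (\<lambda>t. c (t + a))"
proof (rule lipschitz_onI)
  fix x y assume "x \<in> {0..b - a}" "y \<in> {0..b - a}"
  then show "dist (c (x + a)) (c (y + a)) \<le> 1 * dist x y"
    using lipschitz_onD[OF assms, of "x + a" "y + a"] by (auto simp: dist_real_def)
qed simp

lemma qh_le_curve:
  fixes c :: "real \<Rightarrow> 'a"
  assumes "a \<le> b" "1-lipschitz_on {a..b} c" "c ` {a..b} \<subseteq> \<Omega>"
  shows "qh (c a) (c b) \<le> integral {a..b} (\<lambda>t. 1 / bdist (c t))"
proof -
  have "(\<lambda>t. c (t + a)) ` {0..b - a} \<subseteq> \<Omega>" using assms(3) by (auto simp: image_subset_iff)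
  from qh_le_curve0[OF _ lipschitz_shift[OF assms(2)] this] assms(1)
  have "qh (c a) (c b) \<le> integral {0..b - a} (\<lambda>t. 1 / bdist (c (t + a)))" by simp
  also have "\<dots> = integral {a..b} (\<lambda>t. 1 / bdist (c t))"
    using integral_shift_real_ivl[of a a b "\<lambda>t. 1 / bdist (c t)"] by simp
  finally show ?thesis .
qed

text \<open>\<open>sgn (y - x)\<close> is the unit direction, and \<open>0\<close> when the points
  coincide, so the degenerate segment is covered too.\<close>

lemma segment_lipschitz: "1-lipschitz_on S (\<lambda>t. x + t *\<^sub>R sgn (y - x))" for x y :: 'a
proof (rule lipschitz_onI)
  fix s t :: real
  have "dist (x + s *\<^sub>R sgn (y - x)) (x + t *\<^sub>R sgn (y - x)) = \<bar>s - t\<bar> * norm (sgn (y - x))"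
    by (simp add: dist_norm flip: scaleR_left_diff_distrib)
  also have "\<dots> \<le> \<bar>s - t\<bar> * 1" by (intro mult_left_mono) (auto simp: norm_sgn)
  finally show "dist (x + s *\<^sub>R sgn (y - x)) (x + t *\<^sub>R sgn (y - x)) \<le> 1 * dist s t"
    by (simp add: dist_real_def)
qed simp

lemma segment_end: "x + norm (y - x) *\<^sub>R sgn (y - x) = y" for x y :: 'a
  by (cases "x = y") (simp_all add: sgn_div_norm)

lemma segment_in:
  assumes S: "convex S" "x \<in> S" "y \<in> S" and t: "t \<in> {0..norm (y - x)}"
  shows "x + t *\<^sub>R sgn (y - x) \<in> S"
proof (cases "x = y")
  case False
  define u where "u = t / norm (y - x)"
  have u: "0 \<le> u" "u \<le> 1" using t False by (auto simp: u_def divide_simps)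
  have "(1 - u) *\<^sub>R x + u *\<^sub>R y \<in> S" using convexD_alt[OF S u] .
  also have "(1 - u) *\<^sub>R x + u *\<^sub>R y = x + u *\<^sub>R (y - x)" by (simp add: algebra_simps)
  also have "u *\<^sub>R (y - x) = t *\<^sub>R sgn (y - x)" by (simp add: u_def sgn_div_norm divide_inverse)
  finally show ?thesis .
qed (use assms in simp)

lemma qh_curve_exists:
  assumes x: "x \<in> \<Omega>" and y: "y \<in> \<Omega>" and L: "qh x y < L"
  shows "\<exists>T (c :: real \<Rightarrow> 'a). 0 \<le> T \<and> 1-lipschitz_on {0..T} c \<and> c ` {0..T} \<subseteq> \<Omega> \<and> c 0 = x \<and> c T = y \<and>
           integral {0..T} (\<lambda>t. 1 / bdist (c t)) < L"
proof -
  let ?S = "{qh_length \<Omega> g | g. rectifiable g \<and> path_image g \<subseteq> \<Omega> \<and> pathstart g = x \<and> pathfinish g = y}"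
  \<comment> \<open>By convexity the straight segment is a path in \<open>\<Omega>\<close>; over an
    empty set the infimum would carry no information.\<close>
  have "?S \<noteq> {}"
    using path_of_curve[OF norm_ge_zero segment_lipschitz[of _ x y]] segment_in[OF convex_dom x y]
    by (force simp: segment_end)
  then obtain g where g: "rectifiable g" "path_image g \<subseteq> \<Omega>" "pathstart g = x" "pathfinish g = y" "qh_length \<Omega> g < L"
    using cInf_lessD[of ?S L] L unfolding qh_dist_def by blast
  show ?thesis
  proof (intro exI conjI)
    show "0 \<le> arc_length g 1"
      using arc_length_mono[OF g(1), of 0 1] by (simp add: arc_length_0[OF g(1)])
    show "1-lipschitz_on {0..arc_length g 1} (arc_length_param g)"
      by (rule arc_length_param_lipschitz[OF g(1)])
    show "arc_length_param g ` {0..arc_length g 1} \<subseteq> \<Omega>"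
      using arc_length_param_in_path_image[OF g(1)] g(2) by blast
    show "arc_length_param g 0 = x" "arc_length_param g (arc_length g 1) = y"
      using arc_length_param_endpoints[OF g(1)] g(3,4) by simp_all
    show "integral {0..arc_length g 1} (\<lambda>t. 1 / bdist (arc_length_param g t)) < L"
      using g(5) by (simp add: qh_length_def)
  qed
qed

lemma qh_nonneg: assumes "x \<in> \<Omega>" "y \<in> \<Omega>" shows "0 \<le> qh x y"
proof (rule ccontr)
  assume "\<not> 0 \<le> qh x y"
  then obtain T and c :: "real \<Rightarrow> 'a" where "integral {0..T} (\<lambda>t. 1 / bdist (c t)) < 0"
    using qh_curve_exists[OF assms, of 0] by auto
  then show False using integral_inverse_bdist_nonneg[of "{0..T}" c] by linarith
qed

lemma qh_refl: assumes "x \<in> \<Omega>" shows "qh x x = 0"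
proof -
  have "1-lipschitz_on {0..0::real} (\<lambda>_. x)" by (rule lipschitz_onI) auto
  then show ?thesis
    using qh_le_curve[of 0 0 "\<lambda>_. x"] qh_nonneg[OF assms assms] assms by auto
qed

lemma qh_triangle:
  assumes "x \<in> \<Omega>" "y \<in> \<Omega>" "z \<in> \<Omega>" shows "qh x z \<le> qh x y + qh y z"
proof (rule field_le_epsilon)
  fix e :: real assume e: "0 < e"
  obtain T and c :: "real \<Rightarrow> 'a" where c: "0 \<le> T" "1-lipschitz_on {0..T} c" "c ` {0..T} \<subseteq> \<Omega>" "c 0 = x" "c T = y"
    "integral {0..T} (\<lambda>t. 1 / bdist (c t)) < qh x y + e / 2"
    using qh_curve_exists[OF assms(1,2), of "qh x y + e / 2"] e by auto
  obtain U and b :: "real \<Rightarrow> 'a" where b: "0 \<le> U" "1-lipschitz_on {0..U} b" "b ` {0..U} \<subseteq> \<Omega>" "b 0 = y" "b U = z"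
    "integral {0..U} (\<lambda>t. 1 / bdist (b t)) < qh y z + e / 2"
    using qh_curve_exists[OF assms(2,3), of "qh y z + e / 2"] e by auto
  define h where "h t = (if t \<le> T then c t else b (t + - T))" for t
  have "1-lipschitz_on {T..T + U} (\<lambda>t. b (t + - T))"
  proof (rule lipschitz_onI)
    fix s t assume "s \<in> {T..T + U}" "t \<in> {T..T + U}"
    then show "dist (b (s + - T)) (b (t + - T)) \<le> 1 * dist s t"
      using lipschitz_onD[OF b(2), of "s + - T" "t + - T"] by (auto simp: dist_real_def)
  qed simp
  then have hL: "1-lipschitz_on {0..T + U} h"
    unfolding h_def[abs_def] by (intro lipschitz_on_concat c(2)) (simp_all add: c b)
  have hI: "h ` {0..T + U} \<subseteq> \<Omega>"
    using c(3) b(3) by (auto simp: h_def image_subset_iff)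
  have "h (T + U) = z" using b c by (cases "U = 0") (auto simp: h_def)
  then have "qh x z \<le> integral {0..T + U} (\<lambda>t. 1 / bdist (h t))"
    using qh_le_curve[OF _ hL hI] c(1,4) b(1) by (simp add: h_def)
  also have "\<dots> = integral {0..T} (\<lambda>t. 1 / bdist (h t)) + integral {T..T + U} (\<lambda>t. 1 / bdist (h t))"
    using c(1) b(1) by (intro Henstock_Kurzweil_Integration.integral_combine[symmetric] inverse_bdist_integrable[OF hL hI]) auto
  also have "integral {0..T} (\<lambda>t. 1 / bdist (h t)) = integral {0..T} (\<lambda>t. 1 / bdist (c t))"
    by (rule integral_cong) (simp add: h_def)
  also have "integral {T..T + U} (\<lambda>t. 1 / bdist (h t)) = integral {T..T + U} (\<lambda>t. 1 / bdist (b (t + - T)))"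
    by (rule integral_cong) (use b(4) c(5) in \<open>auto simp: h_def\<close>)
  also have "\<dots> = integral {0..U} (\<lambda>t. 1 / bdist (b t))"
    using integral_shift_real_ivl[of 0 "- T" U "\<lambda>t. 1 / bdist (b t)"] by (simp add: add.commute)
  finally show "qh x z \<le> qh x y + qh y z + e" using c(6) b(6) by linarith
qed

lemma qh_commute_le: assumes "x \<in> \<Omega>" "y \<in> \<Omega>" shows "qh y x \<le> qh x y"
proof (rule field_le_epsilon)
  fix e :: real assume e: "0 < e"
  obtain T and c :: "real \<Rightarrow> 'a" where c: "0 \<le> T" "1-lipschitz_on {0..T} c" "c ` {0..T} \<subseteq> \<Omega>" "c 0 = x" "c T = y"
    "integral {0..T} (\<lambda>t. 1 / bdist (c t)) < qh x y + e"
    using qh_curve_exists[OF assms, of "qh x y + e"] e by auto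
  have L: "1-lipschitz_on {-T..0} (\<lambda>t. c (- t))"
  proof (rule lipschitz_onI)
    fix s t assume "s \<in> {-T..0}" "t \<in> {-T..0}"
    then show "dist (c (- s)) (c (- t)) \<le> 1 * dist s t"
      using lipschitz_onD[OF c(2), of "- s" "- t"] by (auto simp: dist_real_def)
  qed simp
  have "(\<lambda>t. c (- t)) ` {-T..0} \<subseteq> \<Omega>" using c(3) by (auto simp: image_subset_iff)
  from qh_le_curve[OF _ L this] c(1,4,5)
  have "qh y x \<le> integral {-T..-0} (\<lambda>t. 1 / bdist (c (- t)))" by simp
  also have "\<dots> = integral {0..T} (\<lambda>t. 1 / bdist (c t))"
    by (rule Henstock_Kurzweil_Integration.integral_reflect_real)
  finally show "qh y x \<le> qh x y + e" using c(6) by linarith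
qed

lemma qh_commute: "x \<in> \<Omega> \<Longrightarrow> y \<in> \<Omega> \<Longrightarrow> qh x y = qh y x"
  by (intro antisym qh_commute_le)

section \<open>Comparison of the quasihyperbolic distance with the norm\<close>

lemma qh_le_near:
  assumes x: "x \<in> \<Omega>" and y: "norm (y - x) < bdist x"
  shows "y \<in> \<Omega>" "qh x y \<le> norm (y - x) / (bdist x - norm (y - x))"
proof -
  let ?c = "\<lambda>t. x + t *\<^sub>R sgn (y - x)"
  have yb: "y \<in> ball x (bdist x)" "x \<in> ball x (bdist x)"
    using y bdist_pos[OF x] by (simp_all add: dist_norm norm_minus_commute)
  then show y': "y \<in> \<Omega>" using ball_bdist_subset[OF x] by blast
  have im: "?c ` {0..norm (y - x)} \<subseteq> \<Omega>" using segment_in[OF convex_dom x y'] by blast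
  have "qh x y \<le> integral {0..norm (y - x)} (\<lambda>t. 1 / bdist (?c t))"
    using qh_le_curve[OF norm_ge_zero segment_lipschitz im] by (simp add: segment_end)
  also have "\<dots> \<le> integral {0..norm (y - x)} (\<lambda>_. 1 / (bdist x - norm (y - x)))"
  proof (rule integral_le)
    show "(\<lambda>t. 1 / bdist (?c t)) integrable_on {0..norm (y - x)}"
      by (rule inverse_bdist_integrable[OF segment_lipschitz im])
    fix t assume t: "t \<in> {0..norm (y - x)}"
    have "norm (t *\<^sub>R sgn (y - x)) \<le> norm (y - x)" using t by (auto simp: norm_sgn)
    then have "bdist x - norm (y - x) \<le> bdist (?c t)"
      using bdist_lipschitz[of x "?c t"] by simp
    then show "1 / bdist (?c t) \<le> 1 / (bdist x - norm (y - x))"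
      using y by (intro divide_left_mono) auto
  qed auto
  finally show "qh x y \<le> norm (y - x) / (bdist x - norm (y - x))" by simp
qed

text \<open>After time \<open>t\<close> a 1-Lipschitz curve from \<open>x\<close> has boundary
  distance at most \<open>bdist x + t\<close>, and it needs at least time
  \<open>norm (y - x)\<close> to reach \<open>y\<close>. The logarithm is the integral of
  \<open>1 / (bdist x + t)\<close> over that time.\<close>

lemma ln_le_qh:
  assumes x: "x \<in> \<Omega>" and y: "y \<in> \<Omega>"
  shows "ln (1 + norm (y - x) / bdist x) \<le> qh x y"
proof (rule field_le_epsilon)
  fix e :: real assume e: "0 < e"
  note dx = bdist_pos[OF x]
  obtain T and c :: "real \<Rightarrow> 'a" where c: "0 \<le> T" "1-lipschitz_on {0..T} c" "c ` {0..T} \<subseteq> \<Omega>" "c 0 = x" "c T = y"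
    "integral {0..T} (\<lambda>t. 1 / bdist (c t)) < qh x y + e"
    using qh_curve_exists[OF assms, of "qh x y + e"] e by auto
  have "norm (y - x) \<le> T"
    using lipschitz_onD[OF c(2), of T 0] c(1,4,5) by (simp add: dist_norm)
  then have "ln (1 + norm (y - x) / bdist x) \<le> ln (1 + T / bdist x)"
    using dx by (intro ln_mono) (auto intro!: add_pos_nonneg divide_right_mono)
  also have "\<dots> = ln (1 + T / bdist x) - ln (1 + 0 / bdist x)" by simp
  also have "\<dots> = integral {0..T} (\<lambda>t. 1 / (bdist x + t))"
  proof (rule integral_unique[symmetric], rule fundamental_theorem_of_calculus[OF c(1)])
    fix t assume "t \<in> {0..T}"
    then show "((\<lambda>t. ln (1 + t / bdist x)) has_vector_derivative 1 / (bdist x + t)) (at t within {0..T})"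
      unfolding has_real_derivative_iff_has_vector_derivative[symmetric] using dx
      by (auto intro!: derivative_eq_intros add_pos_nonneg simp: field_simps)
  qed
  also have "\<dots> \<le> integral {0..T} (\<lambda>t. 1 / bdist (c t))"
  proof (rule integral_le)
    show "(\<lambda>t. 1 / (bdist x + t)) integrable_on {0..T}"
      using dx by (intro integrable_continuous_interval continuous_intros) auto
    show "(\<lambda>t. 1 / bdist (c t)) integrable_on {0..T}" by (rule inverse_bdist_integrable[OF c(2,3)])
    fix t assume t: "t \<in> {0..T}"
    have "norm (c t - x) \<le> t" using lipschitz_onD[OF c(2), of t 0] t c(1,4) by (simp add: dist_norm)
    then have "bdist (c t) \<le> bdist x + t" using bdist_lipschitz[of "c t" x] by linarith
    then show "1 / (bdist x + t) \<le> 1 / bdist (c t)"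
      using bdist_pos[of "c t"] subsetD[OF c(3) imageI[OF t]] dx t by (intro divide_left_mono) (auto intro!: mult_pos_pos)
  qed
  finally show "ln (1 + norm (y - x) / bdist x) \<le> qh x y + e" using c(6) by linarith
qed

lemma norm_diff_le_qh:
  assumes x: "x \<in> \<Omega>" and y: "y \<in> \<Omega>" and k: "qh x y \<le> k"
  shows "norm (y - x) \<le> bdist x * (exp k - 1)" "bdist y \<le> bdist x * exp k"
proof -
  note dx = bdist_pos[OF x]
  have "ln (1 + norm (y - x) / bdist x) \<le> k" using ln_le_qh[OF x y] k by linarith
  then have "1 + norm (y - x) / bdist x \<le> exp k"
    using dx add_pos_nonneg[of 1 "norm (y - x) / bdist x"] by (metis divide_nonneg_pos exp_le_cancel_iff exp_ln norm_ge_zero zero_less_one)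
  then show *: "norm (y - x) \<le> bdist x * (exp k - 1)" using dx by (simp add: field_simps)
  show "bdist y \<le> bdist x * exp k"
    using * bdist_lipschitz[of y x] by (simp add: right_diff_distrib)
qed

lemma bdist_ge_qh:
  assumes "x \<in> \<Omega>" "y \<in> \<Omega>" "qh x y \<le> k"
  shows "bdist x * exp (- k) \<le> bdist y"
  using norm_diff_le_qh(2)[of y x k] assms qh_commute[of x y] by (simp add: exp_minus field_simps)

lemma qh_eq_0: "x \<in> \<Omega> \<Longrightarrow> y \<in> \<Omega> \<Longrightarrow> qh x y \<le> 0 \<Longrightarrow> x = y"
  using norm_diff_le_qh(1)[of x y 0] by simp

text \<open>An \<open>R\<close>-Lipschitz map from \<open>[0, 1]\<close> into the metric space
  \<open>(\<Omega>, qh)\<close>. For \<open>R = qh (\<sigma> 0) (\<sigma> 1)\<close> it is a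
  geodesic of constant speed.\<close>

definition qcurve :: "real \<Rightarrow> (real \<Rightarrow> 'a) \<Rightarrow> bool" where
  "qcurve R \<sigma> \<longleftrightarrow> (\<forall>t\<in>{0..1}. \<sigma> t \<in> \<Omega>) \<and>
     (\<forall>s t. 0 \<le> s \<longrightarrow> s \<le> t \<longrightarrow> t \<le> 1 \<longrightarrow> qh (\<sigma> s) (\<sigma> t) \<le> R * (t - s))"

lemma qcurve_in: "qcurve R \<sigma> \<Longrightarrow> 0 \<le> t \<Longrightarrow> t \<le> 1 \<Longrightarrow> \<sigma> t \<in> \<Omega>"
  by (simp add: qcurve_def)

lemma qcurve_le: "qcurve R \<sigma> \<Longrightarrow> 0 \<le> s \<Longrightarrow> s \<le> t \<Longrightarrow> t \<le> 1 \<Longrightarrow> qh (\<sigma> s) (\<sigma> t) \<le> R * (t - s)"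
  by (simp add: qcurve_def)

lemma qcurve_mono: "qcurve R \<sigma> \<Longrightarrow> R \<le> R' \<Longrightarrow> qcurve R' \<sigma>"
  unfolding qcurve_def by (meson diff_ge_0_iff_ge mult_right_mono order_trans)

lemma qcurve_nonneg: "qcurve R \<sigma> \<Longrightarrow> 0 \<le> R"
  using qcurve_le[of R \<sigma> 0 1] qh_nonneg[of "\<sigma> 0" "\<sigma> 1"] qcurve_in[of R \<sigma>] by fastforce

text \<open>\<open>\<tau>\<close> inverts the accumulated length \<open>\<Phi>\<close>, with values
  from the intermediate value theorem. It is pinned down only through
  \<open>\<Phi> (\<tau> t)\<close>; the order of two values is settled by the symmetry of
  \<open>qh\<close>, and the endpoints by the fact that distance \<open>0\<close> forces
  equality.\<close>

lemma qcurve_exists: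
  assumes x: "x \<in> \<Omega>" and y: "y \<in> \<Omega>" and R: "qh x y < R"
  shows "\<exists>\<sigma>. qcurve R \<sigma> \<and> \<sigma> 0 = x \<and> \<sigma> 1 = y"
proof -
  obtain T and c :: "real \<Rightarrow> 'a" where c: "0 \<le> T" "1-lipschitz_on {0..T} c" "c ` {0..T} \<subseteq> \<Omega>" "c 0 = x" "c T = y"
    "integral {0..T} (\<lambda>t. 1 / bdist (c t)) < R"
    using qh_curve_exists[OF assms] by auto
  define \<Phi> where "\<Phi> t = integral {0..t} (\<lambda>t. 1 / bdist (c t))" for t
  have \<Phi>0: "\<Phi> 0 = 0" by (simp add: \<Phi>_def)
  have cin: "c t \<in> \<Omega>" if "t \<in> {0..T}" for t using c(3) that by blast
  have le: "qh (c a) (c b) \<le> \<Phi> b - \<Phi> a" "\<Phi> a \<le> \<Phi> b" if "0 \<le> a" "a \<le> b" "b \<le> T" for a b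
  proof -
    have "1-lipschitz_on {a..b} c" using lipschitz_on_subset[OF c(2)] that by auto
    moreover have "c ` {a..b} \<subseteq> \<Omega>" using c(3) that by auto
    ultimately have "qh (c a) (c b) \<le> integral {a..b} (\<lambda>t. 1 / bdist (c t))"
      by (rule qh_le_curve[OF that(2)])
    moreover have "integral {0..a} (\<lambda>t. 1 / bdist (c t)) + integral {a..b} (\<lambda>t. 1 / bdist (c t))
        = integral {0..b} (\<lambda>t. 1 / bdist (c t))"
      using that by (intro Henstock_Kurzweil_Integration.integral_combine
        integrable_on_subinterval[OF inverse_bdist_integrable[OF c(2,3)]]) auto
    ultimately show "qh (c a) (c b) \<le> \<Phi> b - \<Phi> a" by (simp add: \<Phi>_def)
    moreover have "0 \<le> qh (c a) (c b)" using that by (intro qh_nonneg cin) auto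
    ultimately show "\<Phi> a \<le> \<Phi> b" by linarith
  qed
  have cont: "continuous_on {0..T} \<Phi>"
    unfolding \<Phi>_def by (rule indefinite_integral_continuous_1[OF inverse_bdist_integrable[OF c(2,3)]])
  have "\<exists>a. 0 \<le> a \<and> a \<le> T \<and> \<Phi> a = \<Phi> T * t" if "t \<in> {0..1}" for t
    using IVT'[of \<Phi> 0 "\<Phi> T * t" T] \<Phi>0 le(2)[of 0 T] c(1) cont that
    by (auto simp: mult_left_le)
  then obtain \<tau> where \<tau>: "\<And>t. t \<in> {0..1} \<Longrightarrow> 0 \<le> \<tau> t \<and> \<tau> t \<le> T \<and> \<Phi> (\<tau> t) = \<Phi> T * t"
    by metis
  define \<sigma> where "\<sigma> = (\<lambda>t. c (\<tau> t))"
  have "qcurve (\<Phi> T) \<sigma>"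
    unfolding qcurve_def \<sigma>_def
  proof (intro conjI ballI allI impI)
    fix t :: real assume "t \<in> {0..1}" then show "c (\<tau> t) \<in> \<Omega>" using \<tau>[of t] cin by simp
  next
    fix s t :: real assume st: "0 \<le> s" "s \<le> t" "t \<le> 1"
    have T: "\<Phi> T * s \<le> \<Phi> T * t" using st le(2)[of 0 T] c(1) \<Phi>0 by (intro mult_left_mono) auto
    show "qh (c (\<tau> s)) (c (\<tau> t)) \<le> \<Phi> T * (t - s)"
    proof (cases "\<tau> s \<le> \<tau> t")
      case True
      then show ?thesis using le(1)[of "\<tau> s" "\<tau> t"] \<tau>[of s] \<tau>[of t] st by (simp add: right_diff_distrib)
    next
      case False
      then have "qh (c (\<tau> t)) (c (\<tau> s)) \<le> \<Phi> T * s - \<Phi> T * t"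
        using le(1)[of "\<tau> t" "\<tau> s"] \<tau>[of s] \<tau>[of t] st by simp
      moreover have "qh (c (\<tau> t)) (c (\<tau> s)) = qh (c (\<tau> s)) (c (\<tau> t))"
        using \<tau>[of s] \<tau>[of t] st by (intro qh_commute cin) auto
      ultimately show ?thesis using T by (simp add: right_diff_distrib)
    qed
  qed
  moreover have "\<sigma> 0 = x"
  proof -
    have "qh (c 0) (c (\<tau> 0)) \<le> 0" using le(1)[of 0 "\<tau> 0"] \<tau>[of 0] \<Phi>0 by simp
    then show ?thesis using qh_eq_0[of "c 0" "c (\<tau> 0)"] cin \<tau>[of 0] c(1,4) x by (auto simp: \<sigma>_def)
  qed
  moreover have "\<sigma> 1 = y"
  proof -
    have "qh (c (\<tau> 1)) (c T) \<le> 0" using le(1)[of "\<tau> 1" T] \<tau>[of 1] by simp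
    then show ?thesis using qh_eq_0[of "c (\<tau> 1)" "c T"] cin \<tau>[of 1] c(1,5) y by (auto simp: \<sigma>_def)
  qed
  ultimately show ?thesis using qcurve_mono[of "\<Phi> T" \<sigma> R] c(6) by (auto simp: \<Phi>_def)
qed

lemma qcurve_norm_le:
  assumes \<sigma>: "qcurve R \<sigma>" and st: "0 \<le> s" "s \<le> t" "t \<le> 1"
  shows "norm (\<sigma> t - \<sigma> s) \<le> bdist (\<sigma> s) * (exp (R * (t - s)) - 1)"
  using norm_diff_le_qh(1)[OF _ _ qcurve_le[OF \<sigma> st]] qcurve_in[OF \<sigma>] st by simp

text \<open>\<open>exp (R * h) - 1\<close> bounds the displacement relative to the boundary distance
  at speed \<open>R\<close>, and \<open>\<kappa> / (1 - \<kappa>)\<close> is how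
  \<open>qh_le_near\<close> converts a relative displacement \<open>\<kappa>\<close> back into
  distance. The composite has derivative \<open>R\<close> at \<open>0\<close>, so the round trip
  costs only \<open>e\<close>.\<close>

lemma exp_quotient_near_0:
  fixes R e :: real assumes "0 \<le> R" "0 < e"
  shows "\<exists>d>0. \<forall>h. 0 \<le> h \<and> h < d \<longrightarrow>
           exp (R * h) < 2 \<and> (exp (R * h) - 1) / (2 - exp (R * h)) \<le> (R + e) * h"
proof -
  let ?f = "\<lambda>h. (exp (R * h) - 1) / (2 - exp (R * h))"
  have "(?f has_real_derivative R) (at 0)"
    by (auto intro!: derivative_eq_intros)
  then have "(\<lambda>h. (?f (0 + h) - ?f 0) / h) \<midarrow>0\<rightarrow> R"
    by (simp only: DERIV_def)
  then have "\<forall>\<^sub>F h in at 0. ?f h / h < R + e"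
    using assms(2) by (auto dest!: order_tendstoD(2)[of _ _ _ "R + e"])
  moreover have "((\<lambda>h. exp (R * h)) \<longlongrightarrow> exp (R * 0)) (at 0)" by (intro tendsto_intros)
  then have "\<forall>\<^sub>F h in at 0. exp (R * h) < 2" by (rule order_tendstoD) simp
  ultimately have "\<forall>\<^sub>F h in at 0. ?f h / h < R + e \<and> exp (R * h) < 2" by eventually_elim simp
  then obtain d where d: "0 < d" "\<And>h. h \<noteq> 0 \<Longrightarrow> \<bar>h\<bar> < d \<Longrightarrow> ?f h / h < R + e \<and> exp (R * h) < 2"
    unfolding eventually_at by (auto simp: dist_real_def)
  have "exp (R * h) < 2 \<and> ?f h \<le> (R + e) * h" if "0 \<le> h" "h < d" for h
    using d(2)[of h] that by (cases "h = 0") (auto simp: divide_simps mult_ac)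
  with d(1) show ?thesis by blast
qed

text \<open>Concavity of the boundary distance lets two curves be averaged at equal quasihyperbolic speed.\<close>

lemma qcurve_convex_combination:
  assumes s1: "qcurve R \<sigma>\<^sub>1" and s2: "qcurve R \<sigma>\<^sub>2" and uv: "0 \<le> u" "0 \<le> v" "u + v = 1"
  shows "qcurve R (\<lambda>t. u *\<^sub>R \<sigma>\<^sub>1 t + v *\<^sub>R \<sigma>\<^sub>2 t)"
proof -
  define \<eta> where "\<eta> t = u *\<^sub>R \<sigma>\<^sub>1 t + v *\<^sub>R \<sigma>\<^sub>2 t" for t
  have \<eta>in: "\<eta> t \<in> \<Omega>" if "0 \<le> t" "t \<le> 1" for t
    unfolding \<eta>_def using qcurve_in[OF s1 that] qcurve_in[OF s2 that] convexD[OF convex_dom _ _ uv] by blast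
  have R: "0 \<le> R" by (rule qcurve_nonneg[OF s1])
  have main: "qh (\<eta> s) (\<eta> t) \<le> (R + e) * (t - s)" if e: "0 < e" and st: "0 \<le> s" "s \<le> t" "t \<le> 1" for e s t
  proof -
    obtain d where d: "0 < d" "\<And>h. 0 \<le> h \<Longrightarrow> h < d \<Longrightarrow>
        exp (R * h) < 2 \<and> (exp (R * h) - 1) / (2 - exp (R * h)) \<le> (R + e) * h"
      using exp_quotient_near_0[OF R e] by blast
    \<comment> \<open>The speed bound \<open>R + e\<close> holds on short intervals and adds up by
      the triangle inequality, so subdivision carries it to \<open>[s, t]\<close>.\<close>
    define P where "P a b \<longleftrightarrow> (0 \<le> a \<and> a \<le> b \<and> b \<le> 1 \<longrightarrow> qh (\<eta> a) (\<eta> b) \<le> (R + e) * (b - a))" for a b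
    have "P s t"
    proof (rule Bolzano[OF st(2)])
      fix a b c assume H: "P a b" "P b c" "a \<le> b" "b \<le> c"
      show "P a c"
        unfolding P_def
      proof
        assume r: "0 \<le> a \<and> a \<le> c \<and> c \<le> 1"
        then have "qh (\<eta> a) (\<eta> c) \<le> qh (\<eta> a) (\<eta> b) + qh (\<eta> b) (\<eta> c)"
          using H by (intro qh_triangle \<eta>in) auto
        also have "\<dots> \<le> (R + e) * (b - a) + (R + e) * (c - b)"
          using H r by (intro add_mono) (auto simp: P_def)
        finally show "qh (\<eta> a) (\<eta> c) \<le> (R + e) * (c - a)" by (simp add: algebra_simps)
      qed
    next
      fix x
      have "P a b" if "a \<le> x" "x \<le> b" "b - a < d" for a b
        unfolding P_def
      proof
        assume r: "0 \<le> a \<and> a \<le> b \<and> b \<le> 1"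
        \<comment> \<open>Both curves move by at most \<open>\<kappa>\<close> times their boundary
          distance. By concavity the average moves by at most \<open>\<kappa>\<close> times its
          own.\<close>
        define \<kappa> where "\<kappa> = exp (R * (b - a)) - 1"
        have \<kappa>: "0 \<le> \<kappa>" "\<kappa> < 1" "\<kappa> / (1 - \<kappa>) \<le> (R + e) * (b - a)"
          using d(2)[of "b - a"] that r R by (auto simp: \<kappa>_def)
        have "\<eta> b - \<eta> a = u *\<^sub>R (\<sigma>\<^sub>1 b - \<sigma>\<^sub>1 a) + v *\<^sub>R (\<sigma>\<^sub>2 b - \<sigma>\<^sub>2 a)"
          by (simp add: \<eta>_def algebra_simps)
        then have "norm (\<eta> b - \<eta> a) \<le> u * norm (\<sigma>\<^sub>1 b - \<sigma>\<^sub>1 a) + v * norm (\<sigma>\<^sub>2 b - \<sigma>\<^sub>2 a)"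
          using norm_triangle_ineq[of "u *\<^sub>R (\<sigma>\<^sub>1 b - \<sigma>\<^sub>1 a)" "v *\<^sub>R (\<sigma>\<^sub>2 b - \<sigma>\<^sub>2 a)"] uv by simp
        also have "\<dots> \<le> u * (bdist (\<sigma>\<^sub>1 a) * \<kappa>) + v * (bdist (\<sigma>\<^sub>2 a) * \<kappa>)"
          unfolding \<kappa>_def using r uv by (intro add_mono mult_left_mono qcurve_norm_le[OF s1] qcurve_norm_le[OF s2]) auto
        also have "\<dots> = \<kappa> * (u * bdist (\<sigma>\<^sub>1 a) + v * bdist (\<sigma>\<^sub>2 a))" by (simp add: algebra_simps)
        also have "\<dots> \<le> \<kappa> * bdist (\<eta> a)"
          unfolding \<eta>_def using r uv \<kappa> by (intro mult_left_mono bdist_concave qcurve_in[OF s1] qcurve_in[OF s2]) auto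
        finally have N: "norm (\<eta> b - \<eta> a) \<le> \<kappa> * bdist (\<eta> a)" .
        have \<eta>a: "\<eta> a \<in> \<Omega>" "0 < bdist (\<eta> a)" using \<eta>in[of a] bdist_pos r by auto
        have "\<kappa> * bdist (\<eta> a) < 1 * bdist (\<eta> a)" using \<kappa> \<eta>a by (intro mult_strict_right_mono) auto
        then have near: "norm (\<eta> b - \<eta> a) < bdist (\<eta> a)" using N by linarith
        have "qh (\<eta> a) (\<eta> b) \<le> norm (\<eta> b - \<eta> a) / (bdist (\<eta> a) - norm (\<eta> b - \<eta> a))"
          by (rule qh_le_near[OF \<eta>a(1) near])
        also have "\<dots> \<le> (\<kappa> * bdist (\<eta> a)) / (bdist (\<eta> a) - \<kappa> * bdist (\<eta> a))"
          using N near \<kappa> \<eta>a by (intro frac_le) (auto simp: \<open>\<kappa> * bdist (\<eta> a) < 1 * bdist (\<eta> a)\<close>[simplified])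
        also have "\<dots> = \<kappa> / (1 - \<kappa>)" using \<eta>a(2) \<kappa>(2) by (simp add: field_simps)
        finally show "qh (\<eta> a) (\<eta> b) \<le> (R + e) * (b - a)" using \<kappa>(3) by linarith
      qed
      with d(1) show "\<exists>d>0. \<forall>a b. a \<le> x \<and> x \<le> b \<and> b - a < d \<longrightarrow> P a b" by blast
    qed
    then show ?thesis using st by (simp add: P_def)
  qed
  have "qh (\<eta> s) (\<eta> t) \<le> R * (t - s)" if st: "0 \<le> s" "s \<le> t" "t \<le> 1" for s t
  proof (rule field_le_epsilon)
    fix e :: real assume e: "0 < e"
    have "qh (\<eta> s) (\<eta> t) \<le> (R + e) * (t - s)" by (rule main[OF e st])
    also have "\<dots> \<le> R * (t - s) + e * 1"
      using st e by (simp add: distrib_right mult_left_le)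
    finally show "qh (\<eta> s) (\<eta> t) \<le> R * (t - s) + e" by simp
  qed
  then show ?thesis using \<eta>in unfolding qcurve_def \<eta>_def[symmetric] by simp
qed

lemma qh_convex:
  assumes "x \<in> \<Omega>" "y \<in> \<Omega>" "x' \<in> \<Omega>" "y' \<in> \<Omega>" "qh x y \<le> R" "qh x' y' \<le> R"
    and uv: "0 \<le> u" "0 \<le> v" "u + v = 1"
  shows "qh (u *\<^sub>R x + v *\<^sub>R x') (u *\<^sub>R y + v *\<^sub>R y') \<le> R"
proof (rule field_le_epsilon)
  fix e :: real assume e: "0 < e"
  obtain \<sigma> where \<sigma>: "qcurve (R + e) \<sigma>" "\<sigma> 0 = x" "\<sigma> 1 = y"
    using qcurve_exists[of x y "R + e"] assms e by fastforce
  obtain \<tau> where \<tau>: "qcurve (R + e) \<tau>" "\<tau> 0 = x'" "\<tau> 1 = y'"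
    using qcurve_exists[of x' y' "R + e"] assms e by fastforce
  show "qh (u *\<^sub>R x + v *\<^sub>R x') (u *\<^sub>R y + v *\<^sub>R y') \<le> R + e"
    using qcurve_le[OF qcurve_convex_combination[OF \<sigma>(1) \<tau>(1) uv], of 0 1] \<sigma> \<tau> by simp
qed

end

section \<open>Hahn-Banach and generalized limits\<close>

definition sublinear :: "('a::real_vector \<Rightarrow> real) \<Rightarrow> bool" where
  "sublinear p \<longleftrightarrow> (\<forall>x y. p (x + y) \<le> p x + p y) \<and> (\<forall>c x. 0 \<le> c \<longrightarrow> p (c *\<^sub>R x) = c * p x)"

lemma sublinearI:
  assumes "\<And>x y. p (x + y) \<le> p x + p y" "\<And>c x. 0 < c \<Longrightarrow> p (c *\<^sub>R x) \<le> c * p x" "p 0 = 0"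
  shows "sublinear p"
proof -
  have "p (c *\<^sub>R x) = c * p x" if "0 \<le> c" for c x
  proof (cases "c = 0")
    case False
    then have c: "0 < c" using that by simp
    have "p (inverse c *\<^sub>R (c *\<^sub>R x)) \<le> inverse c * p (c *\<^sub>R x)" by (rule assms(2)) (use c in simp)
    then have "c * p x \<le> p (c *\<^sub>R x)" using c by (simp add: field_simps)
    then show ?thesis using assms(2)[OF c, of x] by simp
  qed (use assms(3) in simp)
  then show ?thesis using assms(1) by (simp add: sublinear_def)
qed

lemma sublinear_add: "sublinear p \<Longrightarrow> p (x + y) \<le> p x + p y"
  by (simp add: sublinear_def)

lemma sublinear_scale: "sublinear p \<Longrightarrow> 0 \<le> c \<Longrightarrow> p (c *\<^sub>R x) = c * p x"
  by (simp add: sublinear_def)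

lemma sublinear_0: "sublinear p \<Longrightarrow> p 0 = 0"
  using sublinear_scale[of p 0 0] by simp

lemma sublinear_norm: "sublinear norm"
  by (rule sublinearI) (auto intro: norm_triangle_ineq)

definition slope_cone :: "('a::real_vector \<times> real) set \<Rightarrow> bool" where
  "slope_cone K \<longleftrightarrow> (0, 0) \<in> K \<and> (\<forall>a\<in>K. \<forall>b\<in>K. a + b \<in> K) \<and> (\<forall>c>0. \<forall>a\<in>K. c *\<^sub>R a \<in> K)"

text \<open>The cone \<open>K\<close> lists the lower bounds \<open>s \<le> f w\<close> wanted for a linear \<open>f \<le> p\<close>: a ray for norming
  functionals, differences \<open>x - c\<close> for separation, eventual lower bounds of sequences for generalized
  limits.\<close>

lemma sublinear_lower:
  assumes p: "sublinear p" and K: "slope_cone K" and le: "\<And>w s. (w, s) \<in> K \<Longrightarrow> s \<le> p w"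
  obtains q where "sublinear q" "\<And>z. q z \<le> p z" "\<And>w s. (w, s) \<in> K \<Longrightarrow> q (- w) \<le> - s"
proof -
  \<comment> \<open>\<open>q\<close> is an infimal convolution of \<open>p\<close> with the cone.
    The member \<open>(0, 0)\<close> gives \<open>q \<le> p\<close>, and \<open>z = - w\<close>
    gives \<open>q (- w) \<le> - s\<close>, which for a linear functional below \<open>q\<close>
    reads \<open>s \<le> f w\<close>.\<close>
  define S where "S z = (\<lambda>(w, s). p (z + w) - s) ` K" for z
  define q where "q z = Inf (S z)" for z
  have ne: "S z \<noteq> {}" for z using K by (auto simp: S_def slope_cone_def)
  have lb: "- p (- z) \<le> y" if yz: "y \<in> S z" for y z
  proof -
    obtain w s where ws: "(w, s) \<in> K" "y = p (z + w) - s" using yz by (auto simp: S_def)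
    have "p w \<le> p (z + w) + p (- z)" using sublinear_add[OF p, of "z + w" "- z"] by simp
    then show ?thesis using le[OF ws(1)] ws(2) by linarith
  qed
  have q_le: "q z \<le> p (z + w) - s" if "(w, s) \<in> K" for z w s
    unfolding q_def by (rule cInf_lower) (use that lb in \<open>force simp: S_def intro!: bdd_belowI\<close>)+
  have "sublinear q"
  proof (rule sublinearI)
    fix x y
    have "q (x + y) - b \<le> a" if a: "a \<in> S x" and b: "b \<in> S y" for a b
    proof -
      obtain w s where ws: "(w, s) \<in> K" "a = p (x + w) - s" using a by (auto simp: S_def)
      obtain w' s' where ws': "(w', s') \<in> K" "b = p (y + w') - s'" using b by (auto simp: S_def)
      have "(w + w', s + s') \<in> K" using K ws(1) ws'(1) by (force simp: slope_cone_def)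
      then have "q (x + y) \<le> p ((x + w) + (y + w')) - (s + s')"
        using q_le[of "w + w'" "s + s'" "x + y"] by (simp add: algebra_simps)
      then show ?thesis using sublinear_add[OF p, of "x + w" "y + w'"] ws ws' by linarith
    qed
    then have "q (x + y) - b \<le> q x" if "b \<in> S y" for b
      unfolding q_def[of x] by (intro cInf_greatest ne) (use that in auto)
    then have "q (x + y) - q x \<le> q y"
      unfolding q_def[of y] by (intro cInf_greatest ne) (simp add: diff_le_eq add.commute)
    then show "q (x + y) \<le> q x + q y" by simp
  next
    fix c :: real and x assume c: "0 < c"
    have "inverse c * q (c *\<^sub>R x) \<le> q x"
      unfolding q_def[of x]
    proof (intro cInf_greatest ne)
      fix a assume "a \<in> S x"
      then obtain w s where ws: "(w, s) \<in> K" "a = p (x + w) - s" by (auto simp: S_def)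
      have "(c *\<^sub>R w, c * s) \<in> K" using K ws(1) c by (force simp: slope_cone_def)
      then have "q (c *\<^sub>R x) \<le> p (c *\<^sub>R (x + w)) - c * s"
        using q_le[of "c *\<^sub>R w" "c * s" "c *\<^sub>R x"] by (simp add: scaleR_add_right)
      also have "\<dots> = c * a" using sublinear_scale[OF p, of c] c ws by (simp add: right_diff_distrib)
      finally show "inverse c * q (c *\<^sub>R x) \<le> a" using c by (simp add: field_simps)
    qed
    then show "q (c *\<^sub>R x) \<le> c * q x" using c by (simp add: field_simps)
  next
    have "q 0 \<le> 0" using q_le[of 0 0 0] K sublinear_0[OF p] by (simp add: slope_cone_def)
    moreover have "0 \<le> q 0"
      unfolding q_def by (intro cInf_greatest ne) (use lb[of _ 0] sublinear_0[OF p] in simp)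
    ultimately show "q 0 = 0" by simp
  qed
  moreover have "q z \<le> p z" for z using q_le[of 0 0 z] K by (simp add: slope_cone_def)
  moreover have "q (- w) \<le> - s" if "(w, s) \<in> K" for w s
    using q_le[OF that, of "- w"] sublinear_0[OF p] by simp
  ultimately show ?thesis using that by blast
qed

lemma slope_cone_ray: "slope_cone {(t *\<^sub>R v, t * s) | t. 0 \<le> t}"
  unfolding slope_cone_def
proof (intro conjI ballI allI impI)
  show "(0, 0) \<in> {(t *\<^sub>R v, t * s) | t. 0 \<le> t}" by (force intro: exI[of _ 0])
  fix a assume "a \<in> {(t *\<^sub>R v, t * s) | t. 0 \<le> t}"
  then obtain t where t: "0 \<le> t" "a = (t *\<^sub>R v, t * s)" by blast
  { fix b assume "b \<in> {(t *\<^sub>R v, t * s) | t. 0 \<le> t}"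
    then obtain u where u: "0 \<le> u" "b = (u *\<^sub>R v, u * s)" by blast
    have "a + b = ((t + u) *\<^sub>R v, (t + u) * s)" using t u by (simp add: algebra_simps)
    then show "a + b \<in> {(t *\<^sub>R v, t * s) | t. 0 \<le> t}" using t u by (auto intro: add_nonneg_nonneg) }
  { fix c :: real assume "0 < c"
    then have "0 \<le> c * t" "c *\<^sub>R a = ((c * t) *\<^sub>R v, (c * t) * s)" using t by simp_all
    then show "c *\<^sub>R a \<in> {(t *\<^sub>R v, t * s) | t. 0 \<le> t}" by blast }
qed

text \<open>Lowering \<open>m\<close> along the ray through \<open>v\<close> yields a sublinear
  functional below \<open>m\<close>, which by minimality is \<open>m\<close> itself. This gives
  \<open>m (- v) \<le> - m v\<close>, so \<open>m\<close> is odd, and an odd sublinear functional is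
  linear.\<close>

lemma minimal_sublinear_linear:
  assumes m: "sublinear m" and min: "\<And>q. sublinear q \<Longrightarrow> (\<And>z. q z \<le> m z) \<Longrightarrow> q = m"
  shows "linear m"
proof -
  have neg: "m (- v) = - m v" for v
  proof -
    define K where "K = {(t *\<^sub>R v, t * m v) | t. 0 \<le> t}"
    have K: "slope_cone K" unfolding K_def by (rule slope_cone_ray)
    have le: "s \<le> m w" if "(w, s) \<in> K" for w s using that sublinear_scale[OF m] by (auto simp: K_def)
    obtain q where q: "sublinear q" "\<And>z. q z \<le> m z" "\<And>w s. (w, s) \<in> K \<Longrightarrow> q (- w) \<le> - s"
      using sublinear_lower[OF m K le] by blast
    have "(v, m v) \<in> K" by (force simp: K_def intro: exI[of _ 1])
    then have "m (- v) \<le> - m v" using q(3) min[OF q(1,2)] by simp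
    moreover have "0 \<le> m v + m (- v)" using sublinear_add[OF m, of v "- v"] sublinear_0[OF m] by simp
    ultimately show ?thesis by linarith
  qed
  have "m (x + y) = m x + m y" for x y
    using sublinear_add[OF m, of x y] sublinear_add[OF m, of "x + y" "- y"] neg[of y] by simp
  moreover have "m (c *\<^sub>R x) = c * m x" for c x
    using sublinear_scale[OF m, of c x] sublinear_scale[OF m, of "- c" x] neg[of "c *\<^sub>R x"] by (cases "0 \<le> c") auto
  ultimately show ?thesis by (intro linearI) auto
qed

text \<open>Zorn's lemma is applied downwards to the sublinear functionals below \<open>p\<close>
  rather than to partial linear extensions: the pointwise infimum of a chain is sublinear, and a
  minimal element is linear.\<close>

lemma hahn_banach:
  assumes p: "sublinear p"
  obtains f where "linear f" "\<And>x. f x \<le> p x"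
proof -
  define A where "A = {q. sublinear q \<and> q \<le> p}"
  let ?r = "relation_of (\<ge>) A"
  have po: "partial_order_on A ?r"
    by (rule partial_order_on_relation_ofI) auto
  have ch: "\<exists>u\<in>A. \<forall>a\<in>C. u \<le> a" if C: "C \<in> Chains ?r" for C
  proof (cases "C = {}")
    case True
    then show ?thesis using p by (auto simp: A_def)
  next
    case False
    have CA: "q \<in> A" if "q \<in> C" for q using C that by (auto simp: Chains_def relation_of_def)
    have tot: "q \<le> q' \<or> q' \<le> q" if "q \<in> C" "q' \<in> C" for q q'
      using C that by (auto simp: Chains_def relation_of_def)
    define u where "u x = (INF q\<in>C. q x)" for x
    \<comment> \<open>From \<open>0 \<le> q x + q (- x)\<close> and \<open>q \<le> p\<close>; the
      bound is common to the chain, so the pointwise infimum exists.\<close>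
    have lb: "- p (- x) \<le> q x" if "q \<in> C" for q x
    proof -
      have q: "sublinear q" "q (- x) \<le> p (- x)" using CA[OF that] by (auto simp: A_def le_fun_def)
      show ?thesis using sublinear_add[OF q(1), of x "- x"] sublinear_0[OF q(1)] q(2) by simp
    qed
    have u_le: "u x \<le> q x" if "q \<in> C" for q x
      unfolding u_def by (rule cINF_lower) (use that lb in \<open>auto intro!: bdd_belowI\<close>)
    have "sublinear u"
    proof (rule sublinearI)
      fix x y
      \<comment> \<open>Two members of the chain are comparable, and the smaller one serves for both
        \<open>x\<close> and \<open>y\<close>.\<close>
      have *: "u (x + y) \<le> q x + q' y" if qq: "q \<in> C" "q' \<in> C" for q q'
      proof -
        obtain q0 where q0: "q0 \<in> C" "q0 \<le> q" "q0 \<le> q'" using tot[OF qq] qq by blast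
        have "u (x + y) \<le> q0 x + q0 y"
          using u_le[OF q0(1), of "x + y"] sublinear_add[of q0 x y] CA[OF q0(1)] by (auto simp: A_def)
        then show ?thesis using le_funD[OF q0(2), of x] le_funD[OF q0(3), of y] by linarith
      qed
      have "u (x + y) - q' y \<le> u x" if "q' \<in> C" for q'
        unfolding u_def[of x] by (rule cINF_greatest[OF False]) (use * that in \<open>simp add: diff_le_eq\<close>)
      then have "u (x + y) - u x \<le> u y"
        unfolding u_def[of y] by (intro cINF_greatest[OF False]) (simp add: diff_le_eq add.commute)
      then show "u (x + y) \<le> u x + u y" by simp
    next
      fix c :: real and x assume c: "0 < c"
      have "inverse c * u (c *\<^sub>R x) \<le> u x"
        unfolding u_def[of x]
      proof (rule cINF_greatest[OF False])
        fix q assume q: "q \<in> C"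
        then have "u (c *\<^sub>R x) \<le> c * q x"
          using u_le[OF q, of "c *\<^sub>R x"] CA[OF q] c by (simp add: A_def sublinear_scale)
        then show "inverse c * u (c *\<^sub>R x) \<le> q x" using c by (simp add: field_simps)
      qed
      then show "u (c *\<^sub>R x) \<le> c * u x" using c by (simp add: field_simps)
    next
      have "(INF q\<in>C. q 0) = (INF q\<in>C. 0 :: real)"
        using CA by (intro INF_cong) (auto simp: A_def sublinear_0)
      then show "u 0 = 0" using False by (simp add: u_def)
    qed
    moreover have "u \<le> p"
    proof -
      obtain q where q: "q \<in> C" using False by blast
      show ?thesis
      proof (rule le_funI)
        fix x
        have "q x \<le> p x" using CA[OF q] by (simp add: A_def le_fun_def)
        then show "u x \<le> p x" using u_le[OF q, of x] by linarith
      qed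
    qed
    ultimately show ?thesis using u_le by (auto simp: A_def le_fun_def)
  qed
  obtain m where m: "m \<in> A" "\<And>a. a \<in> A \<Longrightarrow> a \<le> m \<Longrightarrow> a = m"
    using predicate_Zorn[OF po] ch by blast
  have "linear m"
  proof (rule minimal_sublinear_linear)
    show "sublinear m" using m(1) by (simp add: A_def)
    fix q assume "sublinear q" "\<And>z. q z \<le> m z"
    then have "q \<le> m" by (simp add: le_funI)
    moreover from this have "q \<le> p" using m(1) unfolding A_def by (blast intro: order_trans)
    ultimately show "q = m" using m(2)[of q] \<open>sublinear q\<close> by (simp add: A_def)
  qed
  then show ?thesis using that m(1) by (auto simp: A_def le_fun_def)
qed

lemma hahn_banach_cone:
  assumes "sublinear p" "slope_cone K" "\<And>w s. (w, s) \<in> K \<Longrightarrow> s \<le> p w"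
  obtains f where "linear f" "\<And>x. f x \<le> p x" "\<And>w s. (w, s) \<in> K \<Longrightarrow> s \<le> f w"
proof -
  obtain q where q: "sublinear q" "\<And>z. q z \<le> p z" "\<And>w s. (w, s) \<in> K \<Longrightarrow> q (- w) \<le> - s"
    using sublinear_lower[OF assms] by blast
  obtain f where f: "linear f" "\<And>x. f x \<le> q x" using hahn_banach[OF q(1)] by blast
  show ?thesis
  proof (rule that[OF f(1)])
    show "f x \<le> p x" for x using f(2)[of x] q(2)[of x] by linarith
    show "s \<le> f w" if "(w, s) \<in> K" for w s
      using f(2)[of "- w"] q(3)[OF that] linear_neg[OF f(1), of w] by linarith
  qed
qed

lemma hahn_banach_functional:
  fixes K :: "('a::real_normed_vector \<times> real) set"
  assumes "slope_cone K" "\<And>w s. (w, s) \<in> K \<Longrightarrow> s \<le> norm w"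
  obtains f :: "'a \<Rightarrow>\<^sub>L real" where "\<And>x. \<bar>f x\<bar> \<le> norm x" "\<And>w s. (w, s) \<in> K \<Longrightarrow> s \<le> f w"
proof -
  obtain f :: "'a \<Rightarrow> real" where f: "linear f" "\<And>x. f x \<le> norm x" "\<And>w s. (w, s) \<in> K \<Longrightarrow> s \<le> f w"
    using hahn_banach_cone[OF sublinear_norm assms] by blast
  have b: "\<bar>f x\<bar> \<le> norm x" for x
    using f(2)[of x] f(2)[of "- x"] linear_neg[OF f(1), of x] by simp
  have "bounded_linear f"
    using f(1) b by (intro bounded_linear_intro[of f 1]) (auto simp: linear_add linear_scale)
  then show ?thesis using that[of "Blinfun f"] b f(3) by (simp add: bounded_linear_Blinfun_apply)
qed

lemma norming_functional:
  fixes x :: "'a::real_normed_vector"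
  obtains f :: "'a \<Rightarrow>\<^sub>L real" where "\<And>z. \<bar>f z\<bar> \<le> norm z" "f x = norm x"
proof -
  define K where "K = {(t *\<^sub>R x, t * norm x) | t. 0 \<le> t}"
  have K: "slope_cone K" unfolding K_def by (rule slope_cone_ray)
  have le: "s \<le> norm w" if "(w, s) \<in> K" for w s using that by (auto simp: K_def)
  obtain f :: "'a \<Rightarrow>\<^sub>L real" where f: "\<And>z. \<bar>f z\<bar> \<le> norm z"
    "\<And>w s. (w, s) \<in> K \<Longrightarrow> s \<le> f w"
    using hahn_banach_functional[OF K le] by blast
  have "(x, norm x) \<in> K" by (force simp: K_def intro: exI[of _ 1])
  then have "f x = norm x" using f(2)[of x "norm x"] f(1)[of x] by linarith
  with f(1) show ?thesis using that by blast
qed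

lemma separating_functional:
  fixes C :: "'a::real_normed_vector set"
  assumes C: "convex C" "closed C" "C \<noteq> {}" and x: "x \<notin> C"
  obtains f :: "'a \<Rightarrow>\<^sub>L real" and r where "0 < r" "\<And>c. c \<in> C \<Longrightarrow> r \<le> f x - f c"
proof -
  \<comment> \<open>With \<open>r\<close> the distance from \<open>x\<close> to \<open>C\<close>,
    every \<open>c\<close> in \<open>C\<close> satisfies \<open>r \<le> norm (x - c)\<close>, so a
    functional below the norm may be asked for \<open>r \<le> f (x - c)\<close>.\<close>
  define r where "r = infdist x C"
  have r: "0 < r" using in_closed_iff_infdist_zero[OF C(2,3), of x] infdist_nonneg[of x C] x by (simp add: r_def)
  define K where "K = {(t *\<^sub>R (x - c), t * r) | t c. 0 \<le> t \<and> c \<in> C}"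
  have KI: "(t *\<^sub>R (x - c), t * r) \<in> K" if "0 \<le> t" "c \<in> C" for t c using that by (auto simp: K_def)
  have KC: "slope_cone K"
    unfolding slope_cone_def
  proof (intro conjI ballI allI impI)
    obtain c where "c \<in> C" using C(3) by blast
    then show "(0, 0) \<in> K" using KI[of 0 c] by simp
    fix a assume "a \<in> K"
    then obtain t c where a: "0 \<le> t" "c \<in> C" "a = (t *\<^sub>R (x - c), t * r)" by (auto simp: K_def)
    { fix b assume "b \<in> K"
      then obtain u e where b: "0 \<le> u" "e \<in> C" "b = (u *\<^sub>R (x - e), u * r)" by (auto simp: K_def)
      show "a + b \<in> K"
      proof (cases "t + u = 0")
        case True
        then have "t = 0" "u = 0" using a b by auto
        then show ?thesis using \<open>(0, 0) \<in> K\<close> a b by simp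
      next
        case False
        \<comment> \<open>By convexity, a sum of two multiples of differences \<open>x - c\<close>,
          \<open>x - e\<close> is again a multiple of one such difference.\<close>
        define w where "w = (t / (t + u)) *\<^sub>R c + (u / (t + u)) *\<^sub>R e"
        have "w \<in> C" unfolding w_def using a b False
          by (intro convexD[OF C(1)]) (auto simp: add_divide_distrib[symmetric])
        moreover have "(t + u) *\<^sub>R w = t *\<^sub>R c + u *\<^sub>R e" using False by (simp add: w_def scaleR_add_right)
        then have "a + b = ((t + u) *\<^sub>R (x - w), (t + u) * r)"
          using a b by (simp add: algebra_simps)
        ultimately show ?thesis using KI[of "t + u" w] a b by simp
      qed }
    { fix k :: real assume "0 < k"
      then show "k *\<^sub>R a \<in> K" using KI[of "k * t" c] a by (simp add: mult.assoc) }
  qed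
  have le: "s \<le> norm w" if ws: "(w, s) \<in> K" for w s
  proof -
    obtain t c where a: "0 \<le> t" "c \<in> C" "w = t *\<^sub>R (x - c)" "s = t * r" using ws by (auto simp: K_def)
    then show ?thesis using infdist_le[OF a(2), of x] by (simp add: r_def dist_norm mult_left_mono)
  qed
  obtain f :: "'a \<Rightarrow>\<^sub>L real" where "\<And>x. \<bar>f x\<bar> \<le> norm x" and f: "\<And>w s. (w, s) \<in> K \<Longrightarrow> s \<le> f w"
    using hahn_banach_functional[OF KC le] by blast
  have "r \<le> f x - f c" if "c \<in> C" for c
    using f[of "x - c" r] KI[of 1 c] that by (simp add: blinfun.diff_right)
  with r show ?thesis using that by blast
qed

text \<open>Nothing is required of \<open>L\<close> on unbounded sequences.\<close>

definition generalized_limit :: "((nat \<Rightarrow> real) \<Rightarrow> real) \<Rightarrow> bool" where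
  "generalized_limit L \<longleftrightarrow>
     (\<forall>u v. bounded (range u) \<longrightarrow> bounded (range v) \<longrightarrow> L (\<lambda>n. u n + v n) = L u + L v) \<and>
     (\<forall>u c. bounded (range u) \<longrightarrow> L (\<lambda>n. c * u n) = c * L u) \<and>
     (\<forall>u s. bounded (range u) \<longrightarrow> (\<forall>\<^sub>F n in sequentially. s \<le> u n) \<longrightarrow> s \<le> L u)"

text \<open>Bounded sequences are the bounded continuous functions on the discrete space
  \<open>nat\<close>, a normed space to which the Hahn-Banach theorem applies. The cone of eventual
  lower bounds forces the functional to depend on the tails only.\<close>

lemma generalized_limit_exists: "\<exists>L. generalized_limit L"
proof -
  define K :: "((nat \<Rightarrow>\<^sub>C real) \<times> real) set" where "K = {(w, s). \<forall>\<^sub>F n in sequentially. s \<le> apply_bcontfun w n}"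
  have KC: "slope_cone K"
    unfolding slope_cone_def
  proof (intro conjI ballI allI impI)
    show "(0, 0) \<in> K" by (simp add: K_def)
    show "a + b \<in> K" if "a \<in> K" "b \<in> K" for a b
    proof -
      have "\<forall>\<^sub>F n in sequentially. snd a \<le> apply_bcontfun (fst a) n"
        "\<forall>\<^sub>F n in sequentially. snd b \<le> apply_bcontfun (fst b) n"
        using that by (auto simp: K_def split_beta)
      then have "\<forall>\<^sub>F n in sequentially. snd a + snd b \<le> apply_bcontfun (fst a + fst b) n"
        by eventually_elim (simp add: add_mono)
      then show ?thesis by (simp add: K_def split_beta)
    qed
    show "c *\<^sub>R a \<in> K" if "0 < c" "a \<in> K" for c a
      using that unfolding K_def by (auto elim: eventually_mono)
  qed
  have le: "s \<le> norm w" if ws: "(w, s) \<in> K" for w s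
  proof -
    obtain n where "s \<le> apply_bcontfun w n" using ws by (auto simp: K_def eventually_sequentially)
    then show ?thesis using norm_bounded[of w n] by simp
  qed
  obtain f :: "(nat \<Rightarrow>\<^sub>C real) \<Rightarrow>\<^sub>L real"
    where "\<And>x. \<bar>f x\<bar> \<le> norm x" and f: "\<And>w s. (w, s) \<in> K \<Longrightarrow> s \<le> f w"
    using hahn_banach_functional[OF KC le] by blast
  define L where "L u = f (Bcontfun u)" for u
  have B: "apply_bcontfun (Bcontfun u) = u" if "bounded (range u)" for u :: "nat \<Rightarrow> real"
    using that by (intro Bcontfun_inverse) (simp add: bcontfun_def)
  have "L (\<lambda>n. u n + v n) = L u + L v" if "bounded (range u)" "bounded (range v)" for u v
  proof -
    have "bounded (range (\<lambda>n. u n + v n))" using bounded_plus_comp[OF that] by simp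
    then have "Bcontfun (\<lambda>n. u n + v n) = Bcontfun u + Bcontfun v"
      by (intro bcontfun_eqI) (simp add: B that)
    then show ?thesis by (simp add: L_def blinfun.add_right)
  qed
  moreover have "L (\<lambda>n. c * u n) = c * L u" if "bounded (range u)" for u c
  proof -
    have "bounded (range (\<lambda>n. c * u n))" using bounded_scaling[OF that, of c] by (simp add: image_image)
    then have "Bcontfun (\<lambda>n. c * u n) = c *\<^sub>R Bcontfun u"
      by (intro bcontfun_eqI) (simp add: B that)
    then show ?thesis by (simp add: L_def blinfun.scaleR_right)
  qed
  moreover have "s \<le> L u" if "bounded (range u)" "\<forall>\<^sub>F n in sequentially. s \<le> u n" for u s
    using f[of "Bcontfun u" s] that by (simp add: K_def L_def B)
  ultimately show ?thesis unfolding generalized_limit_def by blast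
qed

section \<open>Weak limits in a reflexive space\<close>

context
  fixes L assumes L: "generalized_limit L"
begin

lemma gl_add: "bounded (range u) \<Longrightarrow> bounded (range v) \<Longrightarrow> L (\<lambda>n. u n + v n) = L u + L v"
  using L by (simp add: generalized_limit_def)

lemma gl_scale: "bounded (range u) \<Longrightarrow> L (\<lambda>n. c * u n) = c * L u"
  using L by (simp add: generalized_limit_def)

lemma gl_ge: "bounded (range u) \<Longrightarrow> \<forall>\<^sub>F n in sequentially. s \<le> u n \<Longrightarrow> s \<le> L u"
  using L by (simp add: generalized_limit_def)

lemma gl_le:
  assumes "bounded (range u)" "\<forall>\<^sub>F n in sequentially. u n \<le> s" shows "L u \<le> s"
proof -
  have "bounded (range (\<lambda>n. - 1 * u n))" using bounded_scaling[OF assms(1), of "- 1"] by (simp add: image_image)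
  then have "- s \<le> L (\<lambda>n. - 1 * u n)" using assms(2) by (intro gl_ge) simp_all
  then show ?thesis using gl_scale[OF assms(1), of "- 1"] by simp
qed

lemma gl_lim:
  assumes "u \<longlonglongrightarrow> l" shows "L u = l"
proof -
  have b: "bounded (range u)" using assms convergent_imp_bounded by blast
  have up: "L u \<le> l + e" if "0 < e" for e
    using order_tendstoD(2)[OF assms, of "l + e"] that by (intro gl_le[OF b]) (auto elim: eventually_mono)
  have lo: "l \<le> L u + e" if "0 < e" for e
  proof -
    have "l - e \<le> L u"
      using order_tendstoD(1)[OF assms, of "l - e"] that by (intro gl_ge[OF b]) (auto elim: eventually_mono)
    then show ?thesis by simp
  qed
  have "L u \<le> l" by (rule field_le_epsilon) (rule up)
  moreover have "l \<le> L u" by (rule field_le_epsilon) (rule lo)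
  ultimately show ?thesis by simp
qed

lemma bounded_functional:
  fixes f :: "'a::real_normed_vector \<Rightarrow>\<^sub>L real"
  assumes "bounded (range u)" shows "bounded (range (\<lambda>n. f (u n)))"
  using bounded_linear_image[OF assms blinfun.bounded_linear_right[of f]] by (simp add: image_image)

text \<open>Sending \<open>f\<close> to the generalized limit of \<open>f (u n)\<close> is a bounded
  functional on the dual space; reflexivity represents it by a point.\<close>

lemma weak_limit_exists:
  assumes "reflexive_space TYPE('a::real_normed_vector)" and u: "bounded (range u)"
  shows "\<exists>x::'a. \<forall>f :: 'a \<Rightarrow>\<^sub>L real. f x = L (\<lambda>n. f (u n))"
proof -
  obtain B where B: "\<And>n. norm (u n) \<le> B" using u by (auto simp: bounded_iff)
  define \<phi> where "\<phi> f = L (\<lambda>n. blinfun_apply f (u n))" for f :: "'a \<Rightarrow>\<^sub>L real"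
  have "bounded_linear \<phi>"
  proof (rule bounded_linear_intro)
    show "\<phi> (f + g) = \<phi> f + \<phi> g" for f g
      using gl_add[OF bounded_functional[OF u] bounded_functional[OF u], of f g]
      by (simp add: \<phi>_def blinfun.add_left)
    show "\<phi> (c *\<^sub>R f) = c *\<^sub>R \<phi> f" for c f
      using gl_scale[OF bounded_functional[OF u], of c f] by (simp add: \<phi>_def blinfun.scaleR_left)
    show "norm (\<phi> f) \<le> norm f * B" for f
    proof -
      have "\<bar>f (u n)\<bar> \<le> norm f * B" for n
        using norm_blinfun[of f "u n"] mult_left_mono[OF B[of n] norm_ge_zero[of f]] by simp
      then have "- (norm f * B) \<le> f (u n)" "f (u n) \<le> norm f * B" for n
        using abs_le_iff by (metis minus_le_iff)+
      then have "\<phi> f \<le> norm f * B" "- (norm f * B) \<le> \<phi> f"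
        unfolding \<phi>_def by (auto intro: gl_le gl_ge bounded_functional[OF u])
      then show ?thesis by (simp add: abs_le_iff)
    qed
  qed
  then have "\<And>f. blinfun_apply (Blinfun \<phi>) f = \<phi> f" by (simp add: bounded_linear_Blinfun_apply)
  moreover obtain x where "\<And>f. blinfun_apply (Blinfun \<phi>) f = blinfun_apply f x"
    using assms(1) unfolding reflexive_space_def by blast
  ultimately show ?thesis by (auto simp: \<phi>_def)
qed

definition weak_limit :: "(nat \<Rightarrow> 'a::real_normed_vector) \<Rightarrow> 'a" where
  "weak_limit u = (SOME x. \<forall>f :: 'a \<Rightarrow>\<^sub>L real. f x = L (\<lambda>n. f (u n)))"

lemma weak_limit:
  fixes f :: "'a::real_normed_vector \<Rightarrow>\<^sub>L real"
  assumes "reflexive_space TYPE('a)" "bounded (range u)"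
  shows "f (weak_limit u) = L (\<lambda>n. f (u n))"
  using someI_ex[OF weak_limit_exists[OF assms]] unfolding weak_limit_def by blast

lemma norm_weak_limit_le:
  fixes u :: "nat \<Rightarrow> 'a::real_normed_vector"
  assumes refl: "reflexive_space TYPE('a)" and u: "bounded (range u)"
    and le: "\<And>e. 0 < e \<Longrightarrow> \<forall>\<^sub>F n in sequentially. norm (u n) \<le> r + e"
  shows "norm (weak_limit u) \<le> r"
proof (rule field_le_epsilon)
  fix e :: real assume e: "0 < e"
  obtain f :: "'a \<Rightarrow>\<^sub>L real" where f: "\<And>z. \<bar>f z\<bar> \<le> norm z" "f (weak_limit u) = norm (weak_limit u)"
    using norming_functional by blast
  have "L (\<lambda>n. f (u n)) \<le> r + e"
  proof (rule gl_le[OF bounded_functional[OF u]])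
    show "\<forall>\<^sub>F n in sequentially. f (u n) \<le> r + e"
      using le[OF e]
    proof eventually_elim
      case (elim n)
      then show ?case using f(1)[of "u n"] by linarith
    qed
  qed
  then show "norm (weak_limit u) \<le> r + e" using weak_limit[OF refl u, of f] f(2) by simp
qed

text \<open>Closed convex sets are weakly closed, by separation. A functional on the product splits
  into one functional for each component, and additivity of \<open>L\<close> lets it see the two
  weak limits jointly.\<close>

lemma weak_limit_pair_in:
  fixes C :: "('a::real_normed_vector \<times> 'a) set"
  assumes refl: "reflexive_space TYPE('a)" and u: "bounded (range u)" and v: "bounded (range v)"
    and C: "convex C" "closed C" and mem: "\<forall>\<^sub>F n in sequentially. (u n, v n) \<in> C"
  shows "(weak_limit u, weak_limit v) \<in> C"
proof (rule ccontr)
  assume "(weak_limit u, weak_limit v) \<notin> C"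
  moreover have "C \<noteq> {}" using mem by (auto simp: eventually_sequentially)
  ultimately obtain f :: "('a \<times> 'a) \<Rightarrow>\<^sub>L real" and r where
    f: "0 < r" "\<And>c. c \<in> C \<Longrightarrow> r \<le> f (weak_limit u, weak_limit v) - f c"
    using separating_functional[OF C] by blast
  have "bounded_linear (\<lambda>x. f (x, 0))" "bounded_linear (\<lambda>x. f (0, x))"
    by (intro bounded_linear_compose[OF blinfun.bounded_linear_right] bounded_linear_Pair
        bounded_linear_ident bounded_linear_zero)+
  then obtain g h :: "'a \<Rightarrow>\<^sub>L real" where gh: "\<And>x. g x = f (x, 0)" "\<And>x. h x = f (0, x)"
    by (metis bounded_linear_Blinfun_apply)
  have split: "f (x, y) = g x + h y" for x y
    using blinfun.add_right[of f "(x, 0)" "(0, y)"] by (simp add: gh)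
  note bb = bounded_functional[OF u, of g] bounded_functional[OF v, of h]
  have "L (\<lambda>n. g (u n) + h (v n)) \<le> f (weak_limit u, weak_limit v) - r"
  proof (rule gl_le)
    show "bounded (range (\<lambda>n. g (u n) + h (v n)))" using bounded_plus_comp[OF bb] by simp
    show "\<forall>\<^sub>F n in sequentially. g (u n) + h (v n) \<le> f (weak_limit u, weak_limit v) - r"
      using mem
    proof eventually_elim
      case (elim n)
      then show ?case using f(2)[OF elim] split[of "u n" "v n"] by simp
    qed
  qed
  then show False
    using gl_add[OF bb] weak_limit[OF refl u, of g] weak_limit[OF refl v, of h] f(1) by (simp add: split)
qed

end

section \<open>Geodesics\<close>

context convex_domain
begin

lemma qh_tendsto_0:
  assumes a: "a \<in> \<Omega>" and u: "u \<longlonglongrightarrow> a"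
  shows "(\<lambda>n. qh a (u n)) \<longlonglongrightarrow> 0"
proof (rule tendsto_sandwich)
  have lim: "(\<lambda>n. norm (u n - a)) \<longlonglongrightarrow> 0" using u by (simp add: LIM_zero tendsto_norm_zero)
  have ev: "\<forall>\<^sub>F n in sequentially. norm (u n - a) < bdist a"
    using order_tendstoD(2)[OF lim bdist_pos[OF a]] .
  show "\<forall>\<^sub>F n in sequentially. 0 \<le> qh a (u n)"
    using ev by eventually_elim (intro qh_nonneg a qh_le_near(1)[OF a])
  show "\<forall>\<^sub>F n in sequentially. qh a (u n) \<le> norm (u n - a) / (bdist a - norm (u n - a))"
    using ev by eventually_elim (rule qh_le_near(2)[OF a])
  have "(\<lambda>n. norm (u n - a) / (bdist a - norm (u n - a))) \<longlonglongrightarrow> 0 / (bdist a - 0)"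
    using bdist_pos[OF a] by (intro tendsto_intros lim) simp
  then show "(\<lambda>n. norm (u n - a) / (bdist a - norm (u n - a))) \<longlonglongrightarrow> 0" by simp
qed simp

lemma limit_in_domain:
  assumes "\<And>n. u n \<in> \<Omega>" "\<And>n. \<delta> \<le> bdist (u n)" "0 < \<delta>" "u \<longlonglongrightarrow> a"
  shows "a \<in> \<Omega>" "\<delta> \<le> bdist a"
proof -
  have "(\<lambda>n. bdist (u n)) \<longlonglongrightarrow> bdist a" by (intro tendsto_intros assms(4))
  then show \<delta>: "\<delta> \<le> bdist a"
    by (rule tendsto_lowerbound) (use assms(2) in auto)
  have "a \<in> closure \<Omega>" using assms(1,4) closure_sequential by blast
  moreover have "a \<notin> frontier \<Omega>"
    using \<delta> assms(3) in_closed_iff_infdist_zero[OF frontier_closed frontier_ne, of a] by auto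
  ultimately show "a \<in> \<Omega>" using interior_subset by (auto simp: frontier_def)
qed

text \<open>The bound \<open>\<delta>\<close> keeps both points away from the frontier; otherwise
  the relation would not be closed in the whole product space, since limits could leave
  \<open>\<Omega>\<close>.\<close>

definition qh_rel :: "real \<Rightarrow> real \<Rightarrow> ('a \<times> 'a) set" where
  "qh_rel \<delta> \<rho> = {(a, b). a \<in> \<Omega> \<and> b \<in> \<Omega> \<and> \<delta> \<le> bdist a \<and> \<delta> \<le> bdist b \<and> qh a b \<le> \<rho>}"

lemma closed_qh_rel:
  assumes "0 < \<delta>" shows "closed (qh_rel \<delta> \<rho>)"
  unfolding closed_sequential_limits
proof (intro allI impI)
  fix w l assume H: "(\<forall>n. w n \<in> qh_rel \<delta> \<rho>) \<and> w \<longlonglongrightarrow> l"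
  define a b where "a n = fst (w n)" and "b n = snd (w n)" for n
  have ab: "a n \<in> \<Omega>" "b n \<in> \<Omega>" "\<delta> \<le> bdist (a n)" "\<delta> \<le> bdist (b n)" "qh (a n) (b n) \<le> \<rho>" for n
    using H by (auto simp: a_def b_def qh_rel_def split_beta)
  have la: "a \<longlonglongrightarrow> fst l" and lb: "b \<longlonglongrightarrow> snd l"
    unfolding a_def b_def using H by (auto intro: tendsto_fst tendsto_snd)
  note A = limit_in_domain[OF ab(1,3) assms la] and B = limit_in_domain[OF ab(2,4) assms lb]
  have "qh (fst l) (snd l) \<le> qh (fst l) (a n) + \<rho> + qh (snd l) (b n)" for n
    using qh_triangle[OF A(1) ab(1) B(1), of n] qh_triangle[OF ab(1) ab(2) B(1), of n n] ab(5)[of n]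
      qh_commute[OF ab(2) B(1), of n] by linarith
  moreover have "(\<lambda>n. qh (fst l) (a n) + \<rho> + qh (snd l) (b n)) \<longlonglongrightarrow> 0 + \<rho> + 0"
    by (intro tendsto_intros qh_tendsto_0 A B la lb)
  ultimately have "qh (fst l) (snd l) \<le> 0 + \<rho> + 0" by (intro LIMSEQ_le_const) auto
  then show "l \<in> qh_rel \<delta> \<rho>" using A B by (auto simp: qh_rel_def split_beta)
qed

lemma convex_qh_rel: "convex (qh_rel \<delta> \<rho>)"
proof (rule convexI)
  fix x y and u v :: real assume xy: "x \<in> qh_rel \<delta> \<rho>" "y \<in> qh_rel \<delta> \<rho>" and uv: "0 \<le> u" "0 \<le> v" "u + v = 1"
  have *: "\<delta> \<le> bdist (u *\<^sub>R a + v *\<^sub>R b)" if "a \<in> \<Omega>" "b \<in> \<Omega>" "\<delta> \<le> bdist a" "\<delta> \<le> bdist b" for a b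
  proof -
    have "\<delta> = u * \<delta> + v * \<delta>" using uv(3) by (simp add: distrib_right[symmetric])
    also have "\<dots> \<le> u * bdist a + v * bdist b" using that uv by (intro add_mono mult_left_mono)
    also have "\<dots> \<le> bdist (u *\<^sub>R a + v *\<^sub>R b)" using bdist_concave[OF that(1,2) uv] .
    finally show ?thesis .
  qed
  show "u *\<^sub>R x + v *\<^sub>R y \<in> qh_rel \<delta> \<rho>"
    using xy * convexD[OF convex_dom _ _ uv] qh_convex[OF _ _ _ _ _ _ uv]
    by (auto simp: qh_rel_def split_beta)
qed

text \<open>A geodesic is a pointwise generalized weak limit of almost geodesics; the relations
  \<open>qh a b \<le> \<rho>\<close> survive because they are closed and convex in the product space.\<close>

lemma geodesic_exists:
  assumes refl: "reflexive_space TYPE('a)" and x: "x \<in> \<Omega>" and y: "y \<in> \<Omega>"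
  shows "\<exists>\<sigma>. qcurve (qh x y) \<sigma> \<and> \<sigma> 0 = x \<and> \<sigma> 1 = y"
proof -
  obtain L where L: "generalized_limit L" using generalized_limit_exists by blast
  define R where "R = qh x y"
  have "\<exists>\<sigma>. qcurve (R + inverse (real (Suc n))) \<sigma> \<and> \<sigma> 0 = x \<and> \<sigma> 1 = y" for n
    by (rule qcurve_exists[OF x y]) (simp add: R_def)
  then obtain S where S: "\<And>n. qcurve (R + inverse (real (Suc n))) (S n)" "\<And>n. S n 0 = x" "\<And>n. S n 1 = y"
    by metis
  have in\<Omega>: "S n t \<in> \<Omega>" if "0 \<le> t" "t \<le> 1" for n t using qcurve_in[OF S(1) that] .
  have R0: "0 \<le> R" using qh_nonneg[OF x y] by (simp add: R_def)
  have le: "qh x (S n t) \<le> R + 1" if "0 \<le> t" "t \<le> 1" for n t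
  proof -
    have "qh x (S n t) \<le> (R + inverse (real (Suc n))) * (t - 0)"
      using qcurve_le[OF S(1), of 0 t n] that S(2) by simp
    also have "\<dots> \<le> (R + 1) * 1"
      using that R0 by (intro mult_mono add_mono order_refl) (auto simp: inverse_eq_divide)
    finally show ?thesis by simp
  qed
  have bd: "bounded (range (\<lambda>n. S n t))" if "0 \<le> t" "t \<le> 1" for t
  proof -
    have "norm (S n t) \<le> norm x + bdist x * (exp (R + 1) - 1)" for n
      using norm_diff_le_qh(1)[OF x in\<Omega>[OF that] le[OF that], of n] norm_triangle_ineq2[of "S n t" x] by linarith
    then show ?thesis by (auto simp: bounded_iff)
  qed
  \<comment> \<open>All approximating curves stay within quasihyperbolic distance
    \<open>R + 1\<close> of \<open>x\<close>, which gives one lower bound for their boundary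
    distances.\<close>
  define \<delta> where "\<delta> = bdist x * exp (- (R + 1))"
  have \<delta>: "0 < \<delta>" using bdist_pos[OF x] by (simp add: \<delta>_def)
  have \<delta>le: "\<delta> \<le> bdist (S n t)" if "0 \<le> t" "t \<le> 1" for n t
    unfolding \<delta>_def by (rule bdist_ge_qh[OF x in\<Omega>[OF that] le[OF that]])
  define \<sigma> where "\<sigma> t = weak_limit L (\<lambda>n. S n t)" for t
  have rel: "(\<sigma> s, \<sigma> t) \<in> qh_rel \<delta> (R * (t - s) + e)" if st: "0 \<le> s" "s \<le> t" "t \<le> 1" and e: "0 < e" for s t e
    unfolding \<sigma>_def
  proof (rule weak_limit_pair_in[OF L refl bd bd convex_qh_rel closed_qh_rel[OF \<delta>]])
    have "(\<lambda>n. inverse (real (Suc n))) \<longlonglongrightarrow> 0" by (rule LIMSEQ_inverse_real_of_nat)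
    then have "\<forall>\<^sub>F n in sequentially. inverse (real (Suc n)) < e" using e by (rule order_tendstoD)
    then show "\<forall>\<^sub>F n in sequentially. (S n s, S n t) \<in> qh_rel \<delta> (R * (t - s) + e)"
    proof eventually_elim
      case (elim n)
      have "qh (S n s) (S n t) \<le> (R + inverse (real (Suc n))) * (t - s)" by (rule qcurve_le[OF S(1) st])
      also have "\<dots> \<le> R * (t - s) + inverse (real (Suc n)) * 1"
        unfolding distrib_right using st by (intro add_mono mult_left_mono order_refl) auto
      finally show ?case using elim in\<Omega> \<delta>le st by (simp add: qh_rel_def)
    qed
  qed (use st in auto)
  have "qcurve R \<sigma>"
    unfolding qcurve_def
  proof (intro conjI ballI allI impI)
    fix t :: real assume "t \<in> {0..1}"
    then show "\<sigma> t \<in> \<Omega>" using rel[of t t 1] by (simp add: qh_rel_def)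
  next
    fix s t :: real assume st: "0 \<le> s" "s \<le> t" "t \<le> 1"
    show "qh (\<sigma> s) (\<sigma> t) \<le> R * (t - s)"
      by (rule field_le_epsilon) (use rel[OF st] in \<open>simp add: qh_rel_def\<close>)
  qed
  \<comment> \<open>A singleton is closed and convex, so a constant sequence has its value as weak
    limit; this fixes the endpoints.\<close>
  moreover have "weak_limit L (\<lambda>n. z) = z" for z :: 'a
  proof -
    have "(weak_limit L (\<lambda>n. z), weak_limit L (\<lambda>n. z)) \<in> {(z, z)}"
      by (rule weak_limit_pair_in[OF L refl]) auto
    then show ?thesis by simp
  qed
  ultimately show ?thesis using S(2,3) by (auto simp: \<sigma>_def R_def)
qed

end

section \<open>Dyadic slopes\<close>

text \<open>Index of the half-open dyadic interval of level \<open>j\<close> containing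
  \<open>t\<close>. On \<open>{0..<1}\<close> exactly the indices below \<open>2 ^ j\<close> occur,
  which is why \<open>unit_measure\<close> leaves out the point \<open>1\<close>.\<close>

definition cell :: "nat \<Rightarrow> real \<Rightarrow> nat" where "cell j t = nat \<lfloor>2 ^ j * t\<rfloor>"

definition node :: "nat \<Rightarrow> nat \<Rightarrow> real" where "node j m = real m / 2 ^ j"

definition increment :: "nat \<Rightarrow> (real \<Rightarrow> 'a::real_vector) \<Rightarrow> nat \<Rightarrow> 'a" where
  "increment j g m = g (node j (Suc m)) - g (node j m)"

definition slope :: "nat \<Rightarrow> (real \<Rightarrow> 'a::real_vector) \<Rightarrow> real \<Rightarrow> 'a" where
  "slope j g t = 2 ^ j *\<^sub>R increment j g (cell j t)"

abbreviation unit_measure :: "real measure" where "unit_measure \<equiv> restrict_space lborel {0..<1}"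

lemma node_nonneg: "0 \<le> node j m" by (simp add: node_def)

lemma node_le_1: "m \<le> 2 ^ j \<Longrightarrow> node j m \<le> 1"
  by (simp add: node_def)

lemma node_Suc: "node j (Suc m) = node j m + 1 / 2 ^ j"
  by (simp add: node_def add_divide_distrib)

lemma cell_eq_iff: "0 \<le> t \<Longrightarrow> cell j t = m \<longleftrightarrow> node j m \<le> t \<and> t < node j (Suc m)"
  by (simp add: cell_def node_def nat_eq_iff floor_eq_iff divide_le_eq less_divide_eq mult.commute add.commute)

lemma cell_bounds: "0 \<le> t \<Longrightarrow> node j (cell j t) \<le> t" "0 \<le> t \<Longrightarrow> t < node j (Suc (cell j t))"
  using cell_eq_iff[of t j "cell j t"] by auto

lemma cell_less:
  assumes "0 \<le> t" "t < 1" shows "cell j t < 2 ^ j"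
proof -
  have "node j (cell j t) < 1" using cell_bounds(1)[OF assms(1), of j] assms(2) by linarith
  then have "real (cell j t) < real (2 ^ j)" by (simp add: node_def)
  then show ?thesis by (simp only: of_nat_less_iff)
qed

text \<open>The nesting of the dyadic partitions, on which the martingale property rests.\<close>

lemma cell_coarser: "cell j t = cell (j + l) t div 2 ^ l"
proof -
  have "2 ^ j * t = (2 ^ (j + l) * t) / real_of_int (2 ^ l)" by (simp add: power_add)
  then have "\<lfloor>2 ^ j * t\<rfloor> = \<lfloor>2 ^ (j + l) * t\<rfloor> div 2 ^ l"
    using floor_divide_real_eq_div[of "2 ^ l" "2 ^ (j + l) * t"] by simp
  then show ?thesis by (simp add: cell_def nat_div_distrib' nat_power_eq)
qed

lemma cell_measurable [measurable]: "cell j \<in> measurable lborel (count_space UNIV)"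
  unfolding cell_def by measurable

lemma cell_fun_measurable [measurable]: "(\<lambda>t. \<phi> (cell j t)) \<in> borel_measurable unit_measure"
  for \<phi> :: "nat \<Rightarrow> real"
  by (intro measurable_restrict_space1) measurable

lemma space_unit_measure: "space unit_measure = {0..<1}"
  by (simp add: space_restrict_space)

lemma finite_unit_measure: "finite_measure unit_measure"
  by (rule finite_measureI) (simp add: space_unit_measure emeasure_restrict_space)

lemma integrable_unit_bounded:
  fixes f :: "real \<Rightarrow> real"
  assumes "f \<in> borel_measurable unit_measure" "\<And>t. t \<in> {0..<1} \<Longrightarrow> \<bar>f t\<bar> \<le> B"
  shows "integrable unit_measure f"
  by (rule finite_measure.integrable_const_bound[OF finite_unit_measure, of _ B])
     (use assms in \<open>auto simp: space_unit_measure intro!: AE_I2\<close>)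

lemma cell_fun_integral:
  fixes \<phi> :: "nat \<Rightarrow> real"
  shows "integrable unit_measure (\<lambda>t. \<phi> (cell j t))"
    and "(\<integral>t. \<phi> (cell j t) \<partial>unit_measure) = (\<Sum>m<2 ^ j. \<phi> m) / 2 ^ j"
proof -
  have eq: "\<phi> (cell j t) = (\<Sum>m<2 ^ j. \<phi> m * indicator {node j m..<node j (Suc m)} t)" if "t \<in> {0..<1}" for t
  proof -
    have "(\<Sum>m<2 ^ j. \<phi> m * indicator {node j m..<node j (Suc m)} t) = (\<Sum>m<2 ^ j. if m = cell j t then \<phi> m else 0)"
    proof (rule sum.cong)
      fix m
      show "\<phi> m * indicator {node j m..<node j (Suc m)} t = (if m = cell j t then \<phi> m else 0)"
        using cell_eq_iff[of t j m] that by (auto simp: indicator_def)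
    qed simp
    also have "\<dots> = \<phi> (cell j t)" using cell_less[of t j] that by simp
    finally show ?thesis by simp
  qed
  have m: "measure unit_measure {node j m..<node j (Suc m)} = 1 / 2 ^ j"
    "{node j m..<node j (Suc m)} \<in> sets unit_measure" if "m < 2 ^ j" for m
  proof -
    have sub: "{node j m..<node j (Suc m)} \<subseteq> {0..<1}"
      using node_nonneg[of j m] node_le_1[of "Suc m" j] that by auto
    then show "{node j m..<node j (Suc m)} \<in> sets unit_measure"
      by (auto simp: sets_restrict_space_iff)
    show "measure unit_measure {node j m..<node j (Suc m)} = 1 / 2 ^ j"
      using sub by (subst measure_restrict_space) (auto simp: node_Suc)
  qed
  have int: "integrable unit_measure (\<lambda>t. \<phi> m * indicator {node j m..<node j (Suc m)} t)" if "m < 2 ^ j" for m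
    using m[OF that] finite_measure.emeasure_finite[OF finite_unit_measure]
    by (intro integrable_mult_right integrable_real_indicator) (auto simp: less_top)
  have "integrable unit_measure (\<lambda>t. \<Sum>m<2 ^ j. \<phi> m * indicator {node j m..<node j (Suc m)} t)"
    by (intro Bochner_Integration.integrable_sum int) simp
  then show "integrable unit_measure (\<lambda>t. \<phi> (cell j t))"
    by (subst Bochner_Integration.integrable_cong[OF refl eq]) (simp_all add: space_unit_measure)
  have "(\<integral>t. \<phi> (cell j t) \<partial>unit_measure) =
      (\<integral>t. (\<Sum>m<2 ^ j. \<phi> m * indicator {node j m..<node j (Suc m)} t) \<partial>unit_measure)"
    by (rule Bochner_Integration.integral_cong) (simp_all add: space_unit_measure eq)
  also have "\<dots> = (\<Sum>m<2 ^ j. \<integral>t. \<phi> m * indicator {node j m..<node j (Suc m)} t \<partial>unit_measure)"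
    by (rule Bochner_Integration.integral_sum) (rule int, simp)
  also have "\<dots> = (\<Sum>m<2 ^ j. \<phi> m * (1 / 2 ^ j))"
  proof (rule sum.cong[OF refl])
    fix k :: nat assume k: "k \<in> {..<2 ^ j}"
    let ?A = "{node j k..<node j (Suc k)}"
    have "(\<integral>t. indicat_real ?A t \<partial>unit_measure) = measure unit_measure (?A \<inter> space unit_measure)"
      by (rule Bochner_Integration.integral_indicator)
    also have "?A \<inter> space unit_measure = ?A"
      using sets.sets_into_space[OF m(2)[of k]] k by blast
    also have "measure unit_measure ?A = 1 / 2 ^ j" using m(1) k by blast
    finally show "(\<integral>t. \<phi> k * indicator ?A t \<partial>unit_measure) = \<phi> k * (1 / 2 ^ j)"
      by (simp only: integral_mult_right_zero)
  qed
  finally show "(\<integral>t. \<phi> (cell j t) \<partial>unit_measure) = (\<Sum>m<2 ^ j. \<phi> m) / 2 ^ j"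
    by (simp add: sum_divide_distrib)
qed

lemma slope_measurable [measurable]: "slope j g \<in> borel_measurable unit_measure"
  for g :: "real \<Rightarrow> real"
  unfolding slope_def[abs_def] by (rule cell_fun_measurable)

lemma sum_group:
  fixes f :: "nat \<Rightarrow> real"
  shows "(\<Sum>n<a * b. f n) = (\<Sum>m<a. \<Sum>i<b. f (m * b + i))"
proof -
  have "sum f {m * b..<m * b + b} = (\<Sum>i<b. f (m * b + i))" for m
    using sum.shift_bounds_nat_ivl[of f 0 "m * b" b] by (simp add: add.commute lessThan_atLeast0)
  then show ?thesis using sum.nat_group[of f b a] by simp
qed

lemma node_finer: "node (j + l) (m * 2 ^ l) = node j m"
  by (simp add: node_def power_add)

lemma sum_increment:
  fixes g :: "real \<Rightarrow> real"
  shows "(\<Sum>i<2 ^ l. increment (j + l) g (m * 2 ^ l + i)) = increment j g m"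
proof -
  have "(\<Sum>i<2 ^ l. increment (j + l) g (m * 2 ^ l + i)) =
      (\<Sum>i<2 ^ l. g (node (j + l) (m * 2 ^ l + Suc i)) - g (node (j + l) (m * 2 ^ l + i)))"
    by (simp add: increment_def)
  also have "\<dots> = g (node (j + l) (m * 2 ^ l + 2 ^ l)) - g (node (j + l) (m * 2 ^ l + 0))"
    by (rule sum_lessThan_telescope)
  also have "m * 2 ^ l + 2 ^ l = Suc m * 2 ^ l" by simp
  finally show ?thesis by (simp only: node_finer add_0_right increment_def)
qed

lemma norm_slope_bound:
  fixes g :: "real \<Rightarrow> 'a::real_normed_vector"
  assumes g: "C-lipschitz_on {0..1} g" and t: "t \<in> {0..<1}"
  shows "norm (slope j g t) \<le> C"
proof -
  have n: "node j (cell j t) \<in> {0..1}" "node j (Suc (cell j t)) \<in> {0..1}"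
    using cell_less[of t j] t by (auto intro!: node_nonneg node_le_1)
  have "norm (increment j g (cell j t)) \<le> C * (1 / 2 ^ j)"
    using lipschitz_onD[OF g n(2,1)] by (simp add: increment_def dist_norm node_Suc)
  then show ?thesis by (simp add: slope_def field_simps)
qed

lemma slope_bound:
  fixes g :: "real \<Rightarrow> real"
  assumes "C-lipschitz_on {0..1} g" "t \<in> {0..<1}"
  shows "\<bar>slope j g t\<bar> \<le> C"
  using norm_slope_bound[OF assms] by simp

text \<open>The martingale property in integrated form: against a function that is constant on cells
  of level \<open>j\<close>, finer increments telescope to those of level \<open>j\<close>.\<close>

lemma integral_cell_slope:
  fixes g :: "real \<Rightarrow> real"
  shows "(\<integral>t. \<psi> (cell j t) * slope (j + l) g t \<partial>unit_measure) = (\<Sum>m<2 ^ j. \<psi> m * increment j g m)"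
proof -
  have "(\<integral>t. \<psi> (cell j t) * slope (j + l) g t \<partial>unit_measure)
      = (\<integral>t. (\<lambda>n. \<psi> (n div 2 ^ l) * (2 ^ (j + l) * increment (j + l) g n)) (cell (j + l) t) \<partial>unit_measure)"
    by (simp add: slope_def cell_coarser[of j _ l])
  also have "\<dots> = (\<Sum>n<2 ^ j * 2 ^ l. \<psi> (n div 2 ^ l) * (2 ^ (j + l) * increment (j + l) g n)) / 2 ^ (j + l)"
    by (subst cell_fun_integral(2)) (simp add: power_add)
  also have "\<dots> = (\<Sum>n<2 ^ j * 2 ^ l. \<psi> (n div 2 ^ l) * increment (j + l) g n)"
    by (simp add: sum_divide_distrib mult.assoc)
  also have "\<dots> = (\<Sum>m<2 ^ j. \<Sum>i<2 ^ l. \<psi> m * increment (j + l) g (m * 2 ^ l + i))"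
    by (subst sum_group) (intro sum.cong refl, simp add: div_add1_eq)
  also have "\<dots> = (\<Sum>m<2 ^ j. \<psi> m * increment j g m)"
    by (simp add: sum_distrib_left[symmetric] sum_increment)
  finally show ?thesis .
qed

definition energy :: "nat \<Rightarrow> (real \<Rightarrow> real) \<Rightarrow> real" where
  "energy j g = (\<integral>t. slope j g t * slope j g t \<partial>unit_measure)"

text \<open>The slopes form a martingale, so their increments are orthogonal.\<close>

lemma integral_slope_diff_square:
  fixes g :: "real \<Rightarrow> real"
  assumes g: "C-lipschitz_on {0..1} g" and jk: "j \<le> k"
  shows "(\<integral>t. (slope k g t - slope j g t)\<^sup>2 \<partial>unit_measure) = energy k g - energy j g"
proof -
  obtain l where k: "k = j + l" using jk le_Suc_ex by blast
  have C: "0 \<le> C" using lipschitz_on_nonneg[OF g] .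
  have int: "integrable unit_measure (\<lambda>t. slope a g t * slope b g t)" for a b
    by (rule integrable_unit_bounded[of _ "C * C"])
       (use slope_bound[OF g] C in \<open>auto simp: abs_mult intro!: mult_mono borel_measurable_times slope_measurable\<close>)
  have cross: "(\<integral>t. slope j g t * slope (j + i) g t \<partial>unit_measure)
      = (\<Sum>m<2 ^ j. 2 ^ j * increment j g m * increment j g m)" for i
    using integral_cell_slope[of "\<lambda>m. 2 ^ j * increment j g m" j i g] by (simp add: slope_def)
  have "(\<integral>t. (slope k g t - slope j g t)\<^sup>2 \<partial>unit_measure) =
      (\<integral>t. slope k g t * slope k g t - 2 * (slope j g t * slope k g t) + slope j g t * slope j g t \<partial>unit_measure)"
    by (rule Bochner_Integration.integral_cong) (simp_all add: power2_eq_square algebra_simps)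
  also have "\<dots> = energy k g - 2 * (\<integral>t. slope j g t * slope k g t \<partial>unit_measure) + energy j g"
    by (simp add: int energy_def)
  also have "(\<integral>t. slope j g t * slope k g t \<partial>unit_measure) = energy j g"
    using cross[of l] cross[of 0] by (simp add: energy_def k)
  finally show ?thesis by simp
qed

lemma energy_mono:
  assumes "C-lipschitz_on {0..1} g" "j \<le> k" shows "energy j g \<le> energy k g"
proof -
  have "0 \<le> energy k g - energy j g"
    unfolding integral_slope_diff_square[OF assms, symmetric] by simp
  then show ?thesis by simp
qed

lemma measure_unit_space: "measure unit_measure (space unit_measure) = 1" "measure unit_measure {0..<1} = 1"
  by (simp_all add: space_unit_measure measure_restrict_space)

lemma integral_unit_le:
  fixes f :: "real \<Rightarrow> real"
  assumes "integrable unit_measure f" "\<And>t. t \<in> {0..<1} \<Longrightarrow> f t \<le> B"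
  shows "(\<integral>t. f t \<partial>unit_measure) \<le> B"
proof -
  have "(\<integral>t. f t \<partial>unit_measure) \<le> (\<integral>t. B \<partial>unit_measure)"
    using finite_measure.integrable_const[OF finite_unit_measure] assms
    by (intro integral_mono) (auto simp: space_unit_measure)
  then show ?thesis using measure_unit_space by simp
qed

lemma energy_bound:
  assumes g: "C-lipschitz_on {0..1} g" shows "energy j g \<le> C * C"
proof -
  have "\<bar>slope j g t * slope j g t\<bar> \<le> C * C" if "t \<in> {0..<1}" for t
    unfolding abs_mult using slope_bound[OF g that] lipschitz_on_nonneg[OF g] by (intro mult_mono) auto
  then show ?thesis
    unfolding energy_def
    by (intro integral_unit_le integrable_unit_bounded[of _ "C * C"] borel_measurable_times slope_measurable)
       (auto simp: abs_le_iff)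
qed

text \<open>The energies increase and are bounded, so by orthogonality the slopes are Cauchy in
  \<open>L2\<close>, hence in \<open>L1\<close>, and a subsequence is Cauchy almost everywhere.
  Starting from a given \<open>s\<close> allows the step to be iterated in a diagonal
  argument.\<close>

lemma slope_AE_convergent_subseq:
  fixes g :: "real \<Rightarrow> real"
  assumes g: "C-lipschitz_on {0..1} g" and s: "strict_mono (s :: nat \<Rightarrow> nat)"
  shows "\<exists>r. strict_mono r \<and> (AE t in unit_measure. convergent (\<lambda>j. slope ((s \<circ> r) j) g t))"
proof -
  have "Bseq (\<lambda>j. energy j g)"
    using energy_bound[OF g] by (intro BseqI'[of _ "C * C"]) (simp add: energy_def)
  moreover have "incseq (\<lambda>j. energy j g)" using energy_mono[OF g] by (rule monoI)
  ultimately have "Cauchy (\<lambda>j. energy j g)"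
    by (intro convergent_Cauchy Bseq_monoseq_convergent) (auto simp: monoseq_iff)
  have int: "integrable unit_measure (slope j g)" for j
    by (rule integrable_unit_bounded[OF slope_measurable slope_bound[OF g]])
  have "\<exists>N. \<forall>i\<ge>N. \<forall>j\<ge>N. (LINT t|unit_measure. norm (slope (s i) g t - slope (s j) g t)) < e" if e: "0 < e" for e
  proof -
    define d where "d = e / 2"
    have d: "0 < d" using e by (simp add: d_def)
    obtain N where N: "\<And>i j. N \<le> i \<Longrightarrow> N \<le> j \<Longrightarrow> \<bar>energy i g - energy j g\<bar> < d * d"
      using \<open>Cauchy (\<lambda>j. energy j g)\<close> d unfolding Cauchy_def dist_real_def by (metis mult_pos_pos)
    have sq: "integrable unit_measure (\<lambda>t. (slope i g t - slope j g t)\<^sup>2)" for i j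
    proof (rule integrable_unit_bounded[of _ "(C + C)\<^sup>2"])
      fix t :: real assume t: "t \<in> {0..<1}"
      have "\<bar>slope i g t - slope j g t\<bar> \<le> C + C"
        using slope_bound[OF g t, of i] slope_bound[OF g t, of j] by linarith
      then show "\<bar>(slope i g t - slope j g t)\<^sup>2\<bar> \<le> (C + C)\<^sup>2"
        using power_mono[of "\<bar>slope i g t - slope j g t\<bar>" "C + C" 2] by simp
    qed measurable
    have main: "(\<integral>t. \<bar>slope i g t - slope j g t\<bar> \<partial>unit_measure) < e" if ij: "N \<le> j" "j \<le> i" for i j
    proof -
      \<comment> \<open>This takes the place of the Cauchy-Schwarz inequality: an energy difference
        below \<open>d * d\<close> makes the integral less than \<open>2 * d = e\<close>.\<close>
      have "\<bar>x\<bar> \<le> d + x\<^sup>2 / d" for x :: real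
      proof (cases "\<bar>x\<bar> \<le> d")
        case True
        then show ?thesis using d by (simp add: add_increasing2)
      next
        case False
        then have "\<bar>x\<bar> * d \<le> \<bar>x\<bar> * \<bar>x\<bar>" by (intro mult_left_mono) auto
        then have "\<bar>x\<bar> \<le> x\<^sup>2 / d" using d by (simp add: pos_le_divide_eq power2_eq_square)
        then show ?thesis using d by linarith
      qed
      then have "(\<integral>t. \<bar>slope i g t - slope j g t\<bar> \<partial>unit_measure)
          \<le> (\<integral>t. d + (slope i g t - slope j g t)\<^sup>2 / d \<partial>unit_measure)"
        using int sq finite_measure.integrable_const[OF finite_unit_measure]
        by (intro integral_mono Bochner_Integration.integrable_add integrable_divide) auto
      also have "\<dots> = d + (energy i g - energy j g) / d"
        using sq[of i j] finite_measure.integrable_const[OF finite_unit_measure, of d]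
          integral_slope_diff_square[OF g ij(2)] by (simp add: measure_unit_space)
      also have "\<dots> < d + d"
        using N[of i j] ij d by (simp add: divide_less_eq abs_less_iff)
      finally show ?thesis by (simp add: d_def)
    qed
    have "(LINT t|unit_measure. norm (slope (s i) g t - slope (s j) g t)) < e" if "N \<le> i" "N \<le> j" for i j
    proof (cases "s j \<le> s i")
      case True
      then show ?thesis using main[of "s j" "s i"] that seq_suble[OF s, of j] by simp
    next
      case False
      then show ?thesis using main[of "s i" "s j"] that seq_suble[OF s, of i] by (simp add: abs_minus_commute)
    qed
    then show ?thesis by blast
  qed
  from cauchy_L1_AE_cauchy_subseq[of unit_measure "\<lambda>n. slope (s n) g", OF int this]
  obtain r where "strict_mono r" "AE t in unit_measure. Cauchy (\<lambda>i. slope (s (r i)) g t)"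
    by blast
  then show ?thesis by (auto simp: Cauchy_convergent_iff)
qed

text \<open>Successive subsequences and their diagonal treat countably many functions at once; the
  countably many exceptional null sets are then united.\<close>

lemma slope_AE_convergent:
  fixes g :: "nat \<Rightarrow> real \<Rightarrow> real"
  assumes g: "\<And>i. \<exists>C. C-lipschitz_on {0..1} (g i)"
  obtains r where "strict_mono r" "AE t in unit_measure. \<forall>i. convergent (\<lambda>j. slope (r j) (g i) t)"
proof -
  let ?P = "\<lambda>i s. AE t in unit_measure. convergent (\<lambda>j. slope (s j) (g i) t)"
  interpret subseqs ?P
  proof
    fix n and s :: "nat \<Rightarrow> nat" assume s: "strict_mono s"
    obtain C where "C-lipschitz_on {0..1} (g n)" using g by blast
    then show "\<exists>r'. strict_mono r' \<and> ?P n (s \<circ> r')" using slope_AE_convergent_subseq[OF _ s] by blast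
  qed
  have "?P i diagseq" for i
  proof -
    \<comment> \<open>From index \<open>Suc i\<close> on, the diagonal sequence is a subsequence of
      the one chosen for function \<open>i\<close>.\<close>
    have "?P i (diagseq \<circ> ((+) (Suc i)))"
    proof (rule diagseq_holds)
      fix r s :: "nat \<Rightarrow> nat" and n assume r: "strict_mono r" and P: "?P n s"
      show "?P n (s \<circ> r)"
        using P
      proof eventually_elim
        case (elim t)
        then show ?case using convergent_subseq_convergent[OF elim r] by (simp add: o_def)
      qed
    qed
    then show ?thesis
    proof eventually_elim
      case (elim t)
      then show ?case
        using convergent_ignore_initial_segment[of "\<lambda>j. slope (diagseq j) (g i) t" "Suc i"]
        by (simp add: o_def add.commute)
    qed
  qed
  then show ?thesis using that[OF subseq_diagseq] by (simp add: AE_all_countable)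
qed

text \<open>Stands in for the derivative of \<open>g\<close>. Where the slopes diverge,
  \<open>lim\<close> has no meaningful value; in all uses this happens on a null set only.\<close>

definition dslope :: "(nat \<Rightarrow> nat) \<Rightarrow> (real \<Rightarrow> real) \<Rightarrow> real \<Rightarrow> real" where
  "dslope r g t = lim (\<lambda>j. slope (r j) g t)"

lemma dslope_measurable [measurable]: "dslope r g \<in> borel_measurable unit_measure"
  unfolding dslope_def[abs_def] by (intro borel_measurable_lim_metric slope_measurable)

lemma dslope_integral:
  assumes g: "C-lipschitz_on {0..1} g" and r: "strict_mono r"
    and conv: "AE t in unit_measure. convergent (\<lambda>j. slope (r j) g t)"
  shows "integrable unit_measure (\<lambda>t. \<psi> (cell i t) * dslope r g t)"
    and "(\<integral>t. \<psi> (cell i t) * dslope r g t \<partial>unit_measure) = (\<Sum>m<2 ^ i. \<psi> m * increment i g m)"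
proof -
  \<comment> \<open>The shift ensures \<open>i \<le> r (j + i)\<close>, and from level
    \<open>i\<close> on the integrals do not depend on the level.\<close>
  have lim: "AE t in unit_measure. (\<lambda>j. \<psi> (cell i t) * slope (r (j + i)) g t) \<longlonglongrightarrow> \<psi> (cell i t) * dslope r g t"
    using conv
  proof eventually_elim
    case (elim t)
    then have "(\<lambda>j. slope (r j) g t) \<longlonglongrightarrow> dslope r g t"
      by (simp add: dslope_def convergent_LIMSEQ_iff)
    then have "(\<lambda>j. slope (r (j + i)) g t) \<longlonglongrightarrow> dslope r g t" by (rule LIMSEQ_ignore_initial_segment)
    then show ?case by (intro tendsto_intros)
  qed
  define B where "B = (\<Sum>m<2 ^ i. \<bar>\<psi> m\<bar>)"
  have B: "\<bar>\<psi> (cell i t)\<bar> \<le> B" if "t \<in> {0..<1}" for t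
    unfolding B_def using cell_less[of t i] that by (intro member_le_sum) auto
  have C: "0 \<le> C" by (rule lipschitz_on_nonneg[OF g])
  have bound: "AE t in unit_measure. norm (\<psi> (cell i t) * slope (r (j + i)) g t) \<le> B * C" for j
  proof (rule AE_I2)
    fix t assume "t \<in> space unit_measure"
    then have t: "t \<in> {0..<1}" by (simp add: space_unit_measure)
    show "norm (\<psi> (cell i t) * slope (r (j + i)) g t) \<le> B * C"
      unfolding real_norm_def abs_mult
      by (intro mult_mono B slope_bound[OF g] t) (auto simp: C intro: order_trans[OF abs_ge_zero B[OF t]])
  qed
  have hyps: "(\<lambda>t. \<psi> (cell i t) * dslope r g t) \<in> borel_measurable unit_measure"
    "\<And>j. (\<lambda>t. \<psi> (cell i t) * slope (r (j + i)) g t) \<in> borel_measurable unit_measure"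
    "integrable unit_measure (\<lambda>_. B * C)"
    using finite_measure.integrable_const[OF finite_unit_measure] by auto
  show "integrable unit_measure (\<lambda>t. \<psi> (cell i t) * dslope r g t)"
    by (rule integrable_dominated_convergence[OF hyps(1,2,3) lim bound])
  have "(\<lambda>j. \<integral>t. \<psi> (cell i t) * slope (r (j + i)) g t \<partial>unit_measure)
      \<longlonglongrightarrow> (\<integral>t. \<psi> (cell i t) * dslope r g t \<partial>unit_measure)"
    by (rule integral_dominated_convergence[OF hyps(1,2,3) lim bound])
  moreover have "(\<integral>t. \<psi> (cell i t) * slope (r (j + i)) g t \<partial>unit_measure) = (\<Sum>m<2 ^ i. \<psi> m * increment i g m)" for j
  proof -
    have "i \<le> r (j + i)" using seq_suble[OF r, of "j + i"] by linarith
    then obtain l where "r (j + i) = i + l" using le_Suc_ex by blast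
    then show ?thesis by (simp add: integral_cell_slope)
  qed
  ultimately show "(\<integral>t. \<psi> (cell i t) * dslope r g t \<partial>unit_measure) = (\<Sum>m<2 ^ i. \<psi> m * increment i g m)"
    by (simp add: LIMSEQ_const_iff)
qed

text \<open>The fundamental theorem of calculus for Lipschitz functions: level \<open>0\<close> has
  a single cell.\<close>

lemma dslope_integral_total:
  assumes "C-lipschitz_on {0..1} g" "strict_mono r"
    and "AE t in unit_measure. convergent (\<lambda>j. slope (r j) g t)"
  shows "integrable unit_measure (dslope r g)" "(\<integral>t. dslope r g t \<partial>unit_measure) = g 1 - g 0"
  using dslope_integral[OF assms, of "\<lambda>_. 1" 0] by (simp_all add: increment_def node_def)

section \<open>Local uniform rotundity and slopes of curves\<close>

text \<open>An epsilon-delta form at a fixed \<open>u\<close> that also admits \<open>v\<close> off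
  the unit sphere. Were it false, counterexamples \<open>v n\<close> for
  \<open>d n \<rightarrow> 0\<close> would have norms tending to \<open>1\<close>, and their
  normalizations would contradict rotundity.\<close>

lemma LUR_modulus:
  fixes u :: "'a::real_normed_vector"
  assumes LUR: "locally_uniformly_rotund (norm :: 'a \<Rightarrow> real)" and u: "norm u = 1" and e: "0 < e"
  obtains d where "0 < d" "\<And>v. norm v \<le> 1 + d \<Longrightarrow> 2 - d \<le> norm (u + v) \<Longrightarrow> norm (v - u) < e"
proof -
  have "\<exists>d>0. \<forall>v. norm v \<le> 1 + d \<longrightarrow> 2 - d \<le> norm (u + v) \<longrightarrow> norm (v - u) < e"
  proof (rule ccontr)
    assume "\<not> ?thesis"
    then have H: "\<exists>v. norm v \<le> 1 + d \<and> 2 - d \<le> norm (u + v) \<and> e \<le> norm (v - u)" if "0 < d" for d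
      using that by (meson not_less)
    \<comment> \<open>\<open>Suc (Suc n)\<close> keeps \<open>d n\<close> below \<open>1\<close>, so
      that \<open>v n\<close> is nonzero and can be normalized.\<close>
    define d where "d n = inverse (real (Suc (Suc n)))" for n
    have d: "0 < d n" "d n < 1" for n by (auto simp: d_def inverse_eq_divide)
    have d0: "d \<longlonglongrightarrow> 0"
      using LIMSEQ_Suc[OF LIMSEQ_inverse_real_of_nat] by (simp add: d_def[abs_def])
    obtain v where v: "\<And>n. norm (v n) \<le> 1 + d n" "\<And>n. 2 - d n \<le> norm (u + v n)" "\<And>n. e \<le> norm (v n - u)"
      using H[OF d(1)] by metis
    have lo: "1 - d n \<le> norm (v n)" for n
      using v(2)[of n] norm_triangle_ineq[of u "v n"] u by linarith
    have nz: "v n \<noteq> 0" for n using lo[of n] d(2)[of n] by auto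
    define z where "z n = sgn (v n)" for n
    have z1: "norm (z n) = 1" for n using nz by (simp add: z_def norm_sgn)
    have zv: "norm (z n - v n) \<le> d n" for n
    proof -
      have "norm (v n) *\<^sub>R z n = v n" using nz by (simp add: z_def sgn_div_norm)
      then have "z n - v n = (1 - norm (v n)) *\<^sub>R z n" by (simp add: scaleR_left_diff_distrib)
      then have "norm (z n - v n) = \<bar>1 - norm (v n)\<bar>" using z1 by simp
      then show ?thesis using lo[of n] v(1)[of n] by (simp add: abs_le_iff)
    qed
    have "(\<lambda>n. norm ((1 / 2) *\<^sub>R (u + z n))) \<longlonglongrightarrow> 1"
    proof (rule tendsto_sandwich)
      have "1 - d n \<le> norm ((1 / 2) *\<^sub>R (u + z n))" for n
        using norm_triangle_ineq2[of "u + v n" "v n - z n"] v(2)[of n] zv[of n] by (simp add: norm_minus_commute)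
      then show "\<forall>\<^sub>F n in sequentially. 1 - d n \<le> norm ((1 / 2) *\<^sub>R (u + z n))" by simp
      have "norm ((1 / 2) *\<^sub>R (u + z n)) \<le> 1" for n
        using norm_triangle_ineq[of u "z n"] u z1[of n] by simp
      then show "\<forall>\<^sub>F n in sequentially. norm ((1 / 2) *\<^sub>R (u + z n)) \<le> 1" by simp
      show "(\<lambda>n. 1 - d n) \<longlonglongrightarrow> 1" using tendsto_diff[OF tendsto_const d0, of 1] by simp
    qed simp
    then have "(\<lambda>n. norm (z n - u)) \<longlonglongrightarrow> 0"
      using LUR u z1 unfolding locally_uniformly_rotund_def by blast
    from tendsto_add[OF this d0] have "(\<lambda>n. norm (z n - u) + d n) \<longlonglongrightarrow> 0" by simp
    then have "\<forall>\<^sub>F n in sequentially. norm (z n - u) + d n < e" using e by (rule order_tendstoD)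
    then obtain n where "norm (z n - u) + d n < e" by (auto simp: eventually_sequentially)
    moreover have "norm (v n - u) \<le> norm (z n - u) + norm (z n - v n)"
      using norm_triangle_ineq[of "z n - u" "v n - z n"] by (simp add: norm_minus_commute)
    ultimately show False using v(3)[of n] zv[of n] by linarith
  qed
  then show ?thesis using that by blast
qed

text \<open>Two curves of equal quasihyperbolic speed have unequal norm speeds \<open>a\<close> and
  \<open>b\<close>. Splitting off the excess of the larger weight leaves \<open>min a b\<close>
  times \<open>u + v\<close>, and the bound \<open>K\<close> on the ratio keeps the loss
  proportional to that minimum.\<close>

lemma LUR_weighted_modulus:
  fixes u :: "'a::real_normed_vector"
  assumes LUR: "locally_uniformly_rotund (norm :: 'a \<Rightarrow> real)" and u: "norm u = 1" and e: "0 < e" and K: "1 \<le> K"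
  obtains d where "0 < d"
    "\<And>a b v. 0 < a \<Longrightarrow> 0 < b \<Longrightarrow> a \<le> K * b \<Longrightarrow> b \<le> K * a \<Longrightarrow> norm v \<le> 1 + d \<Longrightarrow>
       (1 - d) * (a + b) \<le> norm (a *\<^sub>R u + b *\<^sub>R v) \<Longrightarrow> norm (v - u) < e"
proof -
  obtain d0 where d0: "0 < d0" "\<And>v. norm v \<le> 1 + d0 \<Longrightarrow> 2 - d0 \<le> norm (u + v) \<Longrightarrow> norm (v - u) < e"
    using LUR_modulus[OF LUR u e] by blast
  \<comment> \<open>In both cases below the loss is at most \<open>2 * d * K * min a b\<close>,
    which this choice makes \<open>d0 * min a b\<close>.\<close>
  define d where "d = d0 / (2 * K)"
  have d: "0 < d" "2 * K * d = d0" using d0(1) K by (auto simp: d_def)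
  have "1 * d \<le> (2 * K) * d" using K d(1) by (intro mult_right_mono) auto
  then have "d \<le> d0" using d(2) by simp
  show ?thesis
  proof (rule that[OF d(1)])
    fix a b v assume ab: "0 < a" "0 < b" "a \<le> K * b" "b \<le> K * a" and v: "norm v \<le> 1 + d"
      and le: "(1 - d) * (a + b) \<le> norm (a *\<^sub>R u + b *\<^sub>R v)"
    define c where "c = min a b"
    have c: "0 < c" using ab by (simp add: c_def)
    have "c * (2 - d0) \<le> c * norm (u + v)"
    proof (cases "a \<le> b")
      case True
      have "a *\<^sub>R u + b *\<^sub>R v = a *\<^sub>R (u + v) + (b - a) *\<^sub>R v" by (simp add: algebra_simps)
      then have "norm (a *\<^sub>R u + b *\<^sub>R v) \<le> a * norm (u + v) + (b - a) * norm v"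
        using norm_triangle_ineq[of "a *\<^sub>R (u + v)" "(b - a) *\<^sub>R v"] ab True by simp
      also have "\<dots> \<le> a * norm (u + v) + (b - a) * (1 + d)"
        using v True by (intro add_left_mono mult_left_mono) auto
      finally have "2 * a - 2 * (d * b) \<le> a * norm (u + v)" using le by (simp add: algebra_simps)
      moreover have "d * b \<le> d * (K * a)" using ab d by (intro mult_left_mono) auto
      moreover have "2 * (d * (K * a)) = d0 * a" using d(2) by (simp add: algebra_simps)
      ultimately have "2 * a - d0 * a \<le> a * norm (u + v)" by linarith
      then show ?thesis using True by (simp add: c_def min_def algebra_simps)
    next
      case False
      have "a *\<^sub>R u + b *\<^sub>R v = b *\<^sub>R (u + v) + (a - b) *\<^sub>R u" by (simp add: algebra_simps)
      then have "norm (a *\<^sub>R u + b *\<^sub>R v) \<le> b * norm (u + v) + (a - b)"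
        using norm_triangle_ineq[of "b *\<^sub>R (u + v)" "(a - b) *\<^sub>R u"] ab False u by simp
      then have "2 * b - d * a - d * b \<le> b * norm (u + v)" using le by (simp add: algebra_simps)
      moreover have "b \<le> K * b" using ab K by simp
      then have "d * b \<le> d * (K * b)" using d by (intro mult_left_mono) auto
      moreover have "d * a \<le> d * (K * b)" using ab d by (intro mult_left_mono) auto
      moreover have "2 * (d * (K * b)) = d0 * b" using d(2) by (simp add: algebra_simps)
      ultimately have "2 * b - d0 * b \<le> b * norm (u + v)" by linarith
      then show ?thesis using False by (simp add: c_def min_def algebra_simps)
    qed
    then have "2 - d0 \<le> norm (u + v)" using c by simp
    then show "norm (v - u) < e" using d0(2) v \<open>d \<le> d0\<close> by simp
  qed
qed

text \<open>The generalized weak limit of \<open>q\<close> has norm \<open>\<rho>\<close>, and local uniform rotundity at that point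
  upgrades the convergence.\<close>

lemma LUR_strong_limit:
  fixes q :: "nat \<Rightarrow> 'a::real_normed_vector" and F :: "('a \<Rightarrow>\<^sub>L real) set"
  assumes LUR: "locally_uniformly_rotund (norm :: 'a \<Rightarrow> real)" and refl: "reflexive_space TYPE('a)"
    and \<rho>: "0 < \<rho>" and q: "(\<lambda>n. norm (q n)) \<longlonglongrightarrow> \<rho>"
    and F: "\<And>f z. f \<in> F \<Longrightarrow> \<bar>blinfun_apply f z\<bar> \<le> norm z"
    and conv: "\<And>f. f \<in> F \<Longrightarrow> convergent (\<lambda>n. blinfun_apply f (q n))"
    and sup: "\<And>e. 0 < e \<Longrightarrow> \<exists>f\<in>F. \<rho> - e \<le> lim (\<lambda>n. blinfun_apply f (q n))"
  shows "\<exists>w. q \<longlonglongrightarrow> w"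
proof -
  obtain L where L: "generalized_limit L" using generalized_limit_exists by blast
  have b: "bounded (range q)"
    using convergent_imp_bounded[OF q] by (simp add: bounded_iff)
  define w where "w = weak_limit L q"
  have fw: "(\<lambda>n. f (q n)) \<longlonglongrightarrow> f w" if "f \<in> F" for f :: "'a \<Rightarrow>\<^sub>L real"
    using weak_limit[OF L refl b, of f] gl_lim[OF L, of "\<lambda>n. f (q n)"] conv[OF that]
    by (simp add: w_def convergent_LIMSEQ_iff)
  have big: "\<exists>f\<in>F. \<rho> - e \<le> blinfun_apply f w" if e: "0 < e" for e
  proof -
    obtain f where f: "f \<in> F" "\<rho> - e \<le> lim (\<lambda>n. blinfun_apply f (q n))" using sup[OF e] by blast
    then show ?thesis using limI[OF fw[OF f(1)]] by auto
  qed
  have "norm w \<le> \<rho>"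
    unfolding w_def
  proof (rule norm_weak_limit_le[OF L refl b])
    fix e :: real assume "0 < e"
    then have "\<forall>\<^sub>F n in sequentially. norm (q n) < \<rho> + e" by (intro order_tendstoD(2)[OF q]) simp
    then show "\<forall>\<^sub>F n in sequentially. norm (q n) \<le> \<rho> + e" by eventually_elim simp
  qed
  moreover have "\<rho> \<le> norm w"
  proof (rule field_le_epsilon)
    fix e :: real assume "0 < e"
    then obtain f where "f \<in> F" "\<rho> - e \<le> blinfun_apply f w" using big by blast
    then show "\<rho> \<le> norm w + e" using F[of f w] by linarith
  qed
  ultimately have nw: "norm w = \<rho>" by simp
  have "q \<longlonglongrightarrow> w"
  proof (rule metric_LIMSEQ_I)
    fix r :: real assume r: "0 < r"
    define u where "u = (1 / \<rho>) *\<^sub>R w"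
    have u: "norm u = 1" using \<rho> nw by (simp add: u_def)
    have "0 < r / \<rho>" using r \<rho> by simp
    then obtain d where d: "0 < d" "\<And>v. norm v \<le> 1 + d \<Longrightarrow> 2 - d \<le> norm (u + v) \<Longrightarrow> norm (v - u) < r / \<rho>"
      using LUR_modulus[OF LUR u] by blast
    \<comment> \<open>Three errors \<open>e\<close> are lost, one in \<open>f w\<close> and two in
      \<open>f (q n)\<close>; after division by \<open>\<rho>\<close> they amount to
      \<open>3 / 4 * d\<close>.\<close>
    define e where "e = \<rho> * d / 4"
    have e: "0 < e" using \<rho> d by (simp add: e_def)
    obtain f where f: "f \<in> F" "\<rho> - e \<le> blinfun_apply f w" using big[OF e] by blast
    have "\<forall>\<^sub>F n in sequentially. blinfun_apply f w - e < f (q n)" "\<forall>\<^sub>F n in sequentially. norm (q n) < \<rho> + e"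
      using e by (auto intro: order_tendstoD(1)[OF fw[OF f(1)]] order_tendstoD(2)[OF q])
    then have "\<forall>\<^sub>F n in sequentially. dist (q n) w < r"
    proof eventually_elim
      case (elim n)
      define v where "v = (1 / \<rho>) *\<^sub>R q n"
      have "norm v = norm (q n) / \<rho>" using \<rho> by (simp add: v_def)
      also have "\<dots> \<le> (\<rho> + e) / \<rho>" using elim \<rho> by (intro divide_right_mono) auto
      also have "\<dots> \<le> 1 + d" using \<rho> d by (simp add: e_def field_simps)
      finally have v1: "norm v \<le> 1 + d" .
      have "2 * \<rho> - 3 * e \<le> f (w + q n)" using f(2) elim by (simp add: blinfun.add_right)
      then have "2 * \<rho> - 3 * e \<le> norm (w + q n)" using F[OF f(1), of "w + q n"] by linarith
      then have "(2 * \<rho> - 3 * e) / \<rho> \<le> norm (w + q n) / \<rho>" using \<rho> by (intro divide_right_mono) auto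
      moreover have "u + v = (1 / \<rho>) *\<^sub>R (w + q n)" by (simp add: u_def v_def scaleR_add_right)
      then have "norm (u + v) = norm (w + q n) / \<rho>" using \<rho> by simp
      moreover have "2 - d \<le> (2 * \<rho> - 3 * e) / \<rho>" using \<rho> d by (simp add: e_def field_simps)
      ultimately have "norm (v - u) < r / \<rho>" using d(2)[OF v1] by linarith
      moreover have "v - u = (1 / \<rho>) *\<^sub>R (q n - w)" by (simp add: u_def v_def scaleR_diff_right)
      ultimately show ?case using \<rho> by (simp add: dist_norm divide_less_cancel)
    qed
    then show "\<exists>no. \<forall>n\<ge>no. dist (q n) w < r" by (simp add: eventually_sequentially)
  qed
  then show ?thesis by blast
qed

section \<open>Limits of dyadic slopes along quasihyperbolic curves\<close>

lemma node_cell_tendsto: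
  assumes "0 \<le> t"
  shows "(\<lambda>j. node j (cell j t)) \<longlonglongrightarrow> t" "(\<lambda>j. node j (Suc (cell j t))) \<longlonglongrightarrow> t"
proof -
  have h: "(\<lambda>j. 1 / 2 ^ j :: real) \<longlonglongrightarrow> 0"
    using LIMSEQ_power_zero[of "1 / 2 :: real"] by (simp add: power_one_over)
  have b: "t - 1 / 2 ^ j \<le> node j (cell j t)" "node j (cell j t) \<le> t" for j
    using cell_bounds[OF assms, of j] by (auto simp: node_Suc)
  have "(\<lambda>j. t - 1 / 2 ^ j) \<longlonglongrightarrow> t" using tendsto_diff[OF tendsto_const h, of t] by simp
  from tendsto_sandwich[OF _ _ this tendsto_const] b
  show *: "(\<lambda>j. node j (cell j t)) \<longlonglongrightarrow> t" by simp
  show "(\<lambda>j. node j (Suc (cell j t))) \<longlonglongrightarrow> t"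
    unfolding node_Suc using tendsto_add[OF * h] by simp
qed

lemma node_cell_in:
  assumes "t \<in> {0..<1}"
  shows "node j (cell j t) \<in> {0..1}" "node j (Suc (cell j t)) \<in> {0..1}"
  using cell_less[of t j] assms by (auto intro!: node_nonneg node_le_1)

lemma exp_quotient_tendsto: "(\<lambda>j. 2 ^ j * (exp (R / 2 ^ j) - 1)) \<longlonglongrightarrow> (R :: real)"
proof -
  have "((\<lambda>h. exp (R * h)) has_real_derivative R) (at 0)" by (auto intro!: derivative_eq_intros)
  then have "((\<lambda>h. (exp (R * (0 + h)) - exp (R * 0)) / h) \<longlongrightarrow> R) (at 0)" by (simp only: DERIV_def)
  moreover have "filterlim (\<lambda>j. 1 / 2 ^ j :: real) (at 0) sequentially"
    unfolding filterlim_at using LIMSEQ_power_zero[of "1 / 2 :: real"] by (simp add: power_one_over)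
  ultimately have "(\<lambda>j. (exp (R * (0 + 1 / 2 ^ j)) - exp (R * 0)) / (1 / 2 ^ j)) \<longlonglongrightarrow> R"
    by (rule filterlim_compose)
  then show ?thesis by (simp add: mult.commute)
qed

lemma norm_slope: "norm (slope j g t) = 2 ^ j * norm (increment j g (cell j t))"
  for g :: "real \<Rightarrow> 'a::real_normed_vector"
  by (simp add: slope_def)

lemma slope_blinfun: "slope j (\<lambda>s. blinfun_apply f (g s)) t = f (slope j g t)"
  by (simp add: slope_def increment_def blinfun.diff_right blinfun.scaleR_right)

context convex_domain
begin

text \<open>The constant depends only on the starting point and \<open>R\<close>, so all geodesics
  of length \<open>R\<close> from one point share it. Its factor
  \<open>bdist (\<sigma> 0) * exp R\<close> bounds the boundary distance along the curve, and
  \<open>R * exp R\<close> comes from \<open>exp x - 1 \<le> x * exp R\<close> on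
  \<open>[0, R]\<close>.\<close>

lemma qcurve_lipschitz:
  assumes \<sigma>: "qcurve R \<sigma>"
  shows "(bdist (\<sigma> 0) * exp R * (R * exp R))-lipschitz_on {0..1} \<sigma>"
proof -
  define C where "C = bdist (\<sigma> 0) * exp R * (R * exp R)"
  have R: "0 \<le> R" by (rule qcurve_nonneg[OF \<sigma>])
  have \<sigma>0: "\<sigma> 0 \<in> \<Omega>" using qcurve_in[OF \<sigma>] by simp
  have *: "norm (\<sigma> t - \<sigma> s) \<le> C * (t - s)" if st: "0 \<le> s" "s \<le> t" "t \<le> 1" for s t
  proof -
    have "bdist (\<sigma> s) \<le> bdist (\<sigma> 0) * exp (R * (s - 0))"
      using st by (intro norm_diff_le_qh(2)[OF \<sigma>0 _ qcurve_le[OF \<sigma>]] qcurve_in[OF \<sigma>]) auto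
    also have "\<dots> \<le> bdist (\<sigma> 0) * exp R"
      using st R by (intro mult_left_mono) (auto simp: infdist_nonneg mult_left_le)
    finally have 1: "bdist (\<sigma> s) \<le> bdist (\<sigma> 0) * exp R" .
    define x where "x = R * (t - s)"
    have x: "0 \<le> x" "x \<le> R" using st R by (auto simp: x_def mult_left_le)
    have "1 - x \<le> exp (- x)" using exp_ge_add_one_self[of "- x"] by simp
    then have "exp x * (1 - x) \<le> exp x * exp (- x)" by (rule mult_left_mono) simp
    then have "exp x - 1 \<le> x * exp x" by (simp add: exp_minus algebra_simps)
    also have "\<dots> \<le> x * exp R" using x by (intro mult_left_mono) auto
    finally have 2: "exp x - 1 \<le> x * exp R" .
    have "norm (\<sigma> t - \<sigma> s) \<le> bdist (\<sigma> s) * (exp x - 1)"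
      unfolding x_def by (rule qcurve_norm_le[OF \<sigma> st])
    also have "\<dots> \<le> (bdist (\<sigma> 0) * exp R) * (x * exp R)"
      using 1 2 x by (intro mult_mono) (auto simp: infdist_nonneg)
    finally show ?thesis by (simp add: x_def C_def mult_ac)
  qed
  show ?thesis
    unfolding C_def[symmetric]
  proof (rule lipschitz_onI)
    fix s t :: real assume "s \<in> {0..1}" "t \<in> {0..1}"
    then show "dist (\<sigma> s) (\<sigma> t) \<le> C * dist s t"
      using *[of s t] *[of t s] by (cases "s \<le> t") (auto simp: dist_norm dist_real_def norm_minus_commute)
  next
    show "0 \<le> C" using R by (simp add: C_def infdist_nonneg)
  qed
qed

lemma qcurve_continuous: "qcurve R \<sigma> \<Longrightarrow> continuous_on {0..1} \<sigma>"
  using lipschitz_on_continuous_on qcurve_lipschitz by blast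

lemma qcurve_bdist:
  assumes \<sigma>: "qcurve R \<sigma>" and t: "t \<in> {0..1}"
  shows "bdist (\<sigma> t) \<le> bdist (\<sigma> 0) * exp R" "bdist (\<sigma> 0) * exp (- R) \<le> bdist (\<sigma> t)"
proof -
  have "qh (\<sigma> 0) (\<sigma> t) \<le> R * (t - 0)" using qcurve_le[OF \<sigma>, of 0 t] t by simp
  also have "\<dots> \<le> R" using t qcurve_nonneg[OF \<sigma>] by (simp add: mult_left_le)
  finally have *: "qh (\<sigma> 0) (\<sigma> t) \<le> R" .
  have "\<sigma> 0 \<in> \<Omega>" "\<sigma> t \<in> \<Omega>" using qcurve_in[OF \<sigma>] t by auto
  then show "bdist (\<sigma> t) \<le> bdist (\<sigma> 0) * exp R" "bdist (\<sigma> 0) * exp (- R) \<le> bdist (\<sigma> t)"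
    using * norm_diff_le_qh(2) bdist_ge_qh by blast+
qed

lemma along_nodes:
  fixes g :: "real \<Rightarrow> 'b::topological_space"
  assumes "continuous_on {0..1} g" and t: "t \<in> {0..<1}"
  shows "(\<lambda>j. g (node j (cell j t))) \<longlonglongrightarrow> g t"
  using t node_cell_tendsto(1)[of t] node_cell_in(1)[OF t]
  by (intro continuous_on_tendsto_compose[OF assms(1)]) auto

lemma bdist_along_nodes:
  assumes "qcurve R \<sigma>" "t \<in> {0..<1}"
  shows "(\<lambda>j. bdist (\<sigma> (node j (cell j t)))) \<longlonglongrightarrow> bdist (\<sigma> t)"
  by (intro tendsto_intros along_nodes[OF qcurve_continuous[OF assms(1)] assms(2)])

lemma qcurve_slope_le:
  assumes \<sigma>: "qcurve R \<sigma>" and t: "t \<in> {0..<1}"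
  shows "norm (slope j \<sigma> t) \<le> bdist (\<sigma> (node j (cell j t))) * (2 ^ j * (exp (R / 2 ^ j) - 1))"
proof -
  have "norm (increment j \<sigma> (cell j t)) \<le> bdist (\<sigma> (node j (cell j t))) * (exp (R * (node j (Suc (cell j t)) - node j (cell j t))) - 1)"
    unfolding increment_def using node_cell_in[OF t, of j] by (intro qcurve_norm_le[OF \<sigma>]) (auto simp: node_Suc)
  then have "norm (increment j \<sigma> (cell j t)) \<le> bdist (\<sigma> (node j (cell j t))) * (exp (R / 2 ^ j) - 1)"
    by (simp add: node_Suc)
  then have "2 ^ j * norm (increment j \<sigma> (cell j t)) \<le> 2 ^ j * (bdist (\<sigma> (node j (cell j t))) * (exp (R / 2 ^ j) - 1))"
    by (rule mult_left_mono) simp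
  then show ?thesis by (simp add: norm_slope mult_ac)
qed

lemma qcurve_slope_upper_tendsto:
  assumes "qcurve R \<sigma>" "t \<in> {0..<1}"
  shows "(\<lambda>j. bdist (\<sigma> (node j (cell j t))) * (2 ^ j * (exp (R / 2 ^ j) - 1))) \<longlonglongrightarrow> bdist (\<sigma> t) * R"
  by (intro tendsto_intros bdist_along_nodes[OF assms] exp_quotient_tendsto)

text \<open>Solving \<open>qh a b \<le> N / (D - N)\<close> for \<open>N\<close> costs a term
  \<open>qh a b * N\<close>, which becomes the subtracted error and vanishes as \<open>j\<close>
  grows. The bound \<open>l\<close> is left free: it is \<open>R\<close> on a geodesic, and on an
  average of two curves the slope of the distance from the start.\<close>

lemma qcurve_slope_ge:
  assumes \<eta>: "qcurve R \<eta>" and t: "t \<in> {0..<1}"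
    and l: "l \<le> 2 ^ j * qh (\<eta> (node j (cell j t))) (\<eta> (node j (Suc (cell j t))))"
  shows "l * bdist (\<eta> (node j (cell j t))) - R * (bdist (\<eta> (node j (cell j t))) * (exp (R / 2 ^ j) - 1))
      \<le> norm (slope j \<eta> t)"
proof -
  define a b where "a = \<eta> (node j (cell j t))" and "b = \<eta> (node j (Suc (cell j t)))"
  define N where "N = norm (b - a)"
  define D where "D = bdist a"
  have R: "0 \<le> R" by (rule qcurve_nonneg[OF \<eta>])
  have a: "a \<in> \<Omega>" and b: "b \<in> \<Omega>"
    using node_cell_in[OF t, of j] by (auto simp: a_def b_def intro!: qcurve_in[OF \<eta>])
  have D: "0 < D" using bdist_pos[OF a] by (simp add: D_def)
  have slope: "norm (slope j \<eta> t) = 2 ^ j * N"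
    by (simp add: norm_slope increment_def N_def a_def b_def)
  have q: "0 \<le> qh a b" "2 ^ j * qh a b \<le> R"
  proof -
    show "0 \<le> qh a b" by (rule qh_nonneg[OF a b])
    have "qh a b \<le> R * (node j (Suc (cell j t)) - node j (cell j t))"
      unfolding a_def b_def using node_cell_in[OF t, of j] by (intro qcurve_le[OF \<eta>]) (auto simp: node_Suc)
    then show "2 ^ j * qh a b \<le> R" by (simp add: node_Suc field_simps)
  qed
  have lR: "l \<le> R" using l q(2) by (simp add: a_def b_def)
  have "2 ^ j * N \<le> 2 ^ j * (D * (exp (R / 2 ^ j) - 1))"
    using qcurve_slope_le[OF \<eta> t, of j] by (simp add: slope D_def a_def mult_ac)
  then have "N \<le> D * (exp (R / 2 ^ j) - 1)" by simp
  then have RN: "R * N \<le> R * (D * (exp (R / 2 ^ j) - 1))" using R by (rule mult_left_mono)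
  have "l * D - R * N \<le> 2 ^ j * N"
  proof (cases "N < D")
    case True
    have "qh a b \<le> N / (D - N)"
      using qh_le_near(2)[OF a, of b] True by (simp add: N_def D_def)
    then have "qh a b * (D - N) \<le> N" using True by (simp add: pos_le_divide_eq)
    then have "2 ^ j * qh a b * (D - N) \<le> 2 ^ j * N" by (simp add: mult.assoc)
    moreover have "l * (D - N) \<le> 2 ^ j * qh a b * (D - N)"
      using l True by (intro mult_right_mono) (auto simp: a_def b_def)
    moreover have "l * N \<le> R * N" using lR by (intro mult_right_mono) (auto simp: N_def)
    ultimately show ?thesis by (simp add: right_diff_distrib)
  next
    case False
    have "l * D \<le> R * D" using lR D by (intro mult_right_mono) auto
    also have "\<dots> \<le> R * N" using False R by (intro mult_left_mono) auto
    finally have "l * D - R * N \<le> 0" by simp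
    also have "0 \<le> 2 ^ j * N" by (simp add: N_def)
    finally show ?thesis .
  qed
  then show ?thesis using RN slope by (simp add: D_def a_def)
qed

lemma slope_error_tendsto:
  assumes "qcurve R \<eta>" "t \<in> {0..<1}"
  shows "(\<lambda>j. R * (bdist (\<eta> (node j (cell j t))) * (exp (R / 2 ^ j) - 1))) \<longlonglongrightarrow> 0"
proof -
  have "(\<lambda>j. R * (1 / 2 ^ j)) \<longlonglongrightarrow> R * 0"
    using LIMSEQ_power_zero[of "1 / 2 :: real"] by (intro tendsto_intros) (simp add: power_one_over)
  then have "(\<lambda>j. exp (R / 2 ^ j) - 1) \<longlonglongrightarrow> exp 0 - 1" by (intro tendsto_intros) simp
  then have "(\<lambda>j. R * (bdist (\<eta> (node j (cell j t))) * (exp (R / 2 ^ j) - 1))) \<longlonglongrightarrow> R * (bdist (\<eta> t) * (exp 0 - 1))"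
    by (intro tendsto_mult tendsto_const bdist_along_nodes[OF assms])
  then show ?thesis by simp
qed

text \<open>The upper bounds for the three pieces of \<open>[0, 1]\<close> add up to the whole
  distance, so none of them can be strict.\<close>

lemma geodesic_qh:
  assumes \<gamma>: "qcurve R \<gamma>" and R: "R = qh (\<gamma> 0) (\<gamma> 1)" and st: "0 \<le> s" "s \<le> t" "t \<le> 1"
  shows "qh (\<gamma> s) (\<gamma> t) = R * (t - s)"
proof (rule antisym)
  show "qh (\<gamma> s) (\<gamma> t) \<le> R * (t - s)" by (rule qcurve_le[OF \<gamma> st])
  have in\<Omega>: "\<gamma> 0 \<in> \<Omega>" "\<gamma> s \<in> \<Omega>" "\<gamma> t \<in> \<Omega>" "\<gamma> 1 \<in> \<Omega>" using st by (auto intro!: qcurve_in[OF \<gamma>])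
  have "R \<le> qh (\<gamma> 0) (\<gamma> s) + (qh (\<gamma> s) (\<gamma> t) + qh (\<gamma> t) (\<gamma> 1))"
    unfolding R using qh_triangle[OF in\<Omega>(1,2,4)] qh_triangle[OF in\<Omega>(2,3,4)] by linarith
  moreover have "qh (\<gamma> 0) (\<gamma> s) \<le> R * (s - 0)" "qh (\<gamma> t) (\<gamma> 1) \<le> R * (1 - t)"
    using st qcurve_le[OF \<gamma>, of 0 s] qcurve_le[OF \<gamma>, of t 1] by auto
  ultimately show "R * (t - s) \<le> qh (\<gamma> s) (\<gamma> t)" by (simp add: algebra_simps)
qed

lemma geodesic_norm_slope_tendsto:
  assumes \<gamma>: "qcurve R \<gamma>" and R: "R = qh (\<gamma> 0) (\<gamma> 1)" and t: "t \<in> {0..<1}"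
  shows "(\<lambda>j. norm (slope j \<gamma> t)) \<longlonglongrightarrow> bdist (\<gamma> t) * R"
proof -
  let ?D = "\<lambda>j. bdist (\<gamma> (node j (cell j t)))"
  let ?E = "\<lambda>j. R * (?D j * (exp (R / 2 ^ j) - 1))"
  have "R \<le> 2 ^ j * qh (\<gamma> (node j (cell j t))) (\<gamma> (node j (Suc (cell j t))))" for j
    using node_cell_in[OF t, of j] by (subst geodesic_qh[OF \<gamma> R]) (auto simp: node_Suc)
  then have lo: "R * ?D j - ?E j \<le> norm (slope j \<gamma> t)" for j
    by (rule qcurve_slope_ge[OF \<gamma> t])
  have "(\<lambda>j. R * ?D j - ?E j) \<longlonglongrightarrow> R * bdist (\<gamma> t) - 0"
    by (intro tendsto_diff tendsto_mult tendsto_const bdist_along_nodes[OF \<gamma> t] slope_error_tendsto[OF \<gamma> t])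
  then have "(\<lambda>j. R * ?D j - ?E j) \<longlonglongrightarrow> bdist (\<gamma> t) * R" by (simp add: mult.commute)
  from tendsto_sandwich[OF _ _ this qcurve_slope_upper_tendsto[OF \<gamma> t]]
  show ?thesis by (simp add: lo qcurve_slope_le[OF \<gamma> t])
qed

end

context convex_domain
begin

text \<open>The integrals of the derivatives of \<open>f j m \<circ> \<gamma>\<close> add up to the length of the \<open>j\<close>-th inscribed polygon,
  which tends to the length of \<open>\<gamma>\<close>; so these functionals almost attain the norm of the derivative.\<close>

lemma geodesic_slope_AE_convergent:
  fixes f :: "nat \<Rightarrow> nat \<Rightarrow> 'a \<Rightarrow>\<^sub>L real"
  assumes LUR: "locally_uniformly_rotund (norm :: 'a \<Rightarrow> real)" and refl: "reflexive_space TYPE('a)"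
    and \<gamma>: "qcurve R \<gamma>" and R: "R = qh (\<gamma> 0) (\<gamma> 1)" "0 < R" and r: "strict_mono r"
    and f: "\<And>j m z. \<bar>f j m z\<bar> \<le> norm z"
    and norming: "\<And>j m. f j m (increment j \<gamma> m) = norm (increment j \<gamma> m)"
    and conv: "AE t in unit_measure. \<forall>j m. convergent (\<lambda>i. slope (r i) (\<lambda>s. f j m (\<gamma> s)) t)"
  shows "AE t in unit_measure. \<exists>w. (\<lambda>i. slope (r i) \<gamma> t) \<longlonglongrightarrow> w"
proof -
  define C where "C = bdist (\<gamma> 0) * exp R * (R * exp R)"
  have \<gamma>L: "C-lipschitz_on {0..1} \<gamma>" unfolding C_def by (rule qcurve_lipschitz[OF \<gamma>])
  define g where "g j m = (\<lambda>s. f j m (\<gamma> s))" for j m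
  have gL: "C-lipschitz_on {0..1} (g j m)" for j m
  proof (rule lipschitz_onI)
    fix s t :: real assume "s \<in> {0..1}" "t \<in> {0..1}"
    then have "dist (\<gamma> s) (\<gamma> t) \<le> C * dist s t" by (rule lipschitz_onD[OF \<gamma>L])
    then show "dist (g j m s) (g j m t) \<le> C * dist s t"
      using f[of j m "\<gamma> s - \<gamma> t"] by (simp add: g_def dist_norm blinfun.diff_right)
  qed (rule lipschitz_on_nonneg[OF \<gamma>L])
  have gconv: "AE t in unit_measure. convergent (\<lambda>i. slope (r i) (g j m) t)" for j m
    using conv unfolding g_def by eventually_elim blast
  define \<rho> where "\<rho> t = bdist (\<gamma> t) * R" for t
  have slope_lim: "(\<lambda>j. norm (slope j \<gamma> t)) \<longlonglongrightarrow> \<rho> t" if "t \<in> {0..<1}" for t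
    unfolding \<rho>_def by (rule geodesic_norm_slope_tendsto[OF \<gamma> R(1) that])
  have slope_lim_r: "(\<lambda>i. norm (slope (r i) \<gamma> t)) \<longlonglongrightarrow> \<rho> t" if "t \<in> {0..<1}" for t
    by (rule filterlim_compose[OF slope_lim[OF that] filterlim_subseq[OF r]])
  have ns: "norm (slope j \<gamma> t) = (\<lambda>n. 2 ^ j * norm (increment j \<gamma> n)) (cell j t)" for j t
    by (simp add: norm_slope)
  have ns_meas: "(\<lambda>t. norm (slope j \<gamma> t)) \<in> borel_measurable unit_measure" for j
    unfolding ns by (rule cell_fun_measurable)
  have ns_int: "(\<integral>t. norm (slope j \<gamma> t) \<partial>unit_measure) = (\<Sum>m<2 ^ j. norm (increment j \<gamma> m))" for j
    using cell_fun_integral(2)[of "\<lambda>n. 2 ^ j * norm (increment j \<gamma> n)" j]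
    by (simp add: norm_slope sum_distrib_left[symmetric])
  have \<rho>_meas: "\<rho> \<in> borel_measurable unit_measure"
    by (rule borel_measurable_LIMSEQ_metric[where f = "\<lambda>j t. norm (slope j \<gamma> t)", OF ns_meas]) (simp add: slope_lim space_unit_measure)
  have \<rho>_bound: "\<bar>\<rho> t\<bar> \<le> C" if "t \<in> {0..<1}" for t
  proof -
    have "\<rho> t \<le> C"
      by (rule tendsto_upperbound[OF slope_lim[OF that]]) (simp_all add: norm_slope_bound[OF \<gamma>L that])
    then show ?thesis using R(2) by (simp add: \<rho>_def infdist_nonneg)
  qed
  have \<rho>_int: "integrable unit_measure \<rho>" by (rule integrable_unit_bounded[OF \<rho>_meas \<rho>_bound])
  have "(\<lambda>j. \<integral>t. norm (slope j \<gamma> t) \<partial>unit_measure) \<longlonglongrightarrow> (\<integral>t. \<rho> t \<partial>unit_measure)"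
  proof (rule integral_dominated_convergence[where w = "\<lambda>_. C"])
    show "integrable unit_measure (\<lambda>_. C)" by (rule finite_measure.integrable_const[OF finite_unit_measure])
    show "AE t in unit_measure. (\<lambda>j. norm (slope j \<gamma> t)) \<longlonglongrightarrow> \<rho> t"
      by (rule AE_I2) (simp add: slope_lim space_unit_measure)
    show "AE t in unit_measure. norm (norm (slope j \<gamma> t)) \<le> C" for j
      by (rule AE_I2) (simp add: norm_slope_bound[OF \<gamma>L] space_unit_measure)
  qed (rule \<rho>_meas ns_meas)+
  then have sum_lim: "(\<lambda>j. \<Sum>m<2 ^ j. norm (increment j \<gamma> m)) \<longlonglongrightarrow> (\<integral>t. \<rho> t \<partial>unit_measure)"
    by (simp add: ns_int)
  \<comment> \<open>\<open>\<kappa>\<close> selects the functional that belongs to the cell of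
    \<open>t\<close>; writing \<open>H\<close> as a sum over all cells brings it into the form that
    \<open>dslope_integral\<close> evaluates.\<close>
  define \<kappa> where "\<kappa> m n = (if n = m then 1 else 0 :: real)" for m n :: nat
  define H where "H j t = (\<Sum>m<2 ^ j. \<kappa> m (cell j t) * dslope r (g j m) t)" for j t
  have H_int: "integrable unit_measure (H j)" for j
    unfolding H_def[abs_def] by (intro Bochner_Integration.integrable_sum dslope_integral(1)[OF gL r gconv])
  have H_val: "(\<integral>t. H j t \<partial>unit_measure) = (\<Sum>m<2 ^ j. norm (increment j \<gamma> m))" for j
  proof -
    have "(\<integral>t. H j t \<partial>unit_measure) = (\<Sum>m<2 ^ j. \<integral>t. \<kappa> m (cell j t) * dslope r (g j m) t \<partial>unit_measure)"
      unfolding H_def by (intro Bochner_Integration.integral_sum dslope_integral(1)[OF gL r gconv])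
    also have "\<dots> = (\<Sum>m<2 ^ j. \<Sum>n<2 ^ j. \<kappa> m n * increment j (g j m) n)"
      by (simp only: dslope_integral(2)[OF gL r gconv])
    also have "\<dots> = (\<Sum>m<2 ^ j. increment j (g j m) m)"
      by (rule sum.cong[OF HOL.refl]) (simp add: \<kappa>_def if_distrib[of "\<lambda>x. x * _"] cong: if_cong)
    also have "\<dots> = (\<Sum>m<2 ^ j. norm (increment j \<gamma> m))"
      using norming by (intro sum.cong HOL.refl) (simp add: increment_def g_def blinfun.diff_right)
    finally show ?thesis .
  qed
  have H_eq: "H j t = dslope r (g j (cell j t)) t" if "t \<in> {0..<1}" for j t
  proof -
    have "H j t = (\<Sum>m<2 ^ j. if m = cell j t then dslope r (g j m) t else 0)"
      unfolding H_def by (rule sum.cong) (auto simp: \<kappa>_def)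
    then show ?thesis using cell_less[of t j] that by simp
  qed
  have in_unit: "AE t in unit_measure. t \<in> {0..<1}"
    by (rule AE_I2) (simp add: space_unit_measure)
  have dslope_lim: "AE t in unit_measure. \<forall>j m. (\<lambda>i. f j m (slope (r i) \<gamma> t)) \<longlonglongrightarrow> dslope r (g j m) t"
    using conv
  proof eventually_elim
    case (elim t)
    show ?case
    proof (intro allI)
      fix j m
      have "(\<lambda>i. slope (r i) (g j m) t) \<longlonglongrightarrow> dslope r (g j m) t"
        using elim by (simp add: dslope_def g_def convergent_LIMSEQ_iff)
      then show "(\<lambda>i. f j m (slope (r i) \<gamma> t)) \<longlonglongrightarrow> dslope r (g j m) t" by (simp add: g_def slope_blinfun)
    qed
  qed
  have H_le: "AE t in unit_measure. H j t \<le> \<rho> t" for j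
    using dslope_lim in_unit
  proof eventually_elim
    case (elim t)
    have "(\<lambda>i. f j (cell j t) (slope (r i) \<gamma> t)) \<longlonglongrightarrow> dslope r (g j (cell j t)) t" using elim(1) by blast
    from LIMSEQ_le[OF this slope_lim_r[OF elim(2)]] show ?case
      using f by (auto simp: H_eq[OF elim(2)] abs_le_iff)
  qed
  \<comment> \<open>As \<open>H j \<le> \<rho>\<close> almost everywhere, the \<open>L1\<close>
    distance is a mere difference of integrals and tends to \<open>0\<close>; a subsequence then
    converges almost everywhere.\<close>
  have "(\<integral>t. norm (\<rho> t - H j t) \<partial>unit_measure) = (\<integral>t. \<rho> t \<partial>unit_measure) - (\<Sum>m<2 ^ j. norm (increment j \<gamma> m))" for j
  proof -
    have "(\<integral>t. norm (\<rho> t - H j t) \<partial>unit_measure) = (\<integral>t. \<rho> t - H j t \<partial>unit_measure)"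
    proof (rule integral_cong_AE)
      show "AE t in unit_measure. norm (\<rho> t - H j t) = \<rho> t - H j t"
        using H_le[of j] by eventually_elim simp
    qed (use \<rho>_int H_int[of j] in auto)
    then show ?thesis using \<rho>_int H_int[of j] by (simp add: H_val)
  qed
  moreover have "(\<lambda>j. (\<integral>t. \<rho> t \<partial>unit_measure) - (\<Sum>m<2 ^ j. norm (increment j \<gamma> m))) \<longlonglongrightarrow> 0"
    using tendsto_diff[OF tendsto_const sum_lim, of "\<integral>t. \<rho> t \<partial>unit_measure"] by simp
  ultimately have "(\<lambda>j. \<integral>t. norm (\<rho> t - H j t) \<partial>unit_measure) \<longlonglongrightarrow> 0" by simp
  from tendsto_L1_AE_subseq[OF _ this] \<rho>_int H_int
  obtain s where "AE t in unit_measure. (\<lambda>n. \<rho> t - H (s n) t) \<longlonglongrightarrow> 0" by auto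
  then show ?thesis
    using dslope_lim in_unit
  proof eventually_elim
    case (elim t)
    show ?case
    \<comment> \<open>The functionals of all levels converge at \<open>t\<close>, and those of the
      cells containing \<open>t\<close>, at the levels \<open>s n\<close>, come arbitrarily close to
      \<open>\<rho> t\<close>.\<close>
    proof (rule LUR_strong_limit[OF LUR refl, where F = "range (\<lambda>(j, m). f j m)"])
      show "0 < \<rho> t" using bdist_pos[OF qcurve_in[OF \<gamma>, of t]] elim(3) R(2) by (simp add: \<rho>_def)
      show "(\<lambda>i. norm (slope (r i) \<gamma> t)) \<longlonglongrightarrow> \<rho> t" by (rule slope_lim_r[OF elim(3)])
      show "\<bar>blinfun_apply h z\<bar> \<le> norm z" if "h \<in> range (\<lambda>(j, m). f j m)" for h z using f that by auto
      show "convergent (\<lambda>i. blinfun_apply h (slope (r i) \<gamma> t))" if "h \<in> range (\<lambda>(j, m). f j m)" for h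
        using elim(2) that by (auto simp: convergent_def)
      fix e :: real assume "0 < e"
      then have "\<forall>\<^sub>F n in sequentially. \<rho> t - H (s n) t < e" by (rule order_tendstoD(2)[OF elim(1)])
      then obtain n where n: "\<rho> t - H (s n) t < e" by (auto simp: eventually_sequentially)
      define h where "h = f (s n) (cell (s n) t)"
      have "lim (\<lambda>i. blinfun_apply h (slope (r i) \<gamma> t)) = H (s n) t"
        using elim(2) by (simp add: H_eq[OF elim(3)] h_def limI)
      then have "\<rho> t - e \<le> lim (\<lambda>i. blinfun_apply h (slope (r i) \<gamma> t))" using n by simp
      moreover have "h \<in> range (\<lambda>(j, m). f j m)" by (force simp: h_def)
      ultimately show "\<exists>h\<in>range (\<lambda>(j, m). f j m). \<rho> t - e \<le> lim (\<lambda>i. blinfun_apply h (slope (r i) \<gamma> t))" by blast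
    qed
  qed
qed

text \<open>The weight \<open>exp (- R * s)\<close> builds Gronwall's inequality into the function whose slope \<open>\<Gamma>\<close> is bounded.\<close>

lemma slope_comparison:
  assumes LUR: "locally_uniformly_rotund (norm :: 'a \<Rightarrow> real)"
    and \<gamma>: "qcurve R \<gamma>" and R: "0 < R" and r: "strict_mono r" and t: "t \<in> {0..<1}"
    and w: "(\<lambda>i. slope (r i) \<gamma> t) \<longlonglongrightarrow> w" and nw: "norm w = bdist (\<gamma> t) * R" and e: "0 < e"
  shows "\<exists>d>0. \<forall>\<sigma> \<Phi> \<Gamma>. qcurve R \<sigma> \<longrightarrow> \<sigma> 0 = \<gamma> 0 \<longrightarrow>
      (\<lambda>i. slope (r i) (\<lambda>s. qh (\<gamma> 0) ((1 / 2) *\<^sub>R \<gamma> s + (1 / 2) *\<^sub>R \<sigma> s)) t) \<longlonglongrightarrow> \<Phi> \<longrightarrow>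
      (\<lambda>i. slope (r i) (\<lambda>s. exp (- R * s) * norm (\<sigma> s - \<gamma> s)) t) \<longlonglongrightarrow> \<Gamma> \<longrightarrow>
      R * (1 - d) \<le> \<Phi> \<longrightarrow> \<Gamma> \<le> e"
proof -
  define \<rho> where "\<rho> = bdist (\<gamma> t) * R"
  have t': "0 \<le> t" "t \<le> 1" "t \<in> {0..1}" using t by auto
  have \<rho>: "0 < \<rho>" using bdist_pos[OF qcurve_in[OF \<gamma> t'(1,2)]] R by (simp add: \<rho>_def)
  define C where "C = bdist (\<gamma> 0) * exp R * R"
  have C: "0 \<le> C" using R by (simp add: C_def infdist_nonneg)
  \<comment> \<open>\<open>e1\<close> is spent twice: on the direction, scaled by a speed of at most
    \<open>C\<close>, and on the slope of \<open>\<gamma>\<close>; together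
    \<open>(C + 1) * e1 = e\<close>.\<close>
  define e1 where "e1 = e / (C + 1)"
  have e1: "0 < e1" using e C by (simp add: e1_def)
  define u where "u = (1 / \<rho>) *\<^sub>R w"
  have u: "norm u = 1" using \<rho> by (simp add: u_def nw[folded \<rho>_def])
  have w_u: "w = \<rho> *\<^sub>R u" using \<rho> by (simp add: u_def)
  \<comment> \<open>Along either curve the boundary distance stays within a factor
    \<open>exp R\<close> of its common initial value, so the two norm speeds differ by at most a
    factor \<open>exp (2 * R)\<close>.\<close>
  define K where "K = exp (2 * R)"
  have K: "1 \<le> K" using R by (simp add: K_def)
  obtain d1 where d1: "0 < d1"
    "\<And>a b v. 0 < a \<Longrightarrow> 0 < b \<Longrightarrow> a \<le> K * b \<Longrightarrow> b \<le> K * a \<Longrightarrow> norm v \<le> 1 + d1 \<Longrightarrow>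
       (1 - d1) * (a + b) \<le> norm (a *\<^sub>R u + b *\<^sub>R v) \<Longrightarrow> norm (v - u) < e1"
    using LUR_weighted_modulus[OF LUR u e1 K] by blast
  \<comment> \<open>Strictly below \<open>d1\<close>, so that a strict inequality between limits
    passes to late members of the sequence; below \<open>1\<close>, so that
    \<open>R * (1 - d)\<close> is a nonnegative factor.\<close>
  define d where "d = min (d1 / 2) (1 / 2)"
  have d: "0 < d" "d < d1" "d < 1" using d1(1) by (auto simp: d_def min_def)
  have sub: "(\<lambda>i. X (r i)) \<longlonglongrightarrow> l" if "X \<longlonglongrightarrow> l" for X and l :: real
    by (rule filterlim_compose[OF that filterlim_subseq[OF r]])
  have "\<Gamma> \<le> e"
    if \<sigma>: "qcurve R \<sigma>" and \<sigma>0: "\<sigma> 0 = \<gamma> 0"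
      and \<Phi>: "(\<lambda>i. slope (r i) (\<lambda>s. qh (\<gamma> 0) ((1 / 2) *\<^sub>R \<gamma> s + (1 / 2) *\<^sub>R \<sigma> s)) t) \<longlonglongrightarrow> \<Phi>"
      and \<Gamma>: "(\<lambda>i. slope (r i) (\<lambda>s. exp (- R * s) * norm (\<sigma> s - \<gamma> s)) t) \<longlonglongrightarrow> \<Gamma>"
      and \<Phi>ge: "R * (1 - d) \<le> \<Phi>" for \<sigma> \<Phi> \<Gamma>
  proof -
    define \<rho>' where "\<rho>' = bdist (\<sigma> t) * R"
    have \<rho>': "0 < \<rho>'" using bdist_pos[OF qcurve_in[OF \<sigma> t'(1,2)]] R by (simp add: \<rho>'_def)
    have \<rho>'C: "\<rho>' \<le> C"
      using qcurve_bdist(1)[OF \<sigma> t'(3)] R by (simp add: \<rho>'_def C_def \<sigma>0 mult_right_mono)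
    define \<eta> where "\<eta> = (\<lambda>s. (1 / 2) *\<^sub>R \<gamma> s + (1 / 2) *\<^sub>R \<sigma> s)"
    have \<eta>: "qcurve R \<eta>" unfolding \<eta>_def by (rule qcurve_convex_combination[OF \<gamma> \<sigma>]) simp_all
    define p where "p j = slope j \<sigma> t" for j
    define q where "q j = slope j \<gamma> t" for j
    define a where "a j = node j (cell j t)" for j
    define b where "b j = node j (Suc (cell j t))" for j
    have ab: "a j \<in> {0..1}" "b j \<in> {0..1}" for j using node_cell_in[OF t, of j] by (auto simp: a_def b_def)
    define \<phi> where "\<phi> = (\<lambda>s. qh (\<gamma> 0) (\<eta> s))"
    define D where "D s = norm (\<sigma> s - \<gamma> s)" for s
    define G where "G = (\<lambda>s. exp (- R * s) * D s)"
    define E where "E j = R * (bdist (\<eta> (a j)) * (exp (R / 2 ^ j) - 1))" for j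
    have \<eta>_slope: "slope j \<eta> t = (1 / 2) *\<^sub>R (q j + p j)" for j
      by (simp add: slope_def increment_def \<eta>_def p_def q_def algebra_simps)
    have ratio: "\<rho> \<le> K * \<rho>'" "\<rho>' \<le> K * \<rho>"
    proof -
      have K2: "exp R = K * exp (- R)" by (simp add: K_def exp_add[symmetric])
      have *: "bdist x \<le> K * bdist y"
        if "bdist x \<le> bdist (\<gamma> 0) * exp R" "bdist (\<gamma> 0) * exp (- R) \<le> bdist y" for x y
      proof -
        have "bdist x \<le> K * (bdist (\<gamma> 0) * exp (- R))" using that(1) by (simp add: K2 mult_ac)
        also have "\<dots> \<le> K * bdist y" using that(2) K by (intro mult_left_mono) auto
        finally show ?thesis .
      qed
      show "\<rho> \<le> K * \<rho>'" "\<rho>' \<le> K * \<rho>"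
        using *[of "\<gamma> t" "\<sigma> t"] *[of "\<sigma> t" "\<gamma> t"] qcurve_bdist[OF \<gamma> t'(3)] qcurve_bdist[OF \<sigma> t'(3)] R
        by (auto simp: \<rho>_def \<rho>'_def \<sigma>0 mult.assoc[symmetric] intro!: mult_right_mono)
    qed
    have p_up: "\<forall>\<^sub>F i in sequentially. norm (p (r i)) \<le> (1 + d1) * \<rho>'"
    proof -
      have "\<rho>' < (1 + d1) * \<rho>'" using \<rho>' d1(1) by simp
      then have "\<forall>\<^sub>F i in sequentially. bdist (\<sigma> (a (r i))) * (2 ^ r i * (exp (R / 2 ^ r i) - 1)) < (1 + d1) * \<rho>'"
        unfolding a_def using sub[OF qcurve_slope_upper_tendsto[OF \<sigma> t]]
        by (intro order_tendstoD(2)[where y = \<rho>']) (auto simp: \<rho>'_def)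
      then show ?thesis
      proof eventually_elim
        case (elim i)
        then show ?case using qcurve_slope_le[OF \<sigma> t, of "r i"] by (simp add: p_def a_def)
      qed
    qed
    \<comment> \<open>By the triangle inequality the distance from the start grows no faster than
      the quasihyperbolic speed of \<open>\<eta>\<close>, and that speed bounds the norm of the
      slope of \<open>\<eta>\<close> from below.\<close>
    have low: "2 * (slope j \<phi> t * bdist (\<eta> (a j)) - E j) \<le> norm (q j + p j)" for j
    proof -
      have in\<Omega>: "\<gamma> 0 \<in> \<Omega>" "\<eta> (a j) \<in> \<Omega>" "\<eta> (b j) \<in> \<Omega>"
        using ab by (auto intro!: qcurve_in[OF \<gamma>] qcurve_in[OF \<eta>])
      have "\<phi> (b j) - \<phi> (a j) \<le> qh (\<eta> (a j)) (\<eta> (b j))"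
        using qh_triangle[OF in\<Omega>] by (simp add: \<phi>_def)
      then have "slope j \<phi> t \<le> 2 ^ j * qh (\<eta> (node j (cell j t))) (\<eta> (node j (Suc (cell j t))))"
        by (simp add: slope_def increment_def a_def b_def)
      from qcurve_slope_ge[OF \<eta> t this] show ?thesis
        by (simp add: \<eta>_slope E_def a_def)
    qed
    have big: "\<forall>\<^sub>F i in sequentially. (1 - d1) * (\<rho> + \<rho>') \<le> norm (w + p (r i))"
    proof -
      have \<Phi>': "(\<lambda>i. slope (r i) \<phi> t) \<longlonglongrightarrow> \<Phi>" using \<Phi> by (simp add: \<phi>_def \<eta>_def)
      have B: "(\<lambda>i. bdist (\<eta> (a (r i)))) \<longlonglongrightarrow> bdist (\<eta> t)"
        unfolding a_def by (rule sub[OF bdist_along_nodes[OF \<eta> t]])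
      have E0: "(\<lambda>i. E (r i)) \<longlonglongrightarrow> 0"
        unfolding E_def a_def by (rule sub[OF slope_error_tendsto[OF \<eta> t]])
      have Q: "(\<lambda>i. norm (q (r i) - w)) \<longlonglongrightarrow> 0"
        using w by (simp add: q_def LIM_zero tendsto_norm_zero)
      have "(\<lambda>i. 2 * (slope (r i) \<phi> t * bdist (\<eta> (a (r i))) - E (r i)) - norm (q (r i) - w))
          \<longlonglongrightarrow> 2 * (\<Phi> * bdist (\<eta> t) - 0) - 0"
        by (intro tendsto_intros \<Phi>' B E0 Q)
      moreover have "(1 - d1) * (\<rho> + \<rho>') < 2 * (\<Phi> * bdist (\<eta> t) - 0) - 0"
      proof -
        have "(1 - d1) * (\<rho> + \<rho>') < (1 - d) * (\<rho> + \<rho>')"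
          using d \<rho> \<rho>' by (intro mult_strict_right_mono) auto
        also have "\<dots> = 2 * (R * (1 - d) * ((1 / 2) * bdist (\<gamma> t) + (1 / 2) * bdist (\<sigma> t)))"
          by (simp add: \<rho>_def \<rho>'_def field_simps)
        also have "\<dots> \<le> 2 * (R * (1 - d) * bdist (\<eta> t))"
          unfolding \<eta>_def using R d t'
          by (intro mult_left_mono bdist_concave qcurve_in[OF \<gamma>] qcurve_in[OF \<sigma>]) auto
        also have "\<dots> \<le> 2 * (\<Phi> * bdist (\<eta> t))"
          using \<Phi>ge by (intro mult_left_mono mult_right_mono) (auto simp: infdist_nonneg)
        finally show ?thesis by simp
      qed
      ultimately have "\<forall>\<^sub>F i in sequentially. (1 - d1) * (\<rho> + \<rho>')
          < 2 * (slope (r i) \<phi> t * bdist (\<eta> (a (r i))) - E (r i)) - norm (q (r i) - w)"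
        by (rule order_tendstoD(1))
      then show ?thesis
      proof eventually_elim
        case (elim i)
        then show ?case
          using low[of "r i"] norm_triangle_ineq[of "w + p (r i)" "q (r i) - w"] by (simp add: algebra_simps)
      qed
    qed
    have "\<forall>\<^sub>F i in sequentially. norm (q (r i) - w) < e1"
      using tendstoD[OF w e1] by (simp add: q_def dist_norm)
    with p_up big have close: "\<forall>\<^sub>F i in sequentially. norm (p (r i) - q (r i)) \<le> C * e1 + R * D t + e1"
    proof eventually_elim
      case (elim i)
      define v where "v = (1 / \<rho>') *\<^sub>R p (r i)"
      have pv: "p (r i) = \<rho>' *\<^sub>R v" using \<rho>' by (simp add: v_def)
      have "norm v = norm (p (r i)) / \<rho>'" using \<rho>' by (simp add: v_def)
      also have "\<dots> \<le> 1 + d1" using elim(1) \<rho>' by (simp add: pos_divide_le_eq)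
      finally have "norm (v - u) < e1"
        using elim(2) by (intro d1(2)[OF \<rho> \<rho>' ratio]) (simp_all add: w_u pv)
      then have "\<rho>' * norm (v - u) \<le> C * e1" using \<rho>' \<rho>'C by (intro mult_mono) auto
      moreover have "\<bar>\<rho>' - \<rho>\<bar> \<le> R * D t"
      proof -
        have "\<rho>' - \<rho> = R * (bdist (\<sigma> t) - bdist (\<gamma> t))" by (simp add: \<rho>_def \<rho>'_def algebra_simps)
        then show ?thesis using R bdist_lipschitz[of "\<sigma> t" "\<gamma> t"] by (simp add: D_def abs_mult)
      qed
      \<comment> \<open>The error consists of a deviation in direction, small by rotundity, and a
        difference of speeds, at most \<open>R * D t\<close> because \<open>bdist\<close> is
        1-Lipschitz; the latter is the term that Gronwall's inequality absorbs.\<close>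
      moreover have "p (r i) - w = \<rho>' *\<^sub>R (v - u) + (\<rho>' - \<rho>) *\<^sub>R u"
        by (simp add: pv w_u algebra_simps)
      then have "norm (p (r i) - w) \<le> \<rho>' * norm (v - u) + \<bar>\<rho>' - \<rho>\<bar>"
        using norm_triangle_ineq[of "\<rho>' *\<^sub>R (v - u)" "(\<rho>' - \<rho>) *\<^sub>R u"] \<rho>' u by simp
      ultimately show ?case
        using elim(3) norm_triangle_ineq4[of "p (r i) - w" "q (r i) - w"] by simp
    qed
    have Dcont: "continuous_on {0..1} D"
      unfolding D_def by (intro continuous_intros qcurve_continuous[OF \<gamma>] qcurve_continuous[OF \<sigma>])
    \<comment> \<open>A discrete product rule. The second summand carries the slope of the weight,
      and in the limit it cancels the term \<open>R * D t\<close> of \<open>close\<close>.\<close>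
    have G_slope: "slope j G t \<le> exp (- R * b j) * norm (p j - q j)
        + exp (- R * a j) * (2 ^ j * (exp (- R / 2 ^ j) - 1)) * D (a j)" for j
    proof -
      have "D (b j) - D (a j) \<le> norm (increment j \<sigma> (cell j t) - increment j \<gamma> (cell j t))"
        using norm_triangle_ineq2[of "\<sigma> (b j) - \<gamma> (b j)" "\<sigma> (a j) - \<gamma> (a j)"]
        by (simp add: D_def increment_def a_def b_def algebra_simps)
      also have "2 ^ j * \<dots> = norm (p j - q j)"
        by (simp add: p_def q_def slope_def flip: scaleR_diff_right)
      finally have "2 ^ j * (D (b j) - D (a j)) \<le> norm (p j - q j)" by simp
      then have "exp (- R * b j) * (2 ^ j * (D (b j) - D (a j))) \<le> exp (- R * b j) * norm (p j - q j)"
        by (rule mult_left_mono) simp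
      moreover have "exp (- R * b j) = exp (- R * a j) * exp (- R / 2 ^ j)"
        by (simp add: a_def b_def node_Suc exp_add[symmetric] algebra_simps)
      then have "slope j G t = exp (- R * b j) * (2 ^ j * (D (b j) - D (a j)))
          + exp (- R * a j) * (2 ^ j * (exp (- R / 2 ^ j) - 1)) * D (a j)"
        by (simp add: slope_def increment_def G_def a_def[symmetric] b_def[symmetric] algebra_simps)
      ultimately show ?thesis by linarith
    qed
    have ea: "(\<lambda>i. exp (- R * a (r i))) \<longlonglongrightarrow> exp (- R * t)" and eb: "(\<lambda>i. exp (- R * b (r i))) \<longlonglongrightarrow> exp (- R * t)"
      unfolding a_def b_def
      by (intro tendsto_intros sub node_cell_tendsto t'(1))+
    have Da: "(\<lambda>i. D (a (r i))) \<longlonglongrightarrow> D t"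
      unfolding a_def by (rule sub[OF along_nodes[OF Dcont t]])
    have eq: "(\<lambda>i. 2 ^ r i * (exp (- R / 2 ^ r i) - 1)) \<longlonglongrightarrow> - R"
      by (rule sub[OF exp_quotient_tendsto])
    have "\<Gamma> \<le> exp (- R * t) * (C * e1 + R * D t + e1) + exp (- R * t) * (- R) * D t"
    proof (rule tendsto_le[OF _ _ \<Gamma>])
      show "(\<lambda>i. exp (- R * b (r i)) * (C * e1 + R * D t + e1)
          + exp (- R * a (r i)) * (2 ^ r i * (exp (- R / 2 ^ r i) - 1)) * D (a (r i)))
          \<longlonglongrightarrow> exp (- R * t) * (C * e1 + R * D t + e1) + exp (- R * t) * (- R) * D t"
        by (intro tendsto_add tendsto_mult tendsto_const ea eb Da eq)
      show "\<forall>\<^sub>F i in sequentially. slope (r i) (\<lambda>s. exp (- R * s) * norm (\<sigma> s - \<gamma> s)) t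
          \<le> exp (- R * b (r i)) * (C * e1 + R * D t + e1)
            + exp (- R * a (r i)) * (2 ^ r i * (exp (- R / 2 ^ r i) - 1)) * D (a (r i))"
        using close
      proof eventually_elim
        case (elim i)
        then have "exp (- R * b (r i)) * norm (p (r i) - q (r i)) \<le> exp (- R * b (r i)) * (C * e1 + R * D t + e1)"
          by (rule mult_left_mono) simp
        then show ?case using G_slope[of "r i"] unfolding G_def D_def by linarith
      qed
    qed simp
    also have "\<dots> = exp (- R * t) * ((C + 1) * e1)" by (simp add: algebra_simps)
    also have "(C + 1) * e1 = e" using C by (simp add: e1_def)
    also have "exp (- R * t) * e \<le> 1 * e" using R t' e by (intro mult_right_mono) auto
    finally show ?thesis by simp
  qed
  with d(1) show ?thesis by blast
qed

end

section \<open>Convergence of midpoints\<close>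

lemma exp_minus_diff_le:
  fixes a b :: real
  assumes "0 \<le> a" "0 \<le> b" shows "\<bar>exp (- a) - exp (- b)\<bar> \<le> \<bar>a - b\<bar>"
proof -
  have *: "exp (- a) - exp (- b) \<le> b - a" "exp (- b) \<le> exp (- a)" if "0 \<le> a" "a \<le> b" for a b :: real
  proof -
    have "exp (- b) = exp (- a) * exp (- (b - a))" by (simp add: exp_add[symmetric])
    then have "exp (- a) - exp (- b) = exp (- a) * (1 - exp (- (b - a)))" by (simp add: algebra_simps)
    also have "\<dots> \<le> 1 * (b - a)"
    proof (rule mult_mono)
      show "1 - exp (- (b - a)) \<le> b - a" using exp_ge_add_one_self[of "- (b - a)"] by linarith
    qed (use that in auto)
    finally show "exp (- a) - exp (- b) \<le> b - a" by simp
    show "exp (- b) \<le> exp (- a)" using that by simp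
  qed
  show ?thesis
    using *[of a b] *[of b a] assms by (cases "a \<le> b") auto
qed

lemma weighted_distance_lipschitz:
  fixes \<sigma> \<gamma> :: "real \<Rightarrow> 'a::real_normed_vector"
  assumes \<sigma>: "C-lipschitz_on {0..1} \<sigma>" and \<gamma>: "C-lipschitz_on {0..1} \<gamma>" and "\<sigma> 0 = \<gamma> 0" and R: "0 \<le> R"
  shows "(2 * C + R * (2 * C))-lipschitz_on {0..1} (\<lambda>s. exp (- R * s) * norm (\<sigma> s - \<gamma> s))"
proof (rule lipschitz_onI)
  have C: "0 \<le> C" by (rule lipschitz_on_nonneg[OF \<sigma>])
  then show "0 \<le> 2 * C + R * (2 * C)" using R by simp
  fix s t :: real assume st: "s \<in> {0..1}" "t \<in> {0..1}"
  define D where "D s = norm (\<sigma> s - \<gamma> s)" for s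
  have Dlip: "\<bar>D a - D b\<bar> \<le> 2 * C * \<bar>a - b\<bar>" if "a \<in> {0..1}" "b \<in> {0..1}" for a b
  proof -
    have "\<bar>D a - D b\<bar> \<le> norm ((\<sigma> a - \<sigma> b) - (\<gamma> a - \<gamma> b))"
      using norm_triangle_ineq3[of "\<sigma> a - \<gamma> a" "\<sigma> b - \<gamma> b"] by (simp add: D_def algebra_simps)
    also have "\<dots> \<le> norm (\<sigma> a - \<sigma> b) + norm (\<gamma> a - \<gamma> b)" by (rule norm_triangle_ineq4)
    also have "\<dots> \<le> C * \<bar>a - b\<bar> + C * \<bar>a - b\<bar>"
      using lipschitz_onD[OF \<sigma> that] lipschitz_onD[OF \<gamma> that] by (simp add: dist_norm)
    finally show ?thesis by simp
  qed
  have "\<bar>D s\<bar> \<le> 2 * C * \<bar>s - 0\<bar>" using Dlip[of s 0] st assms(3) by (simp add: D_def)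
  also have "\<dots> \<le> 2 * C * 1" using st C by (intro mult_left_mono) auto
  finally have Ds: "\<bar>D s\<bar> \<le> 2 * C" by simp
  have "exp (- R * t) * D t - exp (- R * s) * D s
      = exp (- R * t) * (D t - D s) + (exp (- (R * t)) - exp (- (R * s))) * D s"
    by (simp add: algebra_simps)
  then have "\<bar>exp (- R * t) * D t - exp (- R * s) * D s\<bar>
      \<le> exp (- R * t) * \<bar>D t - D s\<bar> + \<bar>exp (- (R * t)) - exp (- (R * s))\<bar> * \<bar>D s\<bar>"
    by (metis abs_exp_cancel abs_mult abs_triangle_ineq)
  also have "\<dots> \<le> 1 * (2 * C * \<bar>t - s\<bar>) + \<bar>R * t - R * s\<bar> * (2 * C)"
    using st R C Ds Dlip[of t s] by (intro add_mono mult_mono exp_minus_diff_le) auto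
  also have "\<bar>R * t - R * s\<bar> = R * \<bar>t - s\<bar>" using R by (simp add: abs_mult flip: right_diff_distrib)
  finally show "dist (exp (- R * s) * norm (\<sigma> s - \<gamma> s)) (exp (- R * t) * norm (\<sigma> t - \<gamma> t))
      \<le> (2 * C + R * (2 * C)) * dist s t"
    by (simp add: D_def dist_real_def abs_minus_commute algebra_simps)
qed

context convex_domain
begin

lemma qh_to_qcurve_lipschitz:
  assumes x: "x \<in> \<Omega>" and \<eta>: "qcurve R \<eta>"
  shows "R-lipschitz_on {0..1} (\<lambda>s. qh x (\<eta> s))"
proof (rule lipschitz_onI)
  have *: "\<bar>qh x (\<eta> s) - qh x (\<eta> t)\<bar> \<le> R * (t - s)" if st: "0 \<le> s" "s \<le> t" "t \<le> 1" for s t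
  proof -
    have in\<Omega>: "\<eta> s \<in> \<Omega>" "\<eta> t \<in> \<Omega>" using st by (auto intro!: qcurve_in[OF \<eta>])
    show ?thesis
      using qh_triangle[OF x in\<Omega>] qh_triangle[OF x in\<Omega>(2,1)] qh_commute[OF in\<Omega>] qcurve_le[OF \<eta> st] by linarith
  qed
  fix s t :: real assume "s \<in> {0..1}" "t \<in> {0..1}"
  then show "dist (qh x (\<eta> s)) (qh x (\<eta> t)) \<le> R * dist s t"
    using *[of s t] *[of t s] by (cases "s \<le> t") (auto simp: dist_real_def abs_minus_commute)
qed (rule qcurve_nonneg[OF \<eta>])

text \<open>Convergence in \<open>L1\<close> yields convergence almost everywhere only along a
  subsequence, hence the form of the conclusion.\<close>

lemma qh_midpoint_subseq:
  assumes LUR: "locally_uniformly_rotund (norm :: 'a \<Rightarrow> real)" and refl: "reflexive_space TYPE('a)"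
    and x: "x \<in> \<Omega>" and y: "y \<in> \<Omega>" and z: "\<And>n. z n \<in> \<Omega>"
    and R: "0 < R" "qh x y = R" "\<And>n. qh x (z n) = R"
    and mid: "(\<lambda>n. qh x ((1 / 2) *\<^sub>R (y + z n))) \<longlonglongrightarrow> R"
  shows "\<exists>s :: nat \<Rightarrow> nat. strict_mono s \<and> (\<lambda>n. z (s n)) \<longlonglongrightarrow> y"
proof -
  obtain \<gamma> where \<gamma>: "qcurve R \<gamma>" "\<gamma> 0 = x" "\<gamma> 1 = y" using geodesic_exists[OF refl x y] R(2) by blast
  have "\<exists>\<sigma>. qcurve R \<sigma> \<and> \<sigma> 0 = x \<and> \<sigma> 1 = z n" for n using geodesic_exists[OF refl x z] R(3) by metis
  then obtain \<sigma> where \<sigma>: "\<And>n. qcurve R (\<sigma> n)" "\<And>n. \<sigma> n 0 = x" "\<And>n. \<sigma> n 1 = z n" by metis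
  define C where "C = bdist x * exp R * (R * exp R)"
  have \<gamma>L: "C-lipschitz_on {0..1} \<gamma>" using qcurve_lipschitz[OF \<gamma>(1)] by (simp add: C_def \<gamma>(2))
  have \<sigma>L: "C-lipschitz_on {0..1} (\<sigma> n)" for n using qcurve_lipschitz[OF \<sigma>(1), of n] by (simp add: C_def \<sigma>(2))
  have "\<exists>f :: 'a \<Rightarrow>\<^sub>L real. (\<forall>v. \<bar>f v\<bar> \<le> norm v) \<and> f (increment j \<gamma> m) = norm (increment j \<gamma> m)" for j m
    by (rule norming_functional[of "increment j \<gamma> m"]) blast
  then obtain f :: "nat \<Rightarrow> nat \<Rightarrow> 'a \<Rightarrow>\<^sub>L real" where
    f: "\<And>j m v. \<bar>f j m v\<bar> \<le> norm v" "\<And>j m. f j m (increment j \<gamma> m) = norm (increment j \<gamma> m)"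
    by metis
  define g where "g j m = (\<lambda>s. f j m (\<gamma> s))" for j m
  define \<phi> where "\<phi> n = (\<lambda>s. qh x ((1 / 2) *\<^sub>R \<gamma> s + (1 / 2) *\<^sub>R \<sigma> n s))" for n
  define G where "G n = (\<lambda>s. exp (- R * s) * norm (\<sigma> n s - \<gamma> s))" for n
  define C' where "C' = 2 * C + R * (2 * C)"
  have gL: "C-lipschitz_on {0..1} (g j m)" for j m
  proof (rule lipschitz_onI)
    fix s t :: real assume "s \<in> {0..1}" "t \<in> {0..1}"
    then have "dist (\<gamma> s) (\<gamma> t) \<le> C * dist s t" by (rule lipschitz_onD[OF \<gamma>L])
    then show "dist (g j m s) (g j m t) \<le> C * dist s t"
      using f(1)[of j m "\<gamma> s - \<gamma> t"] by (simp add: g_def dist_norm blinfun.diff_right)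
  qed (rule lipschitz_on_nonneg[OF \<gamma>L])
  have \<phi>L: "R-lipschitz_on {0..1} (\<phi> n)" for n
    unfolding \<phi>_def by (intro qh_to_qcurve_lipschitz x qcurve_convex_combination \<gamma> \<sigma>) simp_all
  have GL: "C'-lipschitz_on {0..1} (G n)" for n
    unfolding G_def C'_def using R(1) by (intro weighted_distance_lipschitz \<gamma>L \<sigma>L) (simp_all add: \<gamma> \<sigma>)
  \<comment> \<open>Three countable families are interleaved by residues modulo 3, the pairs being
    coded by \<open>prod_decode\<close>, so that a single \<open>r\<close> works for all.\<close>
  define fam where "fam i = (if i mod 3 = 0 then case_prod g (prod_decode (i div 3))
      else if i mod 3 = 1 then \<phi> (i div 3) else G (i div 3))" for i :: nat
  have "\<exists>C. C-lipschitz_on {0..1} (fam i)" for i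
  proof (cases "i mod 3 = 0")
    case True
    then show ?thesis using gL by (auto simp: fam_def split_beta)
  next
    case False
    then show ?thesis using \<phi>L[of "i div 3"] GL[of "i div 3"] unfolding fam_def by (cases "i mod 3 = 1") force+
  qed
  then obtain r where r: "strict_mono r" and conv: "AE t in unit_measure. \<forall>i. convergent (\<lambda>j. slope (r j) (fam i) t)"
    using slope_AE_convergent[of fam] by blast
  have fam0: "fam (3 * prod_encode (j, m)) = g j m" for j m by (simp add: fam_def)
  have fam1: "fam (3 * n + 1) = \<phi> n" for n
  proof -
    have "(3 * n + 1) mod 3 = 1" "(3 * n + 1) div 3 = n" by presburger+
    then show ?thesis unfolding fam_def by simp
  qed
  have fam2: "fam (3 * n + 2) = G n" for n
  proof -
    have "(3 * n + 2) mod 3 = 2" "(3 * n + 2) div 3 = n" by presburger+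
    then show ?thesis unfolding fam_def by simp
  qed
  have conv': "AE t in unit_measure. (\<forall>j m. convergent (\<lambda>i. slope (r i) (g j m) t)) \<and>
      (\<forall>n. convergent (\<lambda>i. slope (r i) (\<phi> n) t)) \<and> (\<forall>n. convergent (\<lambda>i. slope (r i) (G n) t))"
    using conv
  proof eventually_elim
    case (elim t)
    then show ?case unfolding fam0[symmetric] fam1[symmetric] fam2[symmetric] by blast
  qed
  have gconv: "AE t in unit_measure. \<forall>j m. convergent (\<lambda>i. slope (r i) (g j m) t)"
    using conv' by eventually_elim blast
  have \<phi>conv: "AE t in unit_measure. convergent (\<lambda>i. slope (r i) (\<phi> n) t)" for n
    using conv' by eventually_elim blast
  have Gconv: "AE t in unit_measure. convergent (\<lambda>i. slope (r i) (G n) t)" for n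
    using conv' by eventually_elim blast
  have in_unit: "AE t in unit_measure. t \<in> {0..<1}" by (rule AE_I2) (simp add: space_unit_measure)
  have limD: "(\<lambda>i. slope (r i) h t) \<longlonglongrightarrow> dslope r h t" if "convergent (\<lambda>i. slope (r i) h t)" for h t
    using that by (simp add: dslope_def convergent_LIMSEQ_iff)
  have lim_bound: "\<bar>dslope r h t\<bar> \<le> B" if "convergent (\<lambda>i. slope (r i) h t)" "B-lipschitz_on {0..1} h" "t \<in> {0..<1}" for h t B
    by (rule tendsto_upperbound[OF tendsto_rabs[OF limD[OF that(1)]]]) (simp_all add: slope_bound[OF that(2,3)])
  have \<gamma>lim: "AE t in unit_measure. \<exists>w. (\<lambda>i. slope (r i) \<gamma> t) \<longlonglongrightarrow> w"
    by (rule geodesic_slope_AE_convergent[OF LUR refl \<gamma>(1) _ R(1) r f(1,2) gconv[unfolded g_def]])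
       (simp add: \<gamma> R)
  note \<phi>int = dslope_integral_total[OF \<phi>L r \<phi>conv] and Gint = dslope_integral_total[OF GL r Gconv]
  \<comment> \<open>Since \<open>\<phi> n\<close> is \<open>R\<close>-Lipschitz, its slopes never
    exceed \<open>R\<close> and the \<open>L1\<close> defect equals
    \<open>R - (\<phi> n 1 - \<phi> n 0)\<close>, which the midpoint hypothesis sends to
    \<open>0\<close>.\<close>
  have "(\<integral>t. norm (R - dslope r (\<phi> n) t) \<partial>unit_measure) = R - qh x ((1 / 2) *\<^sub>R (y + z n))" for n
  proof -
    have "(\<integral>t. norm (R - dslope r (\<phi> n) t) \<partial>unit_measure) = (\<integral>t. R - dslope r (\<phi> n) t \<partial>unit_measure)"
    proof (rule integral_cong_AE)
      show "AE t in unit_measure. norm (R - dslope r (\<phi> n) t) = R - dslope r (\<phi> n) t"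
        using \<phi>conv[of n] in_unit
      proof eventually_elim
        case (elim t)
        then show ?case using lim_bound[OF elim(1) \<phi>L elim(2)] by simp
      qed
    qed simp_all
    also have "\<dots> = R - (\<phi> n 1 - \<phi> n 0)"
      using \<phi>int[of n] finite_measure.integrable_const[OF finite_unit_measure, of R] by (simp add: measure_unit_space)
    also have "\<phi> n 0 = 0"
      using qh_refl[OF x] by (simp add: \<phi>_def \<gamma> \<sigma> flip: scaleR_left_distrib)
    also have "\<phi> n 1 = qh x ((1 / 2) *\<^sub>R (y + z n))" by (simp add: \<phi>_def \<gamma> \<sigma> scaleR_add_right)
    finally show ?thesis by simp
  qed
  moreover have "(\<lambda>n. R - qh x ((1 / 2) *\<^sub>R (y + z n))) \<longlonglongrightarrow> 0"
    using tendsto_diff[OF tendsto_const mid, of R] by simp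
  ultimately have L1: "(\<lambda>n. \<integral>t. norm (R - dslope r (\<phi> n) t) \<partial>unit_measure) \<longlonglongrightarrow> 0" by simp
  have "integrable unit_measure (\<lambda>t. R - dslope r (\<phi> n) t)" for n
    using \<phi>int(1)[of n] finite_measure.integrable_const[OF finite_unit_measure, of R] by simp
  from tendsto_L1_AE_subseq[OF this L1]
  obtain s :: "nat \<Rightarrow> nat" where s: "strict_mono s"
    and \<Phi>lim: "AE t in unit_measure. (\<lambda>n. R - dslope r (\<phi> (s n)) t) \<longlonglongrightarrow> 0" by blast
  \<comment> \<open>\<open>slope_comparison\<close> bounds the derivative of \<open>G\<close> from
    above only, hence the positive part; its integral still dominates \<open>G (s n) 1\<close>, as
    \<open>G\<close> vanishes at \<open>0\<close>.\<close>
  have "AE t in unit_measure. (\<lambda>n. max 0 (dslope r (G (s n)) t)) \<longlonglongrightarrow> 0"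
    using \<Phi>lim \<gamma>lim conv' in_unit
  proof eventually_elim
    case (elim t)
    obtain w where w: "(\<lambda>i. slope (r i) \<gamma> t) \<longlonglongrightarrow> w" using elim(2) by blast
    have "(\<lambda>i. norm (slope (r i) \<gamma> t)) \<longlonglongrightarrow> bdist (\<gamma> t) * R"
      by (rule filterlim_compose[OF geodesic_norm_slope_tendsto[OF \<gamma>(1) _ elim(4)] filterlim_subseq[OF r]])
         (simp add: \<gamma> R)
    then have nw: "norm w = bdist (\<gamma> t) * R" using LIMSEQ_unique tendsto_norm[OF w] by blast
    show ?case
    proof (rule metric_LIMSEQ_I)
      fix e :: real assume e: "0 < e"
      then have "0 < e / 2" by simp
      from slope_comparison[OF LUR \<gamma>(1) R(1) r elim(4) w nw this]
      obtain d where d: "0 < d" "\<And>\<sigma> \<Phi> \<Gamma>. qcurve R \<sigma> \<Longrightarrow> \<sigma> 0 = \<gamma> 0 \<Longrightarrow>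
          (\<lambda>i. slope (r i) (\<lambda>s. qh (\<gamma> 0) ((1 / 2) *\<^sub>R \<gamma> s + (1 / 2) *\<^sub>R \<sigma> s)) t) \<longlonglongrightarrow> \<Phi> \<Longrightarrow>
          (\<lambda>i. slope (r i) (\<lambda>s. exp (- R * s) * norm (\<sigma> s - \<gamma> s)) t) \<longlonglongrightarrow> \<Gamma> \<Longrightarrow>
          R * (1 - d) \<le> \<Phi> \<Longrightarrow> \<Gamma> \<le> e / 2"
        by blast
      have "0 < R * d" using R d by simp
      then have "\<forall>\<^sub>F n in sequentially. R - dslope r (\<phi> (s n)) t < R * d" by (rule order_tendstoD(2)[OF elim(1)])
      then have "\<forall>\<^sub>F n in sequentially. dist (max 0 (dslope r (G (s n)) t)) 0 < e"
      proof eventually_elim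
        case (elim n)
        have "(\<lambda>i. slope (r i) (\<phi> (s n)) t) \<longlonglongrightarrow> dslope r (\<phi> (s n)) t"
          "(\<lambda>i. slope (r i) (G (s n)) t) \<longlonglongrightarrow> dslope r (G (s n)) t"
          using \<open>_ \<and> _ \<and> _\<close> by (auto intro!: limD)
        moreover have "R * (1 - d) \<le> dslope r (\<phi> (s n)) t" using elim by (simp add: right_diff_distrib)
        ultimately have "dslope r (G (s n)) t \<le> e / 2"
          by (intro d(2)[OF \<sigma>(1)[of "s n"]]) (simp_all add: \<phi>_def G_def \<gamma> \<sigma>)
        then show ?case using e by (simp add: dist_real_def max_def)
      qed
      then show "\<exists>N. \<forall>n\<ge>N. dist (max 0 (dslope r (G (s n)) t)) 0 < e" by (simp add: eventually_sequentially)
    qed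
  qed
  then have "(\<lambda>n. \<integral>t. max 0 (dslope r (G (s n)) t) \<partial>unit_measure) \<longlonglongrightarrow> (\<integral>t. 0 \<partial>unit_measure)"
  proof (rule integral_dominated_convergence[where w = "\<lambda>_. C'", rotated 3])
    show "integrable unit_measure (\<lambda>_. C')" by (rule finite_measure.integrable_const[OF finite_unit_measure])
    show "AE t in unit_measure. norm (max 0 (dslope r (G (s n)) t)) \<le> C'" for n
      using Gconv[of "s n"] in_unit
    proof eventually_elim
      case (elim t)
      then show ?case using lim_bound[OF elim(1) GL elim(2)] by (auto simp: max_def)
    qed
  qed simp_all
  then have up: "(\<lambda>n. \<integral>t. max 0 (dslope r (G (s n)) t) \<partial>unit_measure) \<longlonglongrightarrow> 0" by simp
  have "G (s n) 1 \<le> (\<integral>t. max 0 (dslope r (G (s n)) t) \<partial>unit_measure)" for n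
  proof -
    have "G (s n) 1 = (\<integral>t. dslope r (G (s n)) t \<partial>unit_measure)"
      using Gint(2)[of "s n"] by (simp add: G_def \<gamma> \<sigma>)
    also have "\<dots> \<le> (\<integral>t. max 0 (dslope r (G (s n)) t) \<partial>unit_measure)"
      using Gint(1)[of "s n"] by (intro integral_mono Bochner_Integration.integrable_max) simp_all
    finally show ?thesis .
  qed
  then have "(\<lambda>n. G (s n) 1) \<longlonglongrightarrow> 0"
    by (intro tendsto_sandwich[OF _ _ tendsto_const up]) (simp_all add: G_def)
  \<comment> \<open>The factor \<open>exp R\<close> undoes the weight at parameter \<open>1\<close>
    and leaves the distance between the endpoints.\<close>
  then have "(\<lambda>n. exp R * G (s n) 1) \<longlonglongrightarrow> exp R * 0" by (intro tendsto_intros)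
  then have "(\<lambda>n. norm (z (s n) - y)) \<longlonglongrightarrow> 0"
    by (simp add: G_def \<gamma> \<sigma> exp_minus field_simps)
  then have "(\<lambda>n. z (s n)) \<longlonglongrightarrow> y" by (simp add: tendsto_norm_zero_iff LIM_zero_iff)
  with s show ?thesis by blast
qed

text \<open>The hypotheses pass to subsequences, so a sequence that infinitely often stays away from
  \<open>y\<close> would contradict the subsequence version. Distance \<open>0\<close> is treated
  apart, because rotundity is applied at a derivative of positive norm.\<close>

lemma qh_midpoint_convergence:
  assumes LUR: "locally_uniformly_rotund (norm :: 'a \<Rightarrow> real)" and refl: "reflexive_space TYPE('a)"
    and x: "x \<in> \<Omega>" and y: "y \<in> \<Omega>" and z: "\<And>n. z n \<in> \<Omega>"
    and eq: "\<And>n. qh x y = qh x (z n)"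
    and mid: "(\<lambda>n. qh x ((1 / 2) *\<^sub>R (y + z n))) \<longlonglongrightarrow> qh x y"
  shows "z \<longlonglongrightarrow> y"
proof (cases "qh x y = 0")
  case True
  then have "x = y" "x = z n" for n
    using qh_eq_0[OF x y] qh_eq_0[OF x z[of n]] eq[of n] by auto
  then have "z = (\<lambda>_. y)" by auto
  then show ?thesis by simp
next
  case False
  then have R: "0 < qh x y" using qh_nonneg[OF x y] by simp
  show ?thesis
  proof (rule ccontr)
    assume "\<not> z \<longlonglongrightarrow> y"
    then obtain e where e: "0 < e" "\<exists>\<^sub>F n in sequentially. e \<le> dist (z n) y"
      by (auto simp: tendsto_iff not_eventually not_less)
    then have "infinite {n. e \<le> dist (z n) y}" by (simp add: frequently_cofinite cofinite_eq_sequentially[symmetric])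
    then obtain u :: "nat \<Rightarrow> nat" where u: "strict_mono u" "\<And>n. e \<le> dist (z (u n)) y"
      using infinite_enumerate by blast
    have "(\<lambda>n. qh x ((1 / 2) *\<^sub>R (y + z (u n)))) \<longlonglongrightarrow> qh x y"
      by (rule filterlim_compose[OF mid filterlim_subseq[OF u(1)]])
    from qh_midpoint_subseq[OF LUR refl x y z R HOL.refl eq[symmetric] this]
    obtain s where "(\<lambda>n. z (u (s n))) \<longlonglongrightarrow> y" by blast
    from tendstoD[OF this e(1)] obtain n where "dist (z (u (s n))) y < e" by (auto simp: eventually_sequentially)
    then show False using u(2)[of "s n"] by simp
  qed
qed

end

section \<open>Minkowski functionals of quasihyperbolic balls\<close>

context
  fixes B :: "'a::real_normed_vector set" and c M :: real
  assumes convexB: "convex B" and closedB: "closed B" and symB: "\<And>x. x \<in> B \<Longrightarrow> - x \<in> B"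
    and c: "0 < c" "\<And>x. norm x \<le> c \<Longrightarrow> x \<in> B"
    and M: "0 < M" "\<And>x. x \<in> B \<Longrightarrow> norm x \<le> M"
begin

abbreviation (input) mink :: "'a \<Rightarrow> real" where "mink \<equiv> minkowski_functional B"

lemma minkowski_set: "{l. 0 < l \<and> z \<in> (\<lambda>b. l *\<^sub>R b) ` B} = {l. 0 < l \<and> (1 / l) *\<^sub>R z \<in> B}"
proof (intro Collect_cong conj_cong refl iffI)
  fix l :: real assume l: "0 < l"
  { assume "z \<in> (\<lambda>b. l *\<^sub>R b) ` B" with l show "(1 / l) *\<^sub>R z \<in> B" by auto }
  { assume "(1 / l) *\<^sub>R z \<in> B"
    then have "l *\<^sub>R ((1 / l) *\<^sub>R z) \<in> (\<lambda>b. l *\<^sub>R b) ` B" by (rule imageI)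
    with l show "z \<in> (\<lambda>b. l *\<^sub>R b) ` B" by simp }
qed

lemma minkowski_eq: "mink z = Inf {l. 0 < l \<and> (1 / l) *\<^sub>R z \<in> B}"
  by (simp only: minkowski_functional_def minkowski_set)

lemma minkowski_set_bdd: "bdd_below {l. 0 < l \<and> (1 / l) *\<^sub>R z \<in> B}"
  by (rule bdd_belowI[of _ 0]) auto

lemma minkowski_set_nonempty: "{l. 0 < l \<and> (1 / l) *\<^sub>R z \<in> B} \<noteq> {}"
proof -
  define l where "l = (norm z + 1) / c"
  have "0 < norm z + 1" by (simp add: add_nonneg_pos)
  then have l: "0 < l" using c(1) by (simp add: l_def)
  moreover have "norm ((1 / l) *\<^sub>R z) \<le> c"
    using c(1) l \<open>0 < norm z + 1\<close> by (simp add: l_def field_simps)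
  ultimately show ?thesis using c(2) by blast
qed

text \<open>The infimum is attained: convexity together with \<open>0 \<in> B\<close> allows every
  scale above it, and closedness lets the scales \<open>l + 1 / (n + 1)\<close> decrease to
  \<open>l\<close>.\<close>

lemma minkowski_le_iff:
  assumes l: "0 < l" shows "mink z \<le> l \<longleftrightarrow> (1 / l) *\<^sub>R z \<in> B"
proof
  assume "(1 / l) *\<^sub>R z \<in> B"
  then show "mink z \<le> l" unfolding minkowski_eq using l by (intro cInf_lower minkowski_set_bdd) simp
next
  assume le: "mink z \<le> l"
  define u where "u n = (1 / (l + inverse (real (Suc n)))) *\<^sub>R z" for n
  have "u n \<in> B" for n
  proof -
    define k where "k = l + inverse (real (Suc n))"
    have k: "l < k" by (simp add: k_def)
    then have "mink z < k" using le by simp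
    then obtain m where m: "0 < m" "(1 / m) *\<^sub>R z \<in> B" "m < k"
      unfolding minkowski_eq using cInf_lessD[OF minkowski_set_nonempty] by blast
    have "(m / k) *\<^sub>R ((1 / m) *\<^sub>R z) + (1 - m / k) *\<^sub>R 0 \<in> B"
      using m k l c(2)[of 0] c(1) by (intro convexD[OF convexB]) auto
    then show ?thesis using m by (simp add: u_def k_def)
  qed
  moreover have "u \<longlonglongrightarrow> (1 / (l + 0)) *\<^sub>R z"
    unfolding u_def using l by (intro tendsto_intros LIMSEQ_inverse_real_of_nat) simp
  ultimately have "(1 / (l + 0)) *\<^sub>R z \<in> B" by (rule closed_sequentially[OF closedB])
  then show "(1 / l) *\<^sub>R z \<in> B" by simp
qed

lemma minkowski_nonneg: "0 \<le> mink z"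
  unfolding minkowski_eq by (rule cInf_greatest[OF minkowski_set_nonempty]) auto

lemma minkowski_upper: "mink z \<le> norm z / c"
proof (rule field_le_epsilon)
  fix e :: real assume e: "0 < e"
  define l where "l = norm z / c + e"
  have l: "0 < l" using e c(1) by (simp add: l_def add_nonneg_pos)
  have "norm z \<le> c * l" using c(1) e by (simp add: l_def distrib_left)
  then have "norm ((1 / l) *\<^sub>R z) \<le> c" using l by (simp add: pos_divide_le_eq)
  then show "mink z \<le> norm z / c + e" using minkowski_le_iff[OF l] c(2) by (simp add: l_def)
qed

lemma minkowski_lower: "norm z \<le> M * mink z"
proof -
  have "norm z / M \<le> mink z"
    unfolding minkowski_eq
  proof (rule cInf_greatest[OF minkowski_set_nonempty])
    fix l assume "l \<in> {l. 0 < l \<and> (1 / l) *\<^sub>R z \<in> B}"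
    then have l: "0 < l" "norm ((1 / l) *\<^sub>R z) \<le> M" using M(2)[of "(1 / l) *\<^sub>R z"] by auto
    then show "norm z / M \<le> l" using M(1) by (simp add: field_simps)
  qed
  then show ?thesis using M(1) by (simp add: field_simps)
qed

lemma minkowski_triangle: "mink (x + y) \<le> mink x + mink y"
proof (rule field_le_epsilon)
  fix e :: real assume e: "0 < e"
  define l m where "l = mink x + e / 2" and "m = mink y + e / 2"
  have lm: "0 < l" "0 < m" using e minkowski_nonneg[of x] minkowski_nonneg[of y] by (auto simp: l_def m_def)
  have "(1 / l) *\<^sub>R x \<in> B" "(1 / m) *\<^sub>R y \<in> B"
    using minkowski_le_iff[OF lm(1), of x] minkowski_le_iff[OF lm(2), of y] e by (auto simp: l_def m_def)
  then have "(l / (l + m)) *\<^sub>R ((1 / l) *\<^sub>R x) + (m / (l + m)) *\<^sub>R ((1 / m) *\<^sub>R y) \<in> B"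
    using lm by (intro convexD[OF convexB]) (auto simp: add_divide_distrib[symmetric])
  then have "(1 / (l + m)) *\<^sub>R (x + y) \<in> B" using lm by (simp add: scaleR_add_right)
  then have "mink (x + y) \<le> l + m" using minkowski_le_iff[of "l + m"] lm by simp
  then show "mink (x + y) \<le> mink x + mink y + e" by (simp add: l_def m_def)
qed

lemma minkowski_scale_le: "mink (a *\<^sub>R z) \<le> \<bar>a\<bar> * mink z"
proof (cases "a = 0")
  case True
  then show ?thesis using minkowski_upper[of "0 :: 'a"] by simp
next
  case False
  show ?thesis
  proof (rule field_le_epsilon)
    fix e :: real assume e: "0 < e"
    define l where "l = mink z + e / \<bar>a\<bar>"
    have l: "0 < l" using e False minkowski_nonneg[of z] by (simp add: l_def add_nonneg_pos)
    have "(1 / l) *\<^sub>R z \<in> B" using minkowski_le_iff[OF l, of z] e by (simp add: l_def)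
    then have "(sgn a / l) *\<^sub>R z \<in> B" using symB[of "(1 / l) *\<^sub>R z"] False by (auto simp: sgn_if)
    moreover have "sgn a / l = 1 / (\<bar>a\<bar> * l) * a" using False l by (simp add: sgn_if)
    ultimately have "(1 / (\<bar>a\<bar> * l)) *\<^sub>R (a *\<^sub>R z) \<in> B" by simp
    then have "mink (a *\<^sub>R z) \<le> \<bar>a\<bar> * l" using minkowski_le_iff[of "\<bar>a\<bar> * l"] False l by simp
    then show "mink (a *\<^sub>R z) \<le> \<bar>a\<bar> * mink z + e" using False by (simp add: l_def distrib_left)
  qed
qed

lemma minkowski_scale: "mink (a *\<^sub>R z) = \<bar>a\<bar> * mink z"
proof (rule antisym[OF minkowski_scale_le])
  show "\<bar>a\<bar> * mink z \<le> mink (a *\<^sub>R z)"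
  proof (cases "a = 0")
    case False
    have "mink ((1 / a) *\<^sub>R (a *\<^sub>R z)) \<le> \<bar>1 / a\<bar> * mink (a *\<^sub>R z)" by (rule minkowski_scale_le)
    then show ?thesis using False by (simp add: field_simps abs_divide)
  qed (simp add: minkowski_nonneg)
qed

lemma minkowski_equivalent_norm: "equivalent_norm mink"
  unfolding equivalent_norm_def is_norm_def
proof (intro conjI allI)
  show "mink x = 0 \<longleftrightarrow> x = 0" for x
    using minkowski_lower[of x] minkowski_upper[of "0 :: 'a"] minkowski_nonneg[of "0 :: 'a"] by auto
  have "1 / M * norm x \<le> mink x \<and> mink x \<le> 1 / c * norm x" for x
    using minkowski_lower[of x] minkowski_upper[of x] M(1) by (simp add: field_simps)
  then show "\<exists>b>0. \<exists>C>0. \<forall>x. b * norm x \<le> mink x \<and> mink x \<le> C * norm x"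
    using c(1) M(1) by (intro exI[of _ "1 / M"] exI[of _ "1 / c"] conjI) auto
qed (rule minkowski_nonneg minkowski_scale minkowski_triangle)+

end

context convex_domain
begin

section \<open>Balls about the centre of a symmetric domain\<close>

context
  assumes sym: "\<Omega> = uminus ` \<Omega>"
begin

lemma neg_in_iff: "- x \<in> \<Omega> \<longleftrightarrow> x \<in> \<Omega>"
  using sym by (metis imageI minus_minus)

lemma zero_in_domain: "0 \<in> \<Omega>"
proof -
  obtain x where "x \<in> \<Omega>" using nonempty_dom by blast
  then have "(1 / 2) *\<^sub>R x + (1 / 2) *\<^sub>R (- x) \<in> \<Omega>"
    using neg_in_iff[of x] by (intro convexD[OF convex_dom]) auto
  then show ?thesis by simp
qed

lemma frontier_neg: "f \<in> frontier \<Omega> \<Longrightarrow> - f \<in> frontier \<Omega>"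
  unfolding frontier_straddle mem_Collect_eq
proof (intro allI impI)
  fix e :: real
  assume H: "\<forall>e>0. (\<exists>x\<in>\<Omega>. dist f x < e) \<and> (\<exists>x. x \<notin> \<Omega> \<and> dist f x < e)" and e: "0 < e"
  obtain x where x: "x \<in> \<Omega>" "dist f x < e" using H e by blast
  obtain y where y: "y \<notin> \<Omega>" "dist f y < e" using H e by blast
  have "dist (- f) (- x) < e" "dist (- f) (- y) < e" using x y by (simp_all add: dist_minus)
  then show "(\<exists>x\<in>\<Omega>. dist (- f) x < e) \<and> (\<exists>x. x \<notin> \<Omega> \<and> dist (- f) x < e)"
    using x(1) y(1) neg_in_iff by blast
qed

lemma bdist_neg: "bdist (- x) = bdist x"
proof -
  have le: "bdist x \<le> bdist (- x)" for x
    unfolding infdist_notempty[OF frontier_ne, of "- x"]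
  proof (rule cINF_greatest[OF frontier_ne])
    fix f assume "f \<in> frontier \<Omega>"
    then show "bdist x \<le> dist (- x) f"
      using infdist_le[OF frontier_neg, of f x] dist_minus[of x "- f"] by simp
  qed
  show ?thesis using le[of x] le[of "- x"] by simp
qed

lemma qh_0_neg: assumes x: "x \<in> \<Omega>" shows "qh 0 (- x) \<le> qh 0 x"
proof (rule field_le_epsilon)
  fix e :: real assume e: "0 < e"
  obtain T and h :: "real \<Rightarrow> 'a" where h: "0 \<le> T" "1-lipschitz_on {0..T} h" "h ` {0..T} \<subseteq> \<Omega>" "h 0 = 0" "h T = x"
    "integral {0..T} (\<lambda>t. 1 / bdist (h t)) < qh 0 x + e"
    using qh_curve_exists[OF zero_in_domain x, of "qh 0 x + e"] e by auto
  have L: "1-lipschitz_on {0..T} (\<lambda>t. - h t)"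
    using h(2) unfolding lipschitz_on_def by (simp add: dist_minus)
  have "(\<lambda>t. - h t) ` {0..T} \<subseteq> \<Omega>" using h(3) neg_in_iff by auto
  from qh_le_curve[OF h(1) L this] show "qh 0 (- x) \<le> qh 0 x + e"
    using h(4,5,6) by (simp add: bdist_neg)
qed

context
  fixes r :: real assumes r: "0 < r"
begin

abbreviation (input) "Br \<equiv> qh_cball \<Omega> 0 r"

lemma qh_cball_bdist: "x \<in> Br \<Longrightarrow> bdist 0 * exp (- r) \<le> bdist x"
  by (auto simp: qh_cball_def intro: bdist_ge_qh[OF zero_in_domain])

lemma qh_cball_convex: "convex Br"
proof (rule convexI)
  fix x y and u v :: real assume xy: "x \<in> Br" "y \<in> Br" and uv: "0 \<le> u" "0 \<le> v" "u + v = 1"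
  have "qh (u *\<^sub>R 0 + v *\<^sub>R 0) (u *\<^sub>R x + v *\<^sub>R y) \<le> r"
    using xy by (intro qh_convex zero_in_domain uv) (auto simp: qh_cball_def)
  moreover have "u *\<^sub>R x + v *\<^sub>R y \<in> \<Omega>"
    using xy by (intro convexD[OF convex_dom _ _ uv]) (auto simp: qh_cball_def)
  ultimately show "u *\<^sub>R x + v *\<^sub>R y \<in> Br" by (simp add: qh_cball_def)
qed

lemma qh_cball_closed: "closed Br"
  unfolding closed_sequential_limits
proof (intro allI impI)
  fix u l assume H: "(\<forall>n. u n \<in> Br) \<and> u \<longlonglongrightarrow> l"
  define \<delta> where "\<delta> = bdist 0 * exp (- r)"
  have \<delta>: "0 < \<delta>" "\<delta> \<le> bdist 0"
    using bdist_pos[OF zero_in_domain] r by (auto simp: \<delta>_def mult_le_cancel_left1)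
  have "(0, u n) \<in> qh_rel \<delta> r" for n
    using H \<delta> zero_in_domain qh_cball_bdist[of "u n"] by (auto simp: qh_rel_def qh_cball_def \<delta>_def)
  moreover have "(\<lambda>n. (0 :: 'a, u n)) \<longlonglongrightarrow> (0, l)" using H by (intro tendsto_intros) simp
  ultimately have "(0, l) \<in> qh_rel \<delta> r" by (rule closed_sequentially[OF closed_qh_rel[OF \<delta>(1)]])
  then show "l \<in> Br" by (simp add: qh_rel_def qh_cball_def)
qed

lemma qh_cball_neg: "x \<in> Br \<Longrightarrow> - x \<in> Br"
  using qh_0_neg[of x] by (auto simp: qh_cball_def neg_in_iff)

text \<open>The radius solves \<open>\<rho> / (bdist 0 - \<rho>) = r\<close>, the equality case of
  the bound in \<open>qh_le_near\<close>.\<close>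

lemma qh_cball_inner:
  assumes "norm x \<le> bdist 0 * r / (1 + r)" shows "x \<in> Br"
proof -
  note b = bdist_pos[OF zero_in_domain]
  have le: "norm x * (1 + r) \<le> bdist 0 * r" using assms r by (simp add: pos_le_divide_eq)
  have "bdist 0 * r / (1 + r) < bdist 0" using b r by (simp add: field_simps)
  then have near: "norm (x - 0) < bdist 0" using assms by simp
  have "norm x / (bdist 0 - norm x) \<le> r"
    using le near by (simp add: pos_divide_le_eq algebra_simps)
  then show ?thesis using qh_le_near[OF zero_in_domain near] by (simp add: qh_cball_def)
qed

lemma qh_cball_outer: "x \<in> Br \<Longrightarrow> norm x \<le> bdist 0 * (exp r - 1)"
  using norm_diff_le_qh(1)[OF zero_in_domain, of x r] by (simp add: qh_cball_def)

lemma inner_pos: "0 < bdist 0 * r / (1 + r)" and outer_pos: "0 < bdist 0 * (exp r - 1)"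
  using bdist_pos[OF zero_in_domain] r by simp_all

lemma qh_cball_minkowski_le_iff: "0 < l \<Longrightarrow> minkowski_functional Br z \<le> l \<longleftrightarrow> (1 / l) *\<^sub>R z \<in> Br"
  by (rule minkowski_le_iff[OF qh_cball_convex qh_cball_closed qh_cball_neg inner_pos qh_cball_inner
      outer_pos qh_cball_outer])

lemma qh_cball_equivalent_norm: "equivalent_norm (minkowski_functional Br)"
  by (rule minkowski_equivalent_norm[OF qh_cball_convex qh_cball_closed qh_cball_neg inner_pos
      qh_cball_inner outer_pos qh_cball_outer])

text \<open>Were the distance of \<open>x\<close> below \<open>r\<close>, the dilated points
  \<open>(1 + 1 / (n + 1)) * x\<close> would eventually stay in the ball, and the functional would
  be less than \<open>1\<close> at \<open>x\<close>.\<close>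

lemma minkowski_1:
  assumes x: "minkowski_functional Br x = 1"
  shows "x \<in> \<Omega>" "qh 0 x = r"
proof -
  have xB: "x \<in> Br" using qh_cball_minkowski_le_iff[of 1 x] x by simp
  then show x\<Omega>: "x \<in> \<Omega>" by (simp add: qh_cball_def)
  show "qh 0 x = r"
  proof (rule ccontr)
    assume "qh 0 x \<noteq> r"
    then have lt: "qh 0 x < r" using xB by (simp add: qh_cball_def)
    define u where "u n = (1 + inverse (real (Suc n))) *\<^sub>R x" for n
    have "u \<longlonglongrightarrow> (1 + 0) *\<^sub>R x" unfolding u_def by (intro tendsto_intros LIMSEQ_inverse_real_of_nat)
    then have u: "u \<longlonglongrightarrow> x" by simp
    have "\<forall>\<^sub>F n in sequentially. u n \<in> \<Omega>" using topological_tendstoD[OF u open_dom x\<Omega>] .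
    moreover have "\<forall>\<^sub>F n in sequentially. qh x (u n) < r - qh 0 x"
      using order_tendstoD(2)[OF qh_tendsto_0[OF x\<Omega> u]] lt by simp
    ultimately have "\<forall>\<^sub>F n in sequentially. u n \<in> Br"
    proof eventually_elim
      case (elim n)
      then show ?case using qh_triangle[OF zero_in_domain x\<Omega> elim(1)] by (simp add: qh_cball_def)
    qed
    then obtain n where n: "u n \<in> Br" by (auto simp: eventually_sequentially)
    define l where "l = 1 / (1 + inverse (real (Suc n)))"
    have l: "0 < l" "l < 1" by (simp_all add: l_def add_pos_pos)
    have "1 / l = 1 + inverse (real (Suc n))" by (simp add: l_def)
    then have "minkowski_functional Br x \<le> l" using n qh_cball_minkowski_le_iff[OF l(1), of x] by (simp only: u_def)
    then show False using x l by simp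
  qed
qed

text \<open>Points of norm \<open>1\<close> lie at quasihyperbolic distance \<open>r\<close>, so the
  convergence of midpoints applies once their distances tend to \<open>r\<close>. For that, a
  midpoint is projected radially onto the unit sphere of the new norm, where the distance is exactly
  \<open>r\<close>; the projection moves it little in norm and hence in \<open>qh\<close>.\<close>

lemma qh_cball_LUR:
  assumes LUR: "locally_uniformly_rotund (norm :: 'a \<Rightarrow> real)" and refl: "reflexive_space TYPE('a)"
  shows "locally_uniformly_rotund (minkowski_functional Br)"
  unfolding locally_uniformly_rotund_def
proof (intro allI impI)
  let ?N = "minkowski_functional Br"
  fix x and u :: "nat \<Rightarrow> 'a"
  assume x: "?N x = 1" and u: "\<forall>n. ?N (u n) = 1"
    and mid: "(\<lambda>n. ?N ((1 / 2) *\<^sub>R (x + u n))) \<longlonglongrightarrow> 1"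
  obtain C where C: "0 < C" "\<And>z. ?N z \<le> C * norm z" and N: "is_norm ?N"
    using qh_cball_equivalent_norm unfolding equivalent_norm_def by blast
  have N_scale: "?N (a *\<^sub>R z) = \<bar>a\<bar> * ?N z" and N_nonneg: "0 \<le> ?N z"
    and N_add: "?N (z + z') \<le> ?N z + ?N z'" for a z z'
    using N unfolding is_norm_def by blast+
  note X = minkowski_1[OF x] and U = minkowski_1[OF u[rule_format]]
  define m where "m n = (1 / 2) *\<^sub>R (x + u n)" for n
  define s where "s n = ?N (m n)" for n
  define M where "M = bdist 0 * (exp r - 1)"
  define \<delta> where "\<delta> = bdist 0 * exp (- r)"
  have \<delta>: "0 < \<delta>" using bdist_pos[OF zero_in_domain] by (simp add: \<delta>_def)
  have s_lim: "s \<longlonglongrightarrow> 1" using mid by (simp add: s_def[abs_def] m_def)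
  have mB: "m n \<in> Br" for n
  proof -
    have "?N (m n) \<le> 1" using N_add[of x "u n"] x u by (simp add: m_def N_scale)
    then show ?thesis using qh_cball_minkowski_le_iff[of 1 "m n"] by simp
  qed
  have m: "m n \<in> \<Omega>" "qh 0 (m n) \<le> r" "\<delta> \<le> bdist (m n)" "norm (m n) \<le> M" for n
    using mB[of n] qh_cball_bdist[OF mB] qh_cball_outer[OF mB] by (auto simp: qh_cball_def \<delta>_def M_def)
  \<comment> \<open>Bounds the displacement of \<open>m n\<close> under the radial projection
    \<open>z\<close> below.\<close>
  define e where "e n = \<bar>1 / s n - 1\<bar> * M" for n
  have "(\<lambda>n. \<bar>1 / s n - 1\<bar> * M) \<longlonglongrightarrow> \<bar>1 / 1 - 1\<bar> * M" by (intro tendsto_intros s_lim) simp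
  then have e: "e \<longlonglongrightarrow> 0" by (simp add: e_def[abs_def])
  have "\<forall>\<^sub>F n in sequentially. e n < \<delta>" "\<forall>\<^sub>F n in sequentially. 0 < s n"
    using order_tendstoD(2)[OF e \<delta>] order_tendstoD(1)[OF s_lim, of 0] by simp_all
  then have low: "\<forall>\<^sub>F n in sequentially. r - e n / (\<delta> - e n) \<le> qh 0 (m n)"
  proof eventually_elim
    case (elim n)
    define z where "z = (1 / s n) *\<^sub>R m n"
    have "?N z = 1" using elim by (simp add: z_def N_scale s_def[symmetric])
    note Z = minkowski_1[OF this]
    have "z - m n = (1 / s n - 1) *\<^sub>R m n" by (simp add: z_def scaleR_left_diff_distrib)
    then have d: "norm (z - m n) \<le> e n" using m(4)[of n] by (simp add: e_def mult_left_mono)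
    then have near: "norm (z - m n) < bdist (m n)" using elim m(3)[of n] by linarith
    have "r \<le> qh 0 (m n) + qh (m n) z" using qh_triangle[OF zero_in_domain m(1) Z(1), of n] Z(2) by simp
    also have "qh (m n) z \<le> norm (z - m n) / (bdist (m n) - norm (z - m n))"
      by (rule qh_le_near(2)[OF m(1) near])
    also have "\<dots> \<le> e n / (\<delta> - e n)"
      using d elim m(3)[of n] order_trans[OF norm_ge_zero d] by (intro frac_le) auto
    finally show ?case by simp
  qed
  have "(\<lambda>n. r - e n / (\<delta> - e n)) \<longlonglongrightarrow> r - 0 / (\<delta> - 0)" using \<delta> by (intro tendsto_intros e) simp
  then have "(\<lambda>n. r - e n / (\<delta> - e n)) \<longlonglongrightarrow> r" by simp
  from tendsto_sandwich[OF low _ this tendsto_const] m(2)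
  have "(\<lambda>n. qh 0 (m n)) \<longlonglongrightarrow> r" by simp
  then have "u \<longlonglongrightarrow> x"
    using X U by (intro qh_midpoint_convergence[OF LUR refl zero_in_domain]) (simp_all add: m_def)
  then have "(\<lambda>n. C * norm (u n - x)) \<longlonglongrightarrow> C * 0"
    by (intro tendsto_intros) (simp add: LIM_zero tendsto_norm_zero)
  then have "(\<lambda>n. C * norm (u n - x)) \<longlonglongrightarrow> 0" by simp
  from tendsto_sandwich[OF _ _ tendsto_const this] C(2) N_nonneg
  show "(\<lambda>n. ?N (u n - x)) \<longlonglongrightarrow> 0" by simp
qed

end

end

end

theorem theorem3p2:
  fixes \<Omega> :: "'a::banach set"
  assumes dim_ge_2: "\<exists>B :: 'a set. independent B \<and> card B = 2"
    and reflexive: "reflexive_space TYPE('a)"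
    and LUR: "locally_uniformly_rotund (norm :: 'a \<Rightarrow> real)"
    and domain: "open \<Omega>" "connected \<Omega>" "\<Omega> \<noteq> {}"
    and proper: "\<Omega> \<noteq> UNIV"
    and convex: "convex \<Omega>"
  shows "(\<forall>x\<^sub>0\<in>\<Omega>. \<forall>y\<in>\<Omega>. \<forall>y' :: nat \<Rightarrow> 'a.
            (\<forall>n. y' n \<in> \<Omega>) \<longrightarrow>
            (\<forall>n. qh_dist \<Omega> x\<^sub>0 y = qh_dist \<Omega> x\<^sub>0 (y' n)) \<longrightarrow>
            (\<lambda>n. qh_dist \<Omega> x\<^sub>0 ((1 / 2) *\<^sub>R (y + y' n))) \<longlonglongrightarrow> qh_dist \<Omega> x\<^sub>0 y \<longrightarrow>
            y' \<longlonglongrightarrow> y) \<and>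
         (\<Omega> = uminus ` \<Omega> \<longrightarrow>
            (\<forall>r>0. equivalent_norm (minkowski_functional (qh_cball \<Omega> 0 r)) \<and>
                   locally_uniformly_rotund (minkowski_functional (qh_cball \<Omega> 0 r))))"
proof -
  interpret convex_domain \<Omega> by unfold_locales (use domain proper convex in auto)
  show ?thesis
    using qh_midpoint_convergence[OF LUR reflexive] qh_cball_equivalent_norm
      qh_cball_LUR[OF _ _ LUR reflexive] by blast
qed

end
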